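(* Let $\mathcal{C}$ be a class of graphs such that the minimum vertex cover problem restricted to graphs in $\mathcal{C}$ is NP-complete. Then MISP is NP-complete on the class of tournaments that have (with respect to some ordering of their vertices) a backedge graph in $\mathcal{C}^+$.
   Context: For a tournament $G$ on $n$ vertices and an ordering $(v_1,\dots,v_n)$ of $V(G)$, an arc $(v_i,v_j)$ (i.e. $v_i\to v_j$) is a backedge if $i>j$; the backedge graph is the undirected graph on $\{v_1,\dots,v_n\}$ with $v_iv_j$ an edge iff $(v_i,v_j)$ is a backedge. For a graph $G$ with $n$ vertices, $G^+$ denotes $G$ together with $n$ additional isolated vertices, and $\mathcal{C}^+=\{G^+: G\in\mathcal{C}\}$. Minimum vertex cover problem: given a graph, find the minimum size of a set of vertices meeting every edge. A set of vertices of a tournament is independent if it induces a transitive (acyclic) subtournament. MISP (decision version): given a tournament $G$ and a positive integer $k$, decide whether $G$ has an independent set of size at least $k$. *)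

theory Defs
  imports Main "HOL-Computational_Algebra.Polynomial"
begin

section \<open>Polynomial time on multi-tape Turing machines\<close>

text \<open>
  A two-way infinite tape is a pair \<open>(ls, rs)\<close>: \<open>ls\<close> is what lies to the left of the head, nearest
  cell first, and \<open>rs\<close> starts with the scanned cell. All cells not listed are blank.
  Symbols are natural numbers: 0 is the blank, 1 and 2 stand for the bits 0 and 1, and a machine may
  use further work symbols below its alphabet size.
\<close>

type_synonym tape = "nat list \<times> nat list"

datatype move = MoveLeft | Stay | MoveRight

definition cell_hd :: "nat list \<Rightarrow> nat" where
  "cell_hd xs = (case xs of [] \<Rightarrow> 0 | x # _ \<Rightarrow> x)"

definition read_tape :: "tape \<Rightarrow> nat" where
  "read_tape t = cell_hd (snd t)"

fun write_move :: "nat \<times> move \<Rightarrow> tape \<Rightarrow> tape" where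
  "write_move (s, MoveLeft) (ls, rs) = (tl ls, cell_hd ls # s # tl rs)"
| "write_move (s, Stay) (ls, rs) = (ls, s # tl rs)"
| "write_move (s, MoveRight) (ls, rs) = (s # ls, tl rs)"

text \<open>
  The states are \<open>0, \<dots>, tm_states\<close>; the start state is 0 and the only halting state is \<open>tm_states\<close>.
  The transition function maps a state and the list of scanned symbols to the next state and the
  list of symbols to write together with the head moves. Only its values on the finitely many
  arguments constrained in \<open>wf_tm\<close> are ever used.
\<close>

record tm =
  tm_tapes :: nat
  tm_alphabet :: nat
  tm_states :: nat
  tm_delta :: "nat \<Rightarrow> nat list \<Rightarrow> nat \<times> (nat \<times> move) list"

definition wf_tm :: "tm \<Rightarrow> bool" where
  "wf_tm M \<longleftrightarrow> tm_tapes M \<ge> 2 \<and> tm_alphabet M \<ge> 3 \<and>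
     (\<forall>q < tm_states M. \<forall>ss. length ss = tm_tapes M \<and> (\<forall>s \<in> set ss. s < tm_alphabet M) \<longrightarrow>
        (case tm_delta M q ss of (q', as) \<Rightarrow>
           q' \<le> tm_states M \<and> length as = tm_tapes M \<and> (\<forall>a \<in> set as. fst a < tm_alphabet M)))"

type_synonym config = "nat \<times> tape list"

definition tm_step :: "tm \<Rightarrow> config \<Rightarrow> config" where
  "tm_step M c = (case c of (q, ts) \<Rightarrow>
     if q = tm_states M then (q, ts)
     else (case tm_delta M q (map read_tape ts) of (q', as) \<Rightarrow> (q', map2 write_move as ts)))"

definition bit_symbol :: "bool \<Rightarrow> nat" where
  "bit_symbol b = (if b then 2 else 1)"

text \<open>The input is on tape 0, with the head on its first symbol; the other tapes are blank.\<close>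

definition tm_init :: "tm \<Rightarrow> bool list \<Rightarrow> config" where
  "tm_init M x = (0, ([], map bit_symbol x) # replicate (tm_tapes M - 1) ([], []))"

text \<open>The output is the longest block of bits on tape 1 that starts at the head.\<close>

definition tm_output :: "config \<Rightarrow> bool list" where
  "tm_output c = map (\<lambda>s. s = 2) (takeWhile (\<lambda>s. s = 1 \<or> s = 2) (snd (snd c ! 1)))"

text \<open>As halting configurations are fixed points of \<open>tm_step\<close>, having halted after exactly \<open>t\<close>
  applications of it means having halted after at most \<open>t\<close> steps.\<close>

definition tm_computes_within :: "tm \<Rightarrow> bool list \<Rightarrow> bool list \<Rightarrow> nat \<Rightarrow> bool" where
  "tm_computes_within M x y t \<longleftrightarrow>
     (let c = (tm_step M ^^ t) (tm_init M x) in fst c = tm_states M \<and> tm_output c = y)"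

definition polytime_computable :: "(bool list \<Rightarrow> bool list) \<Rightarrow> bool" where
  "polytime_computable f \<longleftrightarrow>
     (\<exists>M (p :: nat poly). wf_tm M \<and> (\<forall>x. tm_computes_within M x (f x) (poly p (length x))))"


section \<open>NP and NP-completeness\<close>

definition pair_string :: "bool list \<Rightarrow> bool list \<Rightarrow> bool list" where
  "pair_string x u = concat (map (\<lambda>b. [b, b]) x) @ [False, True] @ u"

definition NP :: "bool list set set" where
  "NP = {L. \<exists>f (p :: nat poly). polytime_computable f \<and>
     (\<forall>x. x \<in> L \<longleftrightarrow> (\<exists>u. length u \<le> poly p (length x) \<and> f (pair_string x u) = [True]))}"

text \<open>
  A decision problem is a set of instances together with the subset of its yes-instances, both
  encoded as bit strings. Restricting a problem to a class shrinks the set of instances: algorithms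
  need only be correct on instances, and reductions must produce instances. For a problem all of
  whose strings are instances, the following is the usual NP-completeness of a language.
\<close>

record problem =
  instances :: "bool list set"
  yes_instances :: "bool list set"

definition in_NP :: "problem \<Rightarrow> bool" where
  "in_NP P \<longleftrightarrow> (\<exists>L \<in> NP. yes_instances P = L \<inter> instances P)"

definition NP_hard :: "problem \<Rightarrow> bool" where
  "NP_hard P \<longleftrightarrow> (\<forall>L \<in> NP. \<exists>f. polytime_computable f \<and>
     (\<forall>x. f x \<in> instances P \<and> (x \<in> L \<longleftrightarrow> f x \<in> yes_instances P)))"

definition NP_complete :: "problem \<Rightarrow> bool" where
  "NP_complete P \<longleftrightarrow> in_NP P \<and> NP_hard P"


section \<open>Graphs and vertex covers\<close>

type_synonym graph = "nat set \<times> nat set set"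

definition simple_graph :: "graph \<Rightarrow> bool" where
  "simple_graph G \<longleftrightarrow> finite (fst G) \<and> (\<forall>e \<in> snd G. e \<subseteq> fst G \<and> card e = 2)"

definition graph_iso :: "graph \<Rightarrow> graph \<Rightarrow> bool" where
  "graph_iso G H \<longleftrightarrow> (\<exists>f. bij_betw f (fst G) (fst H) \<and> snd H = (\<lambda>e. f ` e) ` snd G)"

definition iso_closure :: "graph set \<Rightarrow> graph set" where
  "iso_closure C = {H. \<exists>G \<in> C. graph_iso G H}"

text \<open>As the added isolated vertices have no preferred names, every choice \<open>W\<close> of them is included.\<close>

definition graphs_plus :: "graph set \<Rightarrow> graph set" where
  "graphs_plus C =
     {(V \<union> W, E) | V E W. (V, E) \<in> C \<and> finite W \<and> V \<inter> W = {} \<and> card W = card V}"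

definition vertex_cover :: "graph \<Rightarrow> nat set \<Rightarrow> bool" where
  "vertex_cover G S \<longleftrightarrow> S \<subseteq> fst G \<and> (\<forall>e \<in> snd G. e \<inter> S \<noteq> {})"

definition min_vertex_cover_size :: "graph \<Rightarrow> nat" where
  "min_vertex_cover_size G = (LEAST m. \<exists>S. vertex_cover G S \<and> card S = m)"


section \<open>Tournaments and backedge graphs\<close>

type_synonym digraph = "nat set \<times> (nat \<times> nat) set"

definition tournament :: "digraph \<Rightarrow> bool" where
  "tournament T \<longleftrightarrow> finite (fst T) \<and> snd T \<subseteq> fst T \<times> fst T \<and> (\<forall>v. (v, v) \<notin> snd T) \<and>
     (\<forall>u \<in> fst T. \<forall>v \<in> fst T. u \<noteq> v \<longrightarrow> ((u, v) \<in> snd T) \<noteq> ((v, u) \<in> snd T))"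

definition vertex_ordering :: "digraph \<Rightarrow> nat list \<Rightarrow> bool" where
  "vertex_ordering T vs \<longleftrightarrow> distinct vs \<and> set vs = fst T"

definition backedge_graph :: "digraph \<Rightarrow> nat list \<Rightarrow> graph" where
  "backedge_graph T vs =
     (fst T, {{vs ! i, vs ! j} | i j. j < i \<and> i < length vs \<and> (vs ! i, vs ! j) \<in> snd T})"

definition tournaments_with_backedge_graph_in :: "graph set \<Rightarrow> digraph set" where
  "tournaments_with_backedge_graph_in D =
     {T. tournament T \<and> (\<exists>vs. vertex_ordering T vs \<and> backedge_graph T vs \<in> iso_closure D)}"

definition tournament_independent :: "digraph \<Rightarrow> nat set \<Rightarrow> bool" where
  "tournament_independent T S \<longleftrightarrow> S \<subseteq> fst T \<and> acyclic (Restr (snd T) S)"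


section \<open>The two decision problems\<close>

text \<open>Binary notation, least significant bit first, without superfluous zeros.\<close>

fun nat_bits :: "nat \<Rightarrow> bool list" where
  "nat_bits n = (if n = 0 then [] else odd n # nat_bits (n div 2))"

declare nat_bits.simps [simp del]

text \<open>A (di)graph on the vertices \<open>0, \<dots>, n - 1\<close> with a number \<open>k\<close>: the number of vertices in unary,
  the adjacency matrix row by row, and \<open>k\<close> in binary.\<close>

definition encode_instance :: "nat \<Rightarrow> (nat \<Rightarrow> nat \<Rightarrow> bool) \<Rightarrow> nat \<Rightarrow> bool list" where
  "encode_instance n adj k =
     replicate n True @ [False] @ concat (map (\<lambda>i. map (adj i) [0..<n]) [0..<n]) @ nat_bits k"

definition encode_graph :: "nat \<Rightarrow> nat set set \<Rightarrow> nat \<Rightarrow> bool list" where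
  "encode_graph n E k = encode_instance n (\<lambda>i j. {i, j} \<in> E) k"

definition encode_digraph :: "nat \<Rightarrow> (nat \<times> nat) set \<Rightarrow> nat \<Rightarrow> bool list" where
  "encode_digraph n A k = encode_instance n (\<lambda>i j. (i, j) \<in> A) k"

text \<open>Every finite graph has an isomorphic copy on an initial segment of the natural numbers, and
  these copies are the possible inputs; hence the closure under isomorphism.\<close>

definition vertex_cover_problem :: "graph set \<Rightarrow> problem" where
  "vertex_cover_problem C =
     \<lparr>instances = {encode_graph n E k | n E k. ({..<n}, E) \<in> iso_closure C},
      yes_instances = {encode_graph n E k | n E k. ({..<n}, E) \<in> iso_closure C \<and>
        min_vertex_cover_size ({..<n}, E) \<le> k}\<rparr>"

definition MISP :: "digraph set \<Rightarrow> problem" where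
  "MISP \<T> =
     \<lparr>instances = {encode_digraph n A k | n A k. ({..<n}, A) \<in> \<T> \<and> k \<ge> 1},
      yes_instances = {encode_digraph n A k | n A k. ({..<n}, A) \<in> \<T> \<and> k \<ge> 1 \<and>
        (\<exists>S. tournament_independent ({..<n}, A) S \<and> card S \<ge> k)}\<rparr>"

end

theory Submission
  imports Defs
begin

text \<open>
  Put the isolated vertices of \<open>G\<^sup>+\<close> alternately between the vertices of \<open>G\<close>. In the tournament with
  this backedge graph, deleting a vertex cover of \<open>G\<close> leaves no backedge. Conversely, a backedge
  whose two ends lie in a transitive set forms a directed triangle with the isolated vertex after
  its first end, so that this isolated vertex is missing from the set; hence a transitive set
  that misses \<open>m\<close> vertices yields a vertex cover with at most \<open>m\<close> vertices. So \<open>G\<close> has a vertex cover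
  of size \<open>k\<close> iff the tournament has a transitive set of size \<open>2 * n - k\<close>.

  Turing machines are programmed in a small language whose registers are tapes used as stacks. Its
  loops run over registers that their bodies do not change, which makes polynomial running time
  automatic. The composition of an arbitrary polynomial-time machine with such a program is
  polynomial-time, too.
\<close>

section \<open>Combining Turing machines\<close>

text \<open>NP-hardness of vertex cover on \<open>C\<close> only yields, for every \<open>L\<close>
  in \<open>NP\<close>, an unknown polynomial-time function \<open>f\<close>, and the reduction to
  MISP is \<open>f\<close> followed by the graph transformation. This forces a composition theorem
  for a machine of which little more than a time bound is known: it may leave its tapes littered,
  and its symbols have to be shown to stay in the alphabet. Two mismatches between the problems
  shape the transformation. MISP asks for a positive threshold, while \<open>2 * n - k\<close> may
  vanish; the threshold is therefore \<open>Suc (2 * n - 1 - k)\<close>, the maximum of 1 and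
  \<open>2 * n - k\<close>, and raising 0 to 1 is harmless as soon as there is a vertex. For
  \<open>n = 0\<close> it is not harmless, so these inputs are sent to a fixed yes-instance. For
  membership in NP, acyclicity is replaced by transitivity, which is equivalent in a tournament and
  needs only a test of all triples.\<close>

inductive tm_runs :: "tm \<Rightarrow> config \<Rightarrow> nat \<Rightarrow> config \<Rightarrow> bool" for M where
  tm_runs_refl: "tm_runs M c 0 c"
| tm_runs_step: "q < tm_states M \<Longrightarrow> tm_delta M q (map read_tape ts) = (q', as) \<Longrightarrow>
    tm_runs M (q', map2 write_move as ts) t c \<Longrightarrow> tm_runs M (q, ts) (Suc t) c"

lemma tm_runs_trans: "tm_runs M c s c' \<Longrightarrow> tm_runs M c' t c'' \<Longrightarrow> tm_runs M c (s + t) c''"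
  by (induction rule: tm_runs.induct) (auto intro: tm_runs.intros)

text \<open>A run never takes a step from the halting state, so only transitions out of proper
  states have to be matched, and \<open>emb\<close> may send the halting state anywhere: to the
  start of a second machine, to a common exit or back to a loop test.\<close>

lemma tm_runs_embed:
  assumes "tm_runs M c t c'"
    and emb: "\<And>q ss. q < tm_states M \<Longrightarrow>
      emb q < tm_states M' \<and> tm_delta M' (emb q) ss = apfst emb (tm_delta M q ss)"
  shows "tm_runs M' (apfst emb c) t (apfst emb c')"
  using assms(1)
proof (induction rule: tm_runs.induct)
  case (tm_runs_step q ts q' as t c)
  then show ?case
    using emb[of q "map read_tape ts"] by (auto intro!: tm_runs.tm_runs_step)
qed (auto intro: tm_runs.intros)

lemma tm_step_halted: "(tm_step M ^^ t) (tm_states M, ts) = (tm_states M, ts)"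
  by (induction t) (auto simp: tm_step_def)

lemma tm_runs_imp_funpow:
  "tm_runs M c t c' \<Longrightarrow> (tm_step M ^^ t) c = c'"
proof (induction rule: tm_runs.induct)
  case (tm_runs_step q ts q' as t c)
  then show ?case by (simp add: tm_step_def funpow_Suc_right del: funpow.simps)
qed auto

lemma tm_runs_halt:
  assumes "tm_runs M c t (tm_states M, ts)" "t \<le> T"
  shows "(tm_step M ^^ T) c = (tm_states M, ts)"
proof -
  have "(tm_step M ^^ T) c = (tm_step M ^^ (T - t)) ((tm_step M ^^ t) c)"
    using assms(2) by (metis comp_apply funpow_add le_add_diff_inverse2)
  then show ?thesis using tm_runs_imp_funpow[OF assms(1)] tm_step_halted by simp
qed

definition computes :: "tm \<Rightarrow> tape list \<Rightarrow> nat \<Rightarrow> tape list \<Rightarrow> bool" where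
  "computes M ts t ts' \<longleftrightarrow> (\<exists>s\<le>t. tm_runs M (0, ts) s (tm_states M, ts'))"

text \<open>The numbers of tapes and symbols are parameters because only machines that agree on both
  are combined; the lower bounds in \<open>wf_tm\<close> are left to the final machine.\<close>

definition wf_code :: "nat \<Rightarrow> nat \<Rightarrow> tm \<Rightarrow> bool" where
  "wf_code K A M \<longleftrightarrow> tm_tapes M = K \<and> tm_alphabet M = A \<and>
     (\<forall>q < tm_states M. \<forall>ss. length ss = K \<and> (\<forall>s \<in> set ss. s < A) \<longrightarrow>
        (case tm_delta M q ss of (q', as) \<Rightarrow>
           q' \<le> tm_states M \<and> length as = K \<and> (\<forall>a \<in> set as. fst a < A)))"

lemma wf_tm_iff_wf_code:
  "wf_tm M \<longleftrightarrow> tm_tapes M \<ge> 2 \<and> tm_alphabet M \<ge> 3 \<and> wf_code (tm_tapes M) (tm_alphabet M) M"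
  by (auto simp: wf_tm_def wf_code_def)

lemma wf_codeI:
  assumes "tm_tapes M = K" "tm_alphabet M = A"
    and "\<And>q ss. q < tm_states M \<Longrightarrow> length ss = K \<Longrightarrow> \<forall>s \<in> set ss. s < A \<Longrightarrow>
      fst (tm_delta M q ss) \<le> tm_states M \<and> length (snd (tm_delta M q ss)) = K \<and>
      (\<forall>a \<in> set (snd (tm_delta M q ss)). fst a < A)"
  shows "wf_code K A M"
  using assms unfolding wf_code_def case_prod_beta by blast

lemma wf_codeD:
  assumes "wf_code K A M"
  shows "tm_tapes M = K" "tm_alphabet M = A"
    and "q < tm_states M \<Longrightarrow> length ss = K \<Longrightarrow> \<forall>s \<in> set ss. s < A \<Longrightarrow>
      fst (tm_delta M q ss) \<le> tm_states M \<and> length (snd (tm_delta M q ss)) = K \<and>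
      (\<forall>a \<in> set (snd (tm_delta M q ss)). fst a < A)"
  using assms unfolding wf_code_def case_prod_beta by blast+

abbreviation keep :: "nat list \<Rightarrow> (nat \<times> move) list" where
  "keep ss \<equiv> map (\<lambda>s. (s, Stay)) ss"

text \<open>A step that leaves a tape alone still writes the scanned symbol back. On an exhausted
  right part this turns the implicit blank into an explicit 0, so idle tapes are preserved only up
  to \<open>refresh\<close>.\<close>

definition refresh :: "tape \<Rightarrow> tape" where
  "refresh t = (fst t, read_tape t # tl (snd t))"

lemma write_move_Stay_read: "write_move (read_tape t, Stay) t = refresh t"
  by (cases t) (simp add: refresh_def)

lemma map2_keep: "map2 write_move (keep (map read_tape ts)) ts = map refresh ts"
  by (induction ts) (auto simp: write_move_Stay_read)

definition act_tm :: "nat \<Rightarrow> nat \<Rightarrow> (nat list \<Rightarrow> (nat \<times> move) list) \<Rightarrow> tm" where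
  "act_tm K A a = \<lparr>tm_tapes = K, tm_alphabet = A, tm_states = 1, tm_delta = (\<lambda>q ss. (1, a ss))\<rparr>"

definition skip_tm :: "nat \<Rightarrow> nat \<Rightarrow> tm" where
  "skip_tm K A = \<lparr>tm_tapes = K, tm_alphabet = A, tm_states = 0, tm_delta = (\<lambda>q ss. (0, keep ss))\<rparr>"

text \<open>State \<open>tm_states M\<close> is at once the exit of \<open>M\<close> and state 0 of
  \<open>N\<close>, so that no step is spent in between.\<close>

definition seq_tm :: "tm \<Rightarrow> tm \<Rightarrow> tm" where
  "seq_tm M N = M\<lparr>tm_states := tm_states M + tm_states N,
     tm_delta := (\<lambda>q ss. if q < tm_states M then tm_delta M q ss
       else apfst ((+) (tm_states M)) (tm_delta N (q - tm_states M) ss))\<rparr>"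

text \<open>State 0 tests; the states of the branches follow, and both branches exit to the common
  halting state.\<close>

definition cond_tm :: "(nat list \<Rightarrow> bool) \<Rightarrow> tm \<Rightarrow> tm \<Rightarrow> tm" where
  "cond_tm P M N = (let m = tm_states M; n = tm_states N;
       l = (\<lambda>q. if q = m then 1 + m + n else 1 + q); r = (\<lambda>q. 1 + m + q) in
     M\<lparr>tm_states := 1 + m + n,
       tm_delta := (\<lambda>q ss. if q = 0 then (if P ss then l 0 else r 0, keep ss)
         else if q \<le> m then apfst l (tm_delta M (q - 1) ss)
         else apfst r (tm_delta N (q - 1 - m) ss))\<rparr>)"

text \<open>State 0 tests, and \<open>l\<close> sends the halting state of the body back to it. This
  also covers a body without steps, where \<open>l 0 = 0\<close>.\<close>

definition while_tm :: "(nat list \<Rightarrow> bool) \<Rightarrow> tm \<Rightarrow> tm" where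
  "while_tm P M = (let m = tm_states M; l = (\<lambda>q. if q = m then 0 else 1 + q) in
     M\<lparr>tm_states := 1 + m,
       tm_delta := (\<lambda>q ss. if q = 0 then (if P ss then l 0 else 1 + m, keep ss)
         else apfst l (tm_delta M (q - 1) ss))\<rparr>)"

section \<open>Well-formedness and running times of the combinations\<close>

lemma wf_act_tm:
  assumes "\<And>ss. length ss = K \<Longrightarrow> \<forall>s \<in> set ss. s < A \<Longrightarrow> length (a ss) = K \<and> (\<forall>a \<in> set (a ss). fst a < A)"
  shows "wf_code K A (act_tm K A a)"
  using assms by (intro wf_codeI) (auto simp: act_tm_def)

lemma wf_skip_tm: "wf_code K A (skip_tm K A)"
  by (intro wf_codeI) (auto simp: skip_tm_def)

lemma wf_seq_tm:
  assumes "wf_code K A M" "wf_code K A N"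
  shows "wf_code K A (seq_tm M N)"
proof (rule wf_codeI, goal_cases)
  case (3 q ss)
  show ?case
  proof (cases "q < tm_states M")
    case True
    then show ?thesis using wf_codeD(3)[OF assms(1), of q ss] 3 by (auto simp: seq_tm_def)
  next
    case False
    then show ?thesis using wf_codeD(3)[OF assms(2), of "q - tm_states M" ss] 3
      by (auto simp: seq_tm_def)
  qed
qed (use assms in \<open>auto simp: seq_tm_def wf_code_def\<close>)

lemma wf_cond_tm:
  assumes "wf_code K A M" "wf_code K A N"
  shows "wf_code K A (cond_tm P M N)"
proof (rule wf_codeI, goal_cases)
  case (3 q ss)
  consider "q = 0" | "q \<noteq> 0" "q \<le> tm_states M" | "q > tm_states M" by linarith
  then show ?case
  proof cases
    case 1
    then show ?thesis using 3 by (auto simp: cond_tm_def Let_def)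
  next
    case 2
    then have "q - 1 < tm_states M" by simp
    then show ?thesis using 2 wf_codeD(3)[OF assms(1), of "q - 1" ss] 3
      by (auto simp: cond_tm_def Let_def)
  next
    case 3
    then show ?thesis
      using wf_codeD(3)[OF assms(2), of "q - 1 - tm_states M" ss] \<open>q < _\<close> \<open>length ss = K\<close> \<open>\<forall>s\<in>set ss. s < A\<close>
      by (auto simp: cond_tm_def Let_def)
  qed
qed (use assms in \<open>auto simp: cond_tm_def Let_def wf_code_def\<close>)

lemma wf_while_tm:
  assumes "wf_code K A M"
  shows "wf_code K A (while_tm P M)"
proof (rule wf_codeI, goal_cases)
  case (3 q ss)
  then show ?case using wf_codeD(3)[OF assms, of "q - 1" ss]
    by (cases "q = 0") (auto simp: while_tm_def Let_def)
qed (use assms in \<open>auto simp: while_tm_def Let_def wf_code_def\<close>)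

lemma computes_skip: "computes (skip_tm K A) ts 0 ts"
  by (auto simp: computes_def skip_tm_def intro: tm_runs.intros)

lemma computes_act:
  "computes (act_tm K A a) ts 1 (map2 write_move (a (map read_tape ts)) ts)"
  unfolding computes_def
  by (rule exI[of _ "Suc 0"]) (auto simp: act_tm_def intro!: tm_runs.intros)

lemma computes_seq:
  assumes "computes M ts t ts'" "computes N ts' u ts''"
  shows "computes (seq_tm M N) ts (t + u) ts''"
proof -
  obtain s s' where s: "s \<le> t" "tm_runs M (0, ts) s (tm_states M, ts')"
    and s': "s' \<le> u" "tm_runs N (0, ts') s' (tm_states N, ts'')"
    using assms by (auto simp: computes_def)
  have "tm_runs (seq_tm M N) (apfst id (0, ts)) s (apfst id (tm_states M, ts'))"
    using s(2) by (rule tm_runs_embed) (auto simp: seq_tm_def apfst_def map_prod.id)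
  moreover have "tm_runs (seq_tm M N) (apfst ((+) (tm_states M)) (0, ts')) s'
      (apfst ((+) (tm_states M)) (tm_states N, ts''))"
    using s'(2) by (rule tm_runs_embed) (auto simp: seq_tm_def)
  ultimately have "tm_runs (seq_tm M N) (0, ts) (s + s') (tm_states (seq_tm M N), ts'')"
    by (auto simp: seq_tm_def intro: tm_runs_trans)
  then show ?thesis unfolding computes_def using s(1) s'(1) add_mono by blast
qed

lemma tm_runs_cond_left:
  assumes "tm_runs M c t c'"
  shows "tm_runs (cond_tm P M N)
    (apfst (\<lambda>q. if q = tm_states M then 1 + tm_states M + tm_states N else 1 + q) c) t
    (apfst (\<lambda>q. if q = tm_states M then 1 + tm_states M + tm_states N else 1 + q) c')"
  using assms by (rule tm_runs_embed) (auto simp: cond_tm_def Let_def)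

lemma tm_runs_cond_right:
  assumes "tm_runs N c t c'"
  shows "tm_runs (cond_tm P M N) (apfst (\<lambda>q. 1 + tm_states M + q) c) t
    (apfst (\<lambda>q. 1 + tm_states M + q) c')"
  using assms by (rule tm_runs_embed) (auto simp: cond_tm_def Let_def)

lemma computes_cond_True:
  assumes "P (map read_tape ts)" "computes M (map refresh ts) t ts'"
  shows "computes (cond_tm P M N) ts (Suc t) ts'"
proof -
  obtain s where s: "s \<le> t" "tm_runs M (0, map refresh ts) s (tm_states M, ts')"
    using assms by (auto simp: computes_def)
  have "tm_runs (cond_tm P M N) (0, ts) (Suc s) (tm_states (cond_tm P M N), ts')"
    by (rule tm_runs_step[where q' = "if 0 = tm_states M then 1 + tm_states M + tm_states N else 1 + 0"
          and as = "keep (map read_tape ts)"])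
      (use assms(1) tm_runs_cond_left[OF s(2), of P N] in \<open>simp_all add: cond_tm_def Let_def map2_keep del: map_map\<close>)
  then show ?thesis unfolding computes_def using s(1) by (metis Suc_le_mono)
qed

lemma computes_cond_False:
  assumes "\<not> P (map read_tape ts)" "computes N (map refresh ts) t ts'"
  shows "computes (cond_tm P M N) ts (Suc t) ts'"
proof -
  obtain s where s: "s \<le> t" "tm_runs N (0, map refresh ts) s (tm_states N, ts')"
    using assms by (auto simp: computes_def)
  have "tm_runs (cond_tm P M N) (0, ts) (Suc s) (tm_states (cond_tm P M N), ts')"
    by (rule tm_runs_step[where q' = "1 + tm_states M"
          and as = "keep (map read_tape ts)"])
      (use assms(1) tm_runs_cond_right[OF s(2), of P M] in \<open>simp_all add: cond_tm_def Let_def map2_keep del: map_map\<close>)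
  then show ?thesis unfolding computes_def using s(1) by (metis Suc_le_mono)
qed

lemma computes_while_False:
  assumes "\<not> P (map read_tape ts)"
  shows "computes (while_tm P M) ts 1 (map refresh ts)"
proof -
  have "tm_runs (while_tm P M) (0, ts) (Suc 0) (tm_states (while_tm P M), map refresh ts)"
    by (rule tm_runs_step[where q' = "1 + tm_states M" and as = "keep (map read_tape ts)"])
      (use assms in \<open>simp_all add: while_tm_def Let_def map2_keep tm_runs_refl del: map_map\<close>)
  then show ?thesis unfolding computes_def by auto
qed

lemma computes_while_True:
  assumes "P (map read_tape ts)" "computes M (map refresh ts) t ts'"
    and "computes (while_tm P M) ts' u ts''"
  shows "computes (while_tm P M) ts (Suc (t + u)) ts''"
proof -
  let ?l = "\<lambda>q. if q = tm_states M then 0 else 1 + q"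
  obtain s s' where s: "s \<le> t" "tm_runs M (0, map refresh ts) s (tm_states M, ts')"
    and s': "s' \<le> u" "tm_runs (while_tm P M) (0, ts') s' (tm_states (while_tm P M), ts'')"
    using assms by (auto simp: computes_def)
  have "tm_runs (while_tm P M) (apfst ?l (0, map refresh ts)) s (apfst ?l (tm_states M, ts'))"
    using s(2) by (rule tm_runs_embed) (auto simp: while_tm_def Let_def)
  then have "tm_runs (while_tm P M) (?l 0, map refresh ts) s (0, ts')" by simp
  then have *: "tm_runs (while_tm P M) (?l 0, map refresh ts) (s + s') (tm_states (while_tm P M), ts'')"
    using s'(2) by (rule tm_runs_trans)
  have "tm_runs (while_tm P M) (0, ts) (Suc (s + s')) (tm_states (while_tm P M), ts'')"
    by (rule tm_runs_step[where q' = "?l 0" and as = "keep (map read_tape ts)"])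
      (use assms(1) * in \<open>simp_all only: map2_keep, simp_all add: while_tm_def Let_def del: map_map\<close>)
  moreover have "Suc (s + s') \<le> Suc (t + u)" using s(1) s'(1) by simp
  ultimately show ?thesis unfolding computes_def by blast
qed

section \<open>A stack language\<close>

datatype cmd = Skip | Push nat bool | Pop nat | Seq cmd cmd (infixr ";;" 60)
  | Cond nat nat cmd cmd | Loop nat cmd

type_synonym store = "nat \<Rightarrow> bool list"

definition top_symbol :: "bool list \<Rightarrow> nat" where
  "top_symbol xs = cell_hd (map bit_symbol xs)"

fun loop :: "(store \<Rightarrow> store) \<Rightarrow> nat \<Rightarrow> bool list \<Rightarrow> store \<Rightarrow> store" where
  "loop f r [] \<sigma> = \<sigma>"
| "loop f r (x # xs) \<sigma> = loop f r xs (f (\<sigma>(r := x # xs)))"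

fun loop_time :: "(store \<Rightarrow> store) \<Rightarrow> (store \<Rightarrow> nat) \<Rightarrow> nat \<Rightarrow> bool list \<Rightarrow> store \<Rightarrow> nat" where
  "loop_time f g r [] \<sigma> = 1"
| "loop_time f g r (x # xs) \<sigma> =
     Suc (g (\<sigma>(r := x # xs)) + 1 + loop_time f g r xs (f (\<sigma>(r := x # xs))))"

text \<open>Inside a loop over register \<open>r\<close> the store shows the unread suffix of \<open>r\<close>; the loop restores
  \<open>r\<close> at its end.\<close>

primrec exec :: "cmd \<Rightarrow> store \<Rightarrow> store" where
  "exec Skip = (\<lambda>\<sigma>. \<sigma>)"
| "exec (Push r b) = (\<lambda>\<sigma>. \<sigma>(r := b # \<sigma> r))"
| "exec (Pop r) = (\<lambda>\<sigma>. \<sigma>(r := tl (\<sigma> r)))"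
| "exec (p ;; q) = (\<lambda>\<sigma>. exec q (exec p \<sigma>))"
| "exec (Cond r v p q) = (\<lambda>\<sigma>. if top_symbol (\<sigma> r) = v then exec p \<sigma> else exec q \<sigma>)"
| "exec (Loop r p) = (\<lambda>\<sigma>. (loop (exec p) r (\<sigma> r) \<sigma>)(r := \<sigma> r))"

text \<open>The numbers follow the compiled machines: a push moves and then writes, each pass of a
  loop adds one step for the test and one for advancing the head, and the last summand of
  \<open>Loop\<close> pays for the rewind.\<close>

primrec time :: "cmd \<Rightarrow> store \<Rightarrow> nat" where
  "time Skip = (\<lambda>\<sigma>. 0)"
| "time (Push r b) = (\<lambda>\<sigma>. 2)"
| "time (Pop r) = (\<lambda>\<sigma>. 1)"
| "time (p ;; q) = (\<lambda>\<sigma>. time p \<sigma> + time q (exec p \<sigma>))"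
| "time (Cond r v p q) = (\<lambda>\<sigma>. Suc (if top_symbol (\<sigma> r) = v then time p \<sigma> else time q \<sigma>))"
| "time (Loop r p) = (\<lambda>\<sigma>. loop_time (exec p) (time p) r (\<sigma> r) \<sigma> + (2 * length (\<sigma> r) + 3))"

primrec writes :: "cmd \<Rightarrow> nat set" where
  "writes Skip = {}"
| "writes (Push r b) = {r}"
| "writes (Pop r) = {r}"
| "writes (p ;; q) = writes p \<union> writes q"
| "writes (Cond r v p q) = writes p \<union> writes q"
| "writes (Loop r p) = writes p"

primrec loops :: "cmd \<Rightarrow> nat set" where
  "loops Skip = {}"
| "loops (Push r b) = {}"
| "loops (Pop r) = {}"
| "loops (p ;; q) = loops p \<union> loops q"
| "loops (Cond r v p q) = loops p \<union> loops q"
| "loops (Loop r p) = insert r (loops p)"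

primrec regs :: "cmd \<Rightarrow> nat set" where
  "regs Skip = {}"
| "regs (Push r b) = {r}"
| "regs (Pop r) = {r}"
| "regs (p ;; q) = regs p \<union> regs q"
| "regs (Cond r v p q) = insert r (regs p \<union> regs q)"
| "regs (Loop r p) = insert r (regs p)"

text \<open>Registers that control a loop must not be written in its body. This bounds the number of
  iterations in advance, so that every such command runs in polynomial time.\<close>

primrec ok :: "cmd \<Rightarrow> bool" where
  "ok Skip = True"
| "ok (Push r b) = True"
| "ok (Pop r) = True"
| "ok (p ;; q) = (ok p \<and> ok q)"
| "ok (Cond r v p q) = (ok p \<and> ok q)"
| "ok (Loop r p) = (ok p \<and> r \<notin> loops p \<and> writes p \<inter> insert r (loops p) = {})"

lemma loop_frame:
  assumes "\<And>\<sigma>. f \<sigma> s = \<sigma> s" "s \<noteq> r"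
  shows "loop f r xs \<sigma> s = \<sigma> s"
  by (induction xs arbitrary: \<sigma>) (use assms in auto)

lemma exec_frame: "s \<notin> writes p \<Longrightarrow> exec p \<sigma> s = \<sigma> s"
  by (induction p arbitrary: \<sigma>) (auto simp: loop_frame)

lemma finite_regs: "finite (regs p)"
  by (induction p) auto

subsection \<open>Compilation\<close>

definition act1 :: "nat \<Rightarrow> nat \<Rightarrow> nat \<Rightarrow> (nat \<Rightarrow> nat \<times> move) \<Rightarrow> tm" where
  "act1 K A i g = act_tm K A (\<lambda>ss. (keep ss)[i := g (ss ! i)])"

text \<open>When a loop ends, the head is on the blank after the contents. The first move steps back
  onto the last bit, the loop runs on to the blank before the first bit, and the final move returns
  to that bit. For an empty register the two outer moves cancel.\<close>

definition rewind_tm :: "nat \<Rightarrow> nat \<Rightarrow> nat \<Rightarrow> tm" where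
  "rewind_tm K A i = seq_tm (act1 K A i (\<lambda>s. (s, MoveLeft)))
     (seq_tm (while_tm (\<lambda>ss. ss ! i \<noteq> 0) (act1 K A i (\<lambda>s. (s, MoveLeft))))
       (act1 K A i (\<lambda>s. (s, MoveRight))))"

text \<open>The top of a stack is the scanned cell, and \<open>\<tau>\<close> assigns tapes to
  registers. A loop leaves its register on the tape and merely advances the head over it, which is
  why the body sees the unread suffix. A popped cell is blanked because a later rewind recognises
  the left end of the contents by a blank.\<close>

primrec compile :: "nat \<Rightarrow> nat \<Rightarrow> (nat \<Rightarrow> nat) \<Rightarrow> cmd \<Rightarrow> tm" where
  "compile K A \<tau> Skip = skip_tm K A"
| "compile K A \<tau> (Push r b) = seq_tm (act1 K A (\<tau> r) (\<lambda>s. (s, MoveLeft)))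
     (act1 K A (\<tau> r) (\<lambda>s. (bit_symbol b, Stay)))"
| "compile K A \<tau> (Pop r) = act1 K A (\<tau> r) (\<lambda>s. (0, if s = 0 then Stay else MoveRight))"
| "compile K A \<tau> (p ;; q) = seq_tm (compile K A \<tau> p) (compile K A \<tau> q)"
| "compile K A \<tau> (Cond r v p q) =
     cond_tm (\<lambda>ss. ss ! \<tau> r = v) (compile K A \<tau> p) (compile K A \<tau> q)"
| "compile K A \<tau> (Loop r p) = seq_tm
     (while_tm (\<lambda>ss. ss ! \<tau> r \<noteq> 0)
       (seq_tm (compile K A \<tau> p) (act1 K A (\<tau> r) (\<lambda>s. (s, MoveRight)))))
     (rewind_tm K A (\<tau> r))"

lemma wf_act1:
  assumes "i < K" "\<And>s. s < A \<Longrightarrow> fst (g s) < A"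
  shows "wf_code K A (act1 K A i g)"
  unfolding act1_def
proof (rule wf_act_tm)
  fix ss :: "nat list" assume *: "length ss = K" "\<forall>s\<in>set ss. s < A"
  show "length ((keep ss)[i := g (ss ! i)]) = K \<and> (\<forall>a\<in>set ((keep ss)[i := g (ss ! i)]). fst a < A)"
    using * assms set_update_subset_insert[of "keep ss" i "g (ss ! i)"] by fastforce
qed

lemma wf_rewind_tm: "i < K \<Longrightarrow> wf_code K A (rewind_tm K A i)"
  unfolding rewind_tm_def by (intro wf_seq_tm wf_while_tm wf_act1) auto

lemma bit_symbol_less: "bit_symbol b < 3" "bit_symbol b > 0"
  by (auto simp: bit_symbol_def)

lemma wf_compile:
  assumes "A \<ge> 3"
  shows "(\<And>r. r \<in> regs p \<Longrightarrow> \<tau> r < K) \<Longrightarrow> wf_code K A (compile K A \<tau> p)"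
proof (induction p)
  case (Push r b)
  then show ?case using assms bit_symbol_less(1)[of b]
    by (auto intro!: wf_seq_tm wf_act1)
next
  case (Pop r)
  then show ?case using assms by (auto intro!: wf_act1)
qed (auto intro!: wf_seq_tm wf_act1 wf_skip_tm wf_cond_tm wf_while_tm wf_rewind_tm)

section \<open>Tapes as stacks: elementary actions, rewinding and the simulation of programs\<close>

lemma read_refresh [simp]: "read_tape (refresh t) = read_tape t"
  by (simp add: refresh_def read_tape_def cell_hd_def)

lemma fst_refresh [simp]: "fst (refresh t) = fst t"
  by (simp add: refresh_def)

lemma refresh_Cons [simp]: "refresh (l, s # rs) = (l, s # rs)"
  by (simp add: refresh_def read_tape_def cell_hd_def)

lemma refresh_refresh [simp]: "refresh (refresh t) = refresh t"
  by (simp add: refresh_def read_tape_def cell_hd_def)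

lemma refresh_o_refresh [simp]: "refresh \<circ> refresh = refresh"
  by (auto simp: fun_eq_iff)

lemma read_o_refresh [simp]: "read_tape \<circ> refresh = read_tape"
  by (auto simp: fun_eq_iff)

lemma cell_hd_simps [simp]: "cell_hd [] = 0" "cell_hd (x # xs) = x"
  by (simp_all add: cell_hd_def)

lemma write_move_refresh [simp]: "write_move a (refresh t) = write_move a t"
  by (cases "(a, t)" rule: write_move.cases) (auto simp: refresh_def)

lemma computes_act1:
  assumes "i < length ts"
  shows "computes (act1 K A i g) ts 1
    ((map refresh ts)[i := write_move (g (read_tape (ts ! i))) (ts ! i)])"
proof -
  have "map2 write_move ((keep (map read_tape ts))[i := g (map read_tape ts ! i)]) ts =
      (map refresh ts)[i := write_move (g (read_tape (ts ! i))) (ts ! i)]"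
    using assms
    by (intro nth_equalityI) (auto simp: nth_list_update write_move_Stay_read)
  then show ?thesis using computes_act[of K A "\<lambda>ss. (keep ss)[i := g (ss ! i)]" ts]
    by (simp add: act1_def)
qed

text \<open>\<open>w\<close> lists the bits from the scanned cell leftwards, followed by
  \<open>z\<close> blanks. Splitting this list by \<open>cell_hd\<close> and \<open>tl\<close>
  describes a head that has just moved left, and it covers the empty \<open>w\<close>, where the
  head is on a blank that need not have been listed.\<close>

lemma computes_rewind_while:
  assumes "i < length ts" "ts ! i = (tl (map bit_symbol w @ replicate z 0),
      cell_hd (map bit_symbol w @ replicate z 0) # rs)"
  shows "computes (while_tm (\<lambda>ss. ss ! i \<noteq> 0) (act1 K A i (\<lambda>s. (s, MoveLeft)))) ts
    (2 * length w + 1) ((map refresh ts)[i := (replicate (z - 1) 0, 0 # map bit_symbol (rev w) @ rs)])"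
  using assms
proof (induction w arbitrary: rs ts)
  case Nil
  have t: "ts ! i = (replicate (z - 1) 0, 0 # rs)" using Nil(2)
    by (cases z) auto
  have "\<not> (map read_tape ts) ! i \<noteq> 0" using t Nil(1) by (simp add: read_tape_def)
  then have "computes (while_tm (\<lambda>ss. ss ! i \<noteq> 0) (act1 K A i (\<lambda>s. (s, MoveLeft)))) ts 1
      (map refresh ts)" by (rule computes_while_False)
  moreover have "map refresh ts = (map refresh ts)[i := (replicate (z - 1) 0, 0 # rs)]"
    using t Nil(1) by (intro nth_equalityI) (auto simp: nth_list_update)
  ultimately show ?case by simp
next
  case (Cons b w)
  have t: "ts ! i = (map bit_symbol w @ replicate z 0, bit_symbol b # rs)" using Cons(3) by auto
  let ?t = "(tl (map bit_symbol w @ replicate z 0),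
      cell_hd (map bit_symbol w @ replicate z 0) # bit_symbol b # rs)"
  have P: "map read_tape ts ! i \<noteq> 0" using t Cons(2) bit_symbol_less(2)[of b]
    by (simp add: read_tape_def)
  have "computes (act1 K A i (\<lambda>s. (s, MoveLeft))) (map refresh ts) 1 ((map refresh ts)[i := ?t])"
    using computes_act1[of i "map refresh ts" K A "\<lambda>s. (s, MoveLeft)"] Cons(2) t
    by (simp add: read_tape_def)
  moreover have "computes (while_tm (\<lambda>ss. ss ! i \<noteq> 0) (act1 K A i (\<lambda>s. (s, MoveLeft))))
      ((map refresh ts)[i := ?t]) (2 * length w + 1)
      ((map refresh ((map refresh ts)[i := ?t]))
        [i := (replicate (z - 1) 0, 0 # map bit_symbol (rev w) @ bit_symbol b # rs)])"
    using Cons(2) by (intro Cons.IH) auto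
  ultimately have "computes (while_tm (\<lambda>ss. ss ! i \<noteq> 0) (act1 K A i (\<lambda>s. (s, MoveLeft)))) ts
      (Suc (1 + (2 * length w + 1))) ((map refresh ((map refresh ts)[i := ?t]))
        [i := (replicate (z - 1) 0, 0 # map bit_symbol (rev w) @ bit_symbol b # rs)])"
    by (rule computes_while_True[where P = "\<lambda>ss. ss ! i \<noteq> 0", OF P])
  then show ?case by (simp add: map_update)
qed

lemma computes_rewind:
  assumes "i < length ts" "ts ! i = (map bit_symbol w @ replicate z 0, js)"
  shows "computes (rewind_tm K A i) ts (2 * length w + 3)
    ((map refresh ts)[i := (replicate (Suc (z - 1)) 0, map bit_symbol (rev w) @ cell_hd js # tl js)])"
proof -
  let ?t = "(tl (map bit_symbol w @ replicate z 0),
      cell_hd (map bit_symbol w @ replicate z 0) # cell_hd js # tl js)"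
  let ?u = "(replicate (z - 1) 0, 0 # map bit_symbol (rev w) @ cell_hd js # tl js)"
  have 1: "computes (act1 K A i (\<lambda>s. (s, MoveLeft))) ts 1 ((map refresh ts)[i := ?t])"
    using computes_act1[of i ts K A "\<lambda>s. (s, MoveLeft)"] assms by (simp add: read_tape_def)
  have 2: "computes (while_tm (\<lambda>ss. ss ! i \<noteq> 0) (act1 K A i (\<lambda>s. (s, MoveLeft))))
      ((map refresh ts)[i := ?t]) (2 * length w + 1) ((map refresh ts)[i := ?u])"
    using computes_rewind_while[of i "(map refresh ts)[i := ?t]" w z "cell_hd js # tl js" K A] assms
    by (simp add: map_update)
  have 3: "computes (act1 K A i (\<lambda>s. (s, MoveRight))) ((map refresh ts)[i := ?u]) 1
      ((map refresh ts)[i := (replicate (Suc (z - 1)) 0, map bit_symbol (rev w) @ cell_hd js # tl js)])"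
    using computes_act1[of i "(map refresh ts)[i := ?u]" K A "\<lambda>s. (s, MoveRight)"] assms
    by (simp add: map_update read_tape_def)
  have "computes (rewind_tm K A i) ts (1 + ((2 * length w + 1) + 1))
    ((map refresh ts)[i := (replicate (Suc (z - 1)) 0, map bit_symbol (rev w) @ cell_hd js # tl js)])"
    unfolding rewind_tm_def by (rule computes_seq[OF 1 computes_seq[OF 2 3]])
  then show ?thesis by (simp add: numeral_3_eq_3)
qed

text \<open>\<open>xs\<close> is the unread part of a register and \<open>sc\<close> the reversed part that an enclosing loop has
  read. The left part of the tape matters only (\<open>l\<close>) if loops over the register have to find the
  left end of its contents.\<close>

definition holds :: "bool \<Rightarrow> bool list \<Rightarrow> bool list \<Rightarrow> tape \<Rightarrow> bool" where
  "holds l sc xs t \<longleftrightarrow> (\<exists>js. snd t = map bit_symbol xs @ js \<and> cell_hd js = 0) \<and>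
     (l \<longrightarrow> (\<exists>z. fst t = map bit_symbol sc @ replicate z 0))"

definition represents ::
    "(nat \<Rightarrow> nat) \<Rightarrow> nat \<Rightarrow> nat set \<Rightarrow> store \<Rightarrow> store \<Rightarrow> tape list \<Rightarrow> bool" where
  "represents \<tau> m L sc \<sigma> ts \<longleftrightarrow> inj_on \<tau> {..<m} \<and>
     (\<forall>r<m. \<tau> r < length ts \<and> holds (r \<in> L) (sc r) (\<sigma> r) (ts ! \<tau> r))"

lemma holds_refresh: "holds l sc xs t \<Longrightarrow> holds l sc xs (refresh t)"
proof -
  assume h: "holds l sc xs t"
  then obtain js where js: "snd t = map bit_symbol xs @ js" "cell_hd js = 0"
    by (auto simp: holds_def)
  have "\<exists>js. snd (refresh t) = map bit_symbol xs @ js \<and> cell_hd js = 0"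
    using js by (cases xs) (auto simp: refresh_def read_tape_def)
  then show ?thesis using h by (auto simp: holds_def)
qed

lemma holds_read: "holds l sc xs t \<Longrightarrow> read_tape t = top_symbol xs"
  by (cases xs) (auto simp: holds_def read_tape_def top_symbol_def)

lemma represents_refresh: "represents \<tau> m L sc \<sigma> ts \<Longrightarrow> represents \<tau> m L sc \<sigma> (map refresh ts)"
  by (auto simp: represents_def holds_refresh)

lemma represents_update:
  assumes "represents \<tau> m L sc \<sigma> ts" "r < m" "holds (r \<in> L) w xs t"
  shows "represents \<tau> m L (sc(r := w)) (\<sigma>(r := xs)) ((map refresh ts)[\<tau> r := t])"
  unfolding represents_def
proof (intro conjI allI impI)
  show "inj_on \<tau> {..<m}" using assms by (auto simp: represents_def)
  fix s assume s: "s < m"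
  show "\<tau> s < length ((map refresh ts)[\<tau> r := t])" using assms s by (auto simp: represents_def)
  show "holds (s \<in> L) ((sc(r := w)) s) ((\<sigma>(r := xs)) s) ((map refresh ts)[\<tau> r := t] ! \<tau> s)"
  proof (cases "s = r")
    case False
    then have "\<tau> s \<noteq> \<tau> r" using assms s by (auto simp: represents_def inj_on_def)
    then show ?thesis using False assms s by (auto simp: represents_def holds_refresh)
  qed (use assms in \<open>auto simp: represents_def\<close>)
qed

lemma represents_act1:
  assumes "represents \<tau> m L sc \<sigma> ts" "r < m"
    and "holds (r \<in> L) w xs (write_move (g (read_tape (ts ! \<tau> r))) (ts ! \<tau> r))"
  shows "\<exists>ts'. computes (act1 K A (\<tau> r) g) ts 1 ts' \<and>
    represents \<tau> m L (sc(r := w)) (\<sigma>(r := xs)) ts'"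
proof -
  have "\<tau> r < length ts" using assms(1,2) by (simp add: represents_def)
  then show ?thesis using computes_act1 represents_update[OF assms] by blast
qed

lemma holds_push:
  assumes "holds l [] xs t"
  shows "holds l [] (b # xs) (write_move (bit_symbol b, Stay) (write_move (read_tape t, MoveLeft) t))"
proof -
  obtain ls rs where t: "t = (ls, rs)" by (cases t)
  obtain js where js: "rs = map bit_symbol xs @ js" "cell_hd js = 0"
    using assms by (auto simp: holds_def t)
  have "\<exists>js'. read_tape t # tl rs = map bit_symbol xs @ js' \<and> cell_hd js' = 0"
    using js by (cases xs) (auto simp: read_tape_def t)
  moreover have "\<exists>z. tl ls = replicate z 0" if l
  proof -
    have "\<exists>z. ls = replicate z 0" using assms that by (simp add: holds_def t)
    then obtain z where "ls = replicate z 0" by blast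
    then show ?thesis by (intro exI[of _ "z - 1"]) (cases z; simp)
  qed
  ultimately show ?thesis by (auto simp: holds_def t)
qed

lemma holds_pop:
  assumes "holds l [] xs t"
  shows "holds l [] (tl xs) (write_move (0, if read_tape t = 0 then Stay else MoveRight) t)"
proof (cases xs)
  case Nil
  then show ?thesis using assms by (cases t) (auto simp: holds_def read_tape_def)
next
  case (Cons b ys)
  then have "read_tape t \<noteq> 0"
    using holds_read[OF assms] bit_symbol_less(2)[of b] by (simp add: top_symbol_def)
  moreover have "\<exists>z. 0 # fst t = replicate z 0" if l
  proof -
    have "\<exists>z. fst t = replicate z 0" using assms that by (simp add: holds_def)
    then obtain z where "fst t = replicate z 0" by blast
    then show ?thesis by (intro exI[of _ "Suc z"]) simp
  qed
  ultimately show ?thesis using assms Cons by (cases t) (auto simp: holds_def)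
qed

lemma holds_advance:
  assumes "holds l w (x # xs) t"
  shows "holds l (x # w) xs (write_move (read_tape t, MoveRight) t)"
  using assms by (cases t) (auto simp: holds_def read_tape_def)

lemma represents_read:
  assumes "represents \<tau> m L sc \<sigma> ts" "r < m"
  shows "map read_tape ts ! \<tau> r = top_symbol (\<sigma> r)"
  using assms holds_read[of "r \<in> L" "sc r" "\<sigma> r" "ts ! \<tau> r"] by (auto simp: represents_def)

lemma top_symbol_eq_0 [simp]: "top_symbol xs = 0 \<longleftrightarrow> xs = []" "0 = top_symbol xs \<longleftrightarrow> xs = []"
  using bit_symbol_less(2) by (cases xs; force simp: top_symbol_def)+

text \<open>Induction on the unread part \<open>xs\<close>, with the part already read, reversed, in
  \<open>w\<close>. Since the body neither writes nor loops over \<open>r\<close>, its correctness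
  applies although the head of that tape stands in the middle of the register.\<close>

lemma represents_loop:
  assumes body: "\<And>sc \<sigma> ts. \<forall>s\<in>writes p \<union> loops p. sc s = [] \<Longrightarrow> represents \<tau> m L sc \<sigma> ts \<Longrightarrow>
      \<exists>ts'. computes M ts (time p \<sigma>) ts' \<and> represents \<tau> m L sc (exec p \<sigma>) ts'"
    and r: "r < m" "r \<notin> writes p" "r \<notin> loops p"
    and "\<forall>s\<in>writes p \<union> loops p. sc s = []"
    and "represents \<tau> m L (sc(r := w)) (\<sigma>(r := xs)) ts"
  shows "\<exists>ts'. computes (while_tm (\<lambda>ss. ss ! \<tau> r \<noteq> 0)
        (seq_tm M (act1 K A (\<tau> r) (\<lambda>s. (s, MoveRight))))) ts
      (loop_time (exec p) (time p) r xs \<sigma>) ts' \<and>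
    represents \<tau> m L (sc(r := rev xs @ w)) ((loop (exec p) r xs \<sigma>)(r := [])) ts'"
  using assms(5,6)
proof (induction xs arbitrary: w \<sigma> ts)
  case Nil
  have "\<not> map read_tape ts ! \<tau> r \<noteq> 0" using represents_read[OF Nil(2) r(1)] by simp
  note computes_while_False[where P = "\<lambda>ss. ss ! \<tau> r \<noteq> 0", OF this]
  then show ?case using represents_refresh[OF Nil(2)] by (intro exI[of _ "map refresh ts"]) simp
next
  case (Cons x xs)
  let ?\<sigma> = "\<sigma>(r := x # xs)" and ?N = "act1 K A (\<tau> r) (\<lambda>s. (s, MoveRight))"
  let ?\<sigma>' = "exec p ?\<sigma>"
  have P: "map read_tape ts ! \<tau> r \<noteq> 0" using represents_read[OF Cons(3) r(1)] by simp
  have sc': "\<forall>s\<in>writes p \<union> loops p. (sc(r := w)) s = []" using Cons(2) r by auto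
  obtain ts1 where 1: "computes M (map refresh ts) (time p ?\<sigma>) ts1"
      "represents \<tau> m L (sc(r := w)) ?\<sigma>' ts1"
    using body[OF sc' represents_refresh[OF Cons(3)]] by blast
  have "?\<sigma>' r = x # xs" using exec_frame[OF r(2)] by simp
  then have "holds (r \<in> L) w (x # xs) (ts1 ! \<tau> r)" using 1(2) r(1) by (auto simp: represents_def)
  from represents_act1[OF 1(2) r(1), of "x # w" xs "\<lambda>s. (s, MoveRight)", OF holds_advance[OF this]]
  obtain ts2 where 2: "computes ?N ts1 1 ts2"
      "represents \<tau> m L (sc(r := x # w)) (?\<sigma>'(r := xs)) ts2"
    by auto
  obtain ts3 where 3: "computes (while_tm (\<lambda>ss. ss ! \<tau> r \<noteq> 0) (seq_tm M ?N)) ts2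
      (loop_time (exec p) (time p) r xs ?\<sigma>') ts3"
      "represents \<tau> m L (sc(r := rev xs @ x # w)) ((loop (exec p) r xs ?\<sigma>')(r := [])) ts3"
    using Cons.IH[OF Cons(2) 2(2)] by blast
  have "computes (while_tm (\<lambda>ss. ss ! \<tau> r \<noteq> 0) (seq_tm M ?N)) ts
      (Suc ((time p ?\<sigma> + 1) + loop_time (exec p) (time p) r xs ?\<sigma>')) ts3"
    by (rule computes_while_True[where P = "\<lambda>ss. ss ! \<tau> r \<noteq> 0", OF P computes_seq[OF 1(1) 2(1)] 3(1)])
  then show ?case using 3(2)
    unfolding rev.simps append.assoc append_Cons append_Nil loop.simps loop_time.simps by blast
qed

text \<open>The condition on \<open>sc\<close> says that no enclosing loop is in the middle of a
  register that \<open>p\<close> writes or loops over: a push would overwrite bits already read, and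
  a rewind would run back over them. For loop bodies, \<open>ok\<close> guarantees this
  condition.\<close>

lemma compile_correct:
  assumes "ok p" "regs p \<subseteq> {..<m}" "loops p \<subseteq> L" "\<forall>r\<in>writes p \<union> loops p. sc r = []"
    and "represents \<tau> m L sc \<sigma> ts"
  shows "\<exists>ts'. computes (compile K A \<tau> p) ts (time p \<sigma>) ts' \<and> represents \<tau> m L sc (exec p \<sigma>) ts'"
  using assms
proof (induction p arbitrary: sc \<sigma> ts)
  case Skip
  then show ?case using computes_skip by auto
next
  case (Push r b)
  let ?t = "ts ! \<tau> r" and ?f = "\<lambda>s. (s, MoveLeft)" and ?g = "\<lambda>s. (bit_symbol b, Stay)"
  let ?u = "write_move (read_tape ?t, MoveLeft) ?t"
  have r: "r < m" "\<tau> r < length ts" and sc: "sc r = []"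
    using Push by (auto simp: represents_def)
  then have "holds (r \<in> L) [] (\<sigma> r) ?t" using Push(5) by (force simp: represents_def)
  then have h: "holds (r \<in> L) [] (b # \<sigma> r) (write_move (bit_symbol b, Stay) ?u)"
    by (rule holds_push)
  have 1: "computes (act1 K A (\<tau> r) ?f) ts 1 ((map refresh ts)[\<tau> r := ?u])"
    using computes_act1[OF r(2), of K A ?f] by simp
  have "computes (act1 K A (\<tau> r) ?g) ((map refresh ts)[\<tau> r := ?u]) 1
      ((map refresh ts)[\<tau> r := write_move (bit_symbol b, Stay) ?u])"
    using computes_act1[of "\<tau> r" "(map refresh ts)[\<tau> r := ?u]" K A ?g] r
    by (simp add: map_update)
  note c = computes_seq[OF 1 this, unfolded one_add_one]
  have "sc(r := []) = sc" using sc by auto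
  then have "represents \<tau> m L sc (\<sigma>(r := b # \<sigma> r))
      ((map refresh ts)[\<tau> r := write_move (bit_symbol b, Stay) ?u])"
    using represents_update[OF Push(5) r(1) h] by metis
  with c show ?case unfolding compile.simps exec.simps time.simps by blast
next
  case (Pop r)
  then have r: "r < m" and "holds (r \<in> L) [] (\<sigma> r) (ts ! \<tau> r)" "sc r = []"
    by (auto simp: represents_def)
  from represents_act1[OF Pop(5) r, of "[]" "tl (\<sigma> r)"
      "\<lambda>s. (0, if s = 0 then Stay else MoveRight)" K A, OF holds_pop[OF this(2)]] this(3)
  show ?case unfolding compile.simps exec.simps time.simps by (metis fun_upd_triv)
next
  case (Seq p q)
  obtain ts1 where 1: "computes (compile K A \<tau> p) ts (time p \<sigma>) ts1"
      "represents \<tau> m L sc (exec p \<sigma>) ts1"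
    using Seq.IH(1)[of sc \<sigma> ts] Seq.prems by auto
  obtain ts2 where 2: "computes (compile K A \<tau> q) ts1 (time q (exec p \<sigma>)) ts2"
      "represents \<tau> m L sc (exec q (exec p \<sigma>)) ts2"
    using Seq.IH(2)[of sc "exec p \<sigma>" ts1] Seq.prems 1 by auto
  show ?case using computes_seq[OF 1(1) 2(1)] 2(2) by auto
next
  case (Cond r v p q)
  have r: "r < m" using Cond.prems by auto
  note rd = represents_read[OF Cond.prems(5) r]
  show ?case
  proof (cases "top_symbol (\<sigma> r) = v")
    case True
    obtain ts1 where 1: "computes (compile K A \<tau> p) (map refresh ts) (time p \<sigma>) ts1"
      "represents \<tau> m L sc (exec p \<sigma>) ts1"
      using Cond.IH(1)[of sc \<sigma> "map refresh ts"] Cond.prems represents_refresh by auto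
    have "computes (compile K A \<tau> (Cond r v p q)) ts (Suc (time p \<sigma>)) ts1"
      unfolding compile.simps using rd True by (intro computes_cond_True 1) auto
    then show ?thesis using 1(2) True by auto
  next
    case False
    obtain ts1 where 1: "computes (compile K A \<tau> q) (map refresh ts) (time q \<sigma>) ts1"
      "represents \<tau> m L sc (exec q \<sigma>) ts1"
      using Cond.IH(2)[of sc \<sigma> "map refresh ts"] Cond.prems represents_refresh by auto
    have "computes (compile K A \<tau> (Cond r v p q)) ts (Suc (time q \<sigma>)) ts1"
      unfolding compile.simps using rd False by (intro computes_cond_False 1) auto
    then show ?thesis using 1(2) False by auto
  qed
next
  case (Loop r p)
  have r: "r < m" "r \<notin> writes p" "r \<notin> loops p" "r \<in> L" and sc: "sc r = []"
    using Loop.prems by auto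
  have upd: "sc(r := []) = sc" "\<sigma>(r := \<sigma> r) = \<sigma>" using sc by auto
  let ?W = "while_tm (\<lambda>ss. ss ! \<tau> r \<noteq> 0)
        (seq_tm (compile K A \<tau> p) (act1 K A (\<tau> r) (\<lambda>s. (s, MoveRight))))"
  let ?\<sigma> = "loop (exec p) r (\<sigma> r) \<sigma>"
  have "\<exists>ts'. computes ?W ts (loop_time (exec p) (time p) r (\<sigma> r) \<sigma>) ts' \<and>
      represents \<tau> m L (sc(r := rev (\<sigma> r) @ [])) (?\<sigma>(r := [])) ts'"
  proof (rule represents_loop)
    show "represents \<tau> m L (sc(r := [])) (\<sigma>(r := \<sigma> r)) ts" unfolding upd by (rule Loop.prems(5))
  qed (use Loop r in auto)
  then obtain ts1 where 1: "computes ?W ts (loop_time (exec p) (time p) r (\<sigma> r) \<sigma>) ts1"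
      "represents \<tau> m L (sc(r := rev (\<sigma> r))) (?\<sigma>(r := [])) ts1" by auto
  then have "holds True (rev (\<sigma> r)) [] (ts1 ! \<tau> r)" and len: "\<tau> r < length ts1"
    using r by (auto simp: represents_def)
  then obtain js z where t: "ts1 ! \<tau> r = (map bit_symbol (rev (\<sigma> r)) @ replicate z 0, js)"
      and js: "cell_hd js = 0"
    by (cases "ts1 ! \<tau> r") (auto simp: holds_def)
  \<comment> \<open>The rewind visits the cell to the left of the contents, which leaves at least
    one explicit blank there: \<open>Suc (z - 1)\<close> is the maximum of \<open>z\<close> and
    1.\<close>
  let ?t = "(replicate (Suc (z - 1)) 0, map bit_symbol (rev (rev (\<sigma> r))) @ cell_hd js # tl js)"
  have 2: "computes (rewind_tm K A (\<tau> r)) ts1 (2 * length (rev (\<sigma> r)) + 3)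
      ((map refresh ts1)[\<tau> r := ?t])"
    by (rule computes_rewind[OF len t])
  have "holds (r \<in> L) [] (\<sigma> r) ?t" using js
    by (auto simp: holds_def simp del: replicate.simps)
  from represents_update[OF 1(2) r(1) this]
  have "represents \<tau> m L sc (exec (Loop r p) \<sigma>) ((map refresh ts1)[\<tau> r := ?t])"
    by (simp add: upd)
  then show ?case using computes_seq[OF 1(1) 2]
    unfolding compile.simps time.simps length_rev by blast
qed

section \<open>Polynomial time\<close>

text \<open>Registers looped over inside \<open>p\<close> keep their contents through every pass, so
  that the same bound \<open>B\<close> serves all passes.\<close>

lemma loop_time_bound:
  assumes body: "\<And>\<sigma>. \<forall>s\<in>loops p. length (\<sigma> s) \<le> N \<Longrightarrow> time p \<sigma> \<le> B"
    and r: "r \<notin> loops p" "writes p \<inter> loops p = {}"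
    and "\<forall>s\<in>loops p. length (\<sigma> s) \<le> N"
  shows "loop_time (exec p) (time p) r xs \<sigma> \<le> length xs * (B + 2) + 1"
  using assms(4)
proof (induction xs arbitrary: \<sigma>)
  case (Cons x xs)
  let ?\<sigma> = "\<sigma>(r := x # xs)"
  have 1: "\<forall>s\<in>loops p. length (?\<sigma> s) \<le> N" using Cons.prems r by auto
  then have "\<forall>s\<in>loops p. length (exec p ?\<sigma> s) \<le> N"
    using exec_frame r(2) by (metis disjoint_iff)
  note Cons.IH[OF this]
  moreover have "time p ?\<sigma> \<le> B" using body 1 by blast
  ultimately show ?case by simp
qed simp

text \<open>If no loop register is ever written, the running time is bounded in terms of the initial
  lengths of these registers, however much others grow. Each nesting level then only multiplies by a
  length, and no polynomial has to be iterated.\<close>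

lemma time_bound_fixed_loops:
  assumes "ok p" "writes p \<inter> loops p = {}"
  shows "\<exists>q :: nat poly. \<forall>\<sigma> N. (\<forall>r\<in>loops p. length (\<sigma> r) \<le> N) \<longrightarrow> time p \<sigma> \<le> poly q N"
  using assms
proof (induction p)
  case Skip
  show ?case by (intro exI[of _ 0]) auto
next
  case (Push r b)
  show ?case by (intro exI[of _ "[:2:]"]) auto
next
  case (Pop r)
  show ?case by (intro exI[of _ "[:1:]"]) auto
next
  case (Seq p1 p2)
  then obtain q1 q2 where
    q1: "\<And>\<sigma> N. (\<forall>r\<in>loops p1. length (\<sigma> r) \<le> N) \<Longrightarrow> time p1 \<sigma> \<le> poly q1 N" and
    q2: "\<And>\<sigma> N. (\<forall>r\<in>loops p2. length (\<sigma> r) \<le> N) \<Longrightarrow> time p2 \<sigma> \<le> poly q2 N"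
    by (auto simp: Int_Un_distrib Int_Un_distrib2) 
  have "time (p1 ;; p2) \<sigma> \<le> poly (q1 + q2) N" if "\<forall>r\<in>loops (p1 ;; p2). length (\<sigma> r) \<le> N" for \<sigma> N
  proof -
    have "\<forall>r\<in>loops p2. exec p1 \<sigma> r = \<sigma> r"
      using Seq.prems(2) by (auto intro!: exec_frame)
    then show ?thesis using that q1[of \<sigma> N] q2[of "exec p1 \<sigma>" N] by (auto intro!: add_mono)
  qed
  then show ?case by blast
next
  case (Cond r v p1 p2)
  then obtain q1 q2 where
    q1: "\<And>\<sigma> N. (\<forall>r\<in>loops p1. length (\<sigma> r) \<le> N) \<Longrightarrow> time p1 \<sigma> \<le> poly q1 N" and
    q2: "\<And>\<sigma> N. (\<forall>r\<in>loops p2. length (\<sigma> r) \<le> N) \<Longrightarrow> time p2 \<sigma> \<le> poly q2 N"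
    by (auto simp: Int_Un_distrib Int_Un_distrib2)
  have "time (Cond r v p1 p2) \<sigma> \<le> poly (1 + q1 + q2) N"
    if "\<forall>r\<in>loops (Cond r v p1 p2). length (\<sigma> r) \<le> N" for \<sigma> N
    using that q1[of \<sigma> N] q2[of \<sigma> N] by auto
  then show ?case by blast
next
  case (Loop r p)
  then obtain q where
    q: "\<And>\<sigma> N. (\<forall>r\<in>loops p. length (\<sigma> r) \<le> N) \<Longrightarrow> time p \<sigma> \<le> poly q N"
    by auto
  \<comment> \<open>\<open>[:4, 2:]\<close> collects the last loop test and the rewind,
    \<open>1 + (2 * N + 3)\<close>.\<close>
  have "time (Loop r p) \<sigma> \<le> poly ([:0, 1:] * (q + [:2:]) + [:4, 2:]) N"
    if N: "\<forall>r\<in>loops (Loop r p). length (\<sigma> r) \<le> N" for \<sigma> N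
  proof -
    have "loop_time (exec p) (time p) r (\<sigma> r) \<sigma> \<le> length (\<sigma> r) * (poly q N + 2) + 1"
      by (rule loop_time_bound[where N = N]) (use Loop.prems N q in auto)
    moreover have len: "length (\<sigma> r) \<le> N" using N by simp
    moreover have "length (\<sigma> r) * (poly q N + 2) \<le> N * (poly q N + 2)"
      by (rule mult_le_mono1[OF len])
    ultimately show ?thesis by (simp add: algebra_simps)
  qed
  then show ?case by blast
qed

lemma length_loop_le:
  assumes "\<And>\<sigma>. length (exec p \<sigma> s) \<le> length (\<sigma> s) + time p \<sigma>" "s \<noteq> r"
  shows "length (loop (exec p) r xs \<sigma> s) \<le> length (\<sigma> s) + loop_time (exec p) (time p) r xs \<sigma>"
proof (induction xs arbitrary: \<sigma>)
  case (Cons x xs)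
  show ?case using Cons.IH[of "exec p (\<sigma>(r := x # xs))"] assms(1)[of "\<sigma>(r := x # xs)"] assms(2)
    by simp
qed simp

lemma length_exec_le: "length (exec p \<sigma> s) \<le> length (\<sigma> s) + time p \<sigma>"
proof (induction p arbitrary: \<sigma>)
  case (Seq p1 p2)
  show ?case using Seq.IH(1)[of \<sigma>] Seq.IH(2)[of "exec p1 \<sigma>"] by simp
next
  case (Cond r v p1 p2)
  show ?case using Cond.IH[of \<sigma>] by (simp add: le_SucI)
next
  case (Loop r p)
  show ?case using length_loop_le[OF Loop.IH, of r "\<sigma> r" \<sigma>] by (auto intro: le_trans)
qed auto

text \<open>Outside of loops a program may write a register and loop over it later, so that the
  bounds of the two parts are composed; this happens only as often as the program text says. Inside
  a loop \<open>ok\<close> rules it out, and \<open>time_bound_fixed_loops\<close> applies.\<close>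

lemma time_bound:
  assumes "ok p"
  shows "\<exists>q :: nat poly. \<forall>\<sigma> N. (\<forall>r. length (\<sigma> r) \<le> N) \<longrightarrow> time p \<sigma> \<le> poly q N"
  using assms
proof (induction p)
  case Skip
  show ?case by (intro exI[of _ 0]) auto
next
  case (Push r b)
  show ?case by (intro exI[of _ "[:2:]"]) auto
next
  case (Pop r)
  show ?case by (intro exI[of _ "[:1:]"]) auto
next
  case (Seq p1 p2)
  then obtain q1 q2 where
    q1: "\<And>\<sigma> N. (\<forall>r. length (\<sigma> r) \<le> N) \<Longrightarrow> time p1 \<sigma> \<le> poly q1 N" and
    q2: "\<And>\<sigma> N. (\<forall>r. length (\<sigma> r) \<le> N) \<Longrightarrow> time p2 \<sigma> \<le> poly q2 N"
    by auto
  have "time (p1 ;; p2) \<sigma> \<le> poly (q1 + pcompose q2 ([:0, 1:] + q1)) N"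
    if N: "\<forall>r. length (\<sigma> r) \<le> N" for \<sigma> N
  proof -
    have "length (exec p1 \<sigma> r) \<le> N + poly q1 N" for r
      using length_exec_le[of p1 \<sigma> r] N q1[OF N] by (meson add_mono le_trans)
    then show ?thesis using q1[OF N] q2[of "exec p1 \<sigma>" "N + poly q1 N"]
      by (simp add: poly_pcompose add_mono)
  qed
  then show ?case by blast
next
  case (Cond r v p1 p2)
  then obtain q1 q2 where
    q1: "\<And>\<sigma> N. (\<forall>r. length (\<sigma> r) \<le> N) \<Longrightarrow> time p1 \<sigma> \<le> poly q1 N" and
    q2: "\<And>\<sigma> N. (\<forall>r. length (\<sigma> r) \<le> N) \<Longrightarrow> time p2 \<sigma> \<le> poly q2 N"
    by auto
  have "time (Cond r v p1 p2) \<sigma> \<le> poly (1 + q1 + q2) N"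
    if "\<forall>r. length (\<sigma> r) \<le> N" for \<sigma> N
    using q1[OF that] q2[OF that] by auto
  then show ?case by blast
next
  case (Loop r p)
  then have "writes (Loop r p) \<inter> loops (Loop r p) = {}" by simp
  from time_bound_fixed_loops[OF Loop.prems this] show ?case by blast
qed

lemma map_bit_symbol_inverse: "map (\<lambda>s. s = 2) (map bit_symbol xs) = xs"
  by (induction xs) (auto simp: bit_symbol_def)

lemma tm_output_holds:
  assumes "holds l sc xs (ts ! 1)"
  shows "tm_output (q, ts) = xs"
proof -
  obtain js where js: "snd (ts ! 1) = map bit_symbol xs @ js" "cell_hd js = 0"
    using assms by (auto simp: holds_def)
  have "takeWhile (\<lambda>s. s = 1 \<or> s = 2) js = []" using js(2) by (cases js) auto
  then have "takeWhile (\<lambda>s. s = 1 \<or> s = 2) (snd (ts ! 1)) = map bit_symbol xs"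
    unfolding js(1) by (subst takeWhile_append2) (auto simp: bit_symbol_def)
  then show ?thesis using map_bit_symbol_inverse[of xs] by (simp add: tm_output_def)
qed

abbreviation init_store :: "bool list \<Rightarrow> store" where
  "init_store x \<equiv> (\<lambda>_. [])(0 := x)"

theorem polytime_computable_exec:
  assumes "ok p"
  shows "polytime_computable (\<lambda>x. exec p (init_store x) 1)"
proof -
  define m where "m = Suc (Max (insert 1 (regs p)))"
  have m: "regs p \<subseteq> {..<m}" "1 < m"
    using finite_regs[of p] by (auto simp: m_def less_Suc_eq_le)
  define M where "M = compile m 3 id p"
  have wf: "wf_code m 3 M" unfolding M_def using m(1) by (intro wf_compile) auto
  obtain q where q: "\<And>\<sigma> N. (\<forall>r. length (\<sigma> r) \<le> N) \<Longrightarrow> time p \<sigma> \<le> poly q N"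
    using time_bound[OF assms] by blast
  have "tm_computes_within M x (exec p (init_store x) 1) (poly q (length x))" for x
  proof -
    let ?ts = "([], map bit_symbol x) # replicate (m - 1) ([], [])"
    have "represents id m UNIV (\<lambda>_. []) (init_store x) ?ts"
      by (auto simp: represents_def holds_def nth_Cons' intro: exI[of _ 0])
    from compile_correct[OF assms m(1) _ _ this, of m 3] obtain ts' where
      c: "computes M ?ts (time p (init_store x)) ts'"
      and r: "represents id m UNIV (\<lambda>_. []) (exec p (init_store x)) ts'"
      unfolding M_def by blast
    then obtain s where s: "s \<le> time p (init_store x)" "tm_runs M (0, ?ts) s (tm_states M, ts')"
      by (auto simp: computes_def)
    have "time p (init_store x) \<le> poly q (length x)" by (rule q) auto
    then have "(tm_step M ^^ poly q (length x)) (0, ?ts) = (tm_states M, ts')"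
      using tm_runs_halt[OF s(2)] s(1) by (meson le_trans)
    moreover have "tm_init M x = (0, ?ts)" using wf by (simp add: tm_init_def wf_code_def)
    moreover have "tm_output (tm_states M, ts') = exec p (init_store x) 1"
      using r m(2) by (intro tm_output_holds) (auto simp: represents_def)
    ultimately show ?thesis by (simp add: tm_computes_within_def Let_def)
  qed
  moreover have "wf_tm M" using wf m(2) by (auto simp: wf_tm_iff_wf_code wf_code_def)
  ultimately show ?thesis unfolding polytime_computable_def by blast
qed


section \<open>Running an arbitrary machine inside a larger one\<close>

definition tapes_below :: "nat \<Rightarrow> tape list \<Rightarrow> bool" where
  "tapes_below A ts \<longleftrightarrow> (\<forall>t\<in>set ts. \<forall>s\<in>set (fst t) \<union> set (snd t). s < A)"

lemma cell_hd_less: "\<forall>s\<in>set xs. s < A \<Longrightarrow> 0 < A \<Longrightarrow> cell_hd xs < A"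
  by (cases xs) auto

lemma tl_less: "\<forall>s\<in>set xs. s < A \<Longrightarrow> \<forall>s\<in>set (tl xs). s < (A :: nat)"
  by (cases xs) auto

lemma read_tapes_below: "tapes_below A ts \<Longrightarrow> 0 < A \<Longrightarrow> \<forall>s\<in>set (map read_tape ts). s < A"
  by (auto simp: tapes_below_def read_tape_def intro!: cell_hd_less)

lemma write_move_below:
  assumes "\<forall>s\<in>set (fst t) \<union> set (snd t). s < A" "fst a < A"
  shows "\<forall>s\<in>set (fst (write_move a t)) \<union> set (snd (write_move a t)). s < A"
proof -
  have A: "0 < A" using assms(2) by simp
  obtain ls rs where t: "t = (ls, rs)" by (cases t)
  obtain s m where a: "a = (s, m)" by (cases a)
  have "\<forall>s\<in>set ls. s < A" "\<forall>s\<in>set rs. s < A" "s < A" using assms by (auto simp: t a)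
  then show ?thesis using tl_less[of ls A] tl_less[of rs A] cell_hd_less[of ls A] A
    by (cases m) (auto simp: t a)
qed

lemma tapes_below_step:
  assumes "tapes_below A ts" "\<forall>a\<in>set as. fst a < A"
  shows "tapes_below A (map2 write_move as ts)"
  unfolding tapes_below_def
proof
  fix u assume "u \<in> set (map2 write_move as ts)"
  then obtain a t where at: "(a, t) \<in> set (zip as ts)" "u = write_move a t" by auto
  then have "t \<in> set ts" "a \<in> set as" by (auto dest: set_zip_leftD set_zip_rightD)
  then show "\<forall>s\<in>set (fst u) \<union> set (snd u). s < A"
    unfolding at(2) using assms by (intro write_move_below) (auto simp: tapes_below_def)
qed

text \<open>\<open>wf_code\<close> controls the transition function only on symbols below
  \<open>A\<close>. That the tapes never leave the alphabet is carried through the run, as otherwise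
  a step could return a list of actions of the wrong length.\<close>

lemma funpow_imp_tm_runs:
  assumes wf: "wf_code K A M" and A: "0 < A"
    and "length ts = K" "tapes_below A ts" "q \<le> tm_states M"
    and "fst ((tm_step M ^^ t) (q, ts)) = tm_states M"
  shows "\<exists>s\<le>t. tm_runs M (q, ts) s ((tm_step M ^^ t) (q, ts))"
  using assms(3-)
proof (induction t arbitrary: q ts)
  case 0
  then show ?case by (auto intro: tm_runs_refl)
next
  case (Suc t)
  show ?case
  proof (cases "q = tm_states M")
    case True
    then show ?thesis using tm_step_halted[of "Suc t" M ts] tm_runs_refl by (metis le0)
  next
    case False
    then have q: "q < tm_states M" using Suc.prems by simp
    obtain q' as where d: "tm_delta M q (map read_tape ts) = (q', as)" by fastforce
    have w: "q' \<le> tm_states M \<and> length as = K \<and> (\<forall>a \<in> set as. fst a < A)"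
      using wf_codeD(3)[OF wf q, of "map read_tape ts"] read_tapes_below[OF Suc.prems(2) A] Suc.prems d
      by auto
    let ?ts = "map2 write_move as ts"
    have st: "(tm_step M ^^ Suc t) (q, ts) = (tm_step M ^^ t) (q', ?ts)"
      using False d by (simp add: tm_step_def funpow_Suc_right del: funpow.simps)
    have "\<exists>s\<le>t. tm_runs M (q', ?ts) s ((tm_step M ^^ t) (q', ?ts))"
      using Suc.prems w st by (intro Suc.IH tapes_below_step) auto
    then obtain s where s: "s \<le> t" "tm_runs M (q', ?ts) s ((tm_step M ^^ t) (q', ?ts))" by blast
    from tm_runs_step[OF q d s(2)] s(1) show ?thesis unfolding st by (metis Suc_le_mono)
  qed
qed

definition lift_tm :: "nat \<Rightarrow> tm \<Rightarrow> tm" where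
  "lift_tm d M = M\<lparr>tm_tapes := tm_tapes M + d,
     tm_delta := (\<lambda>q ss. apsnd (\<lambda>as. as @ keep (drop (tm_tapes M) ss))
       (tm_delta M q (take (tm_tapes M) ss)))\<rparr>"

lemma wf_lift_tm:
  assumes "wf_code K A M"
  shows "wf_code (K + d) A (lift_tm d M)"
proof (rule wf_codeI, goal_cases)
  case (3 q ss)
  have "length (take K ss) = K" "\<forall>s\<in>set (take K ss). s < A" "\<forall>s\<in>set (drop K ss). s < A"
    using 3 by (auto dest: in_set_takeD in_set_dropD)
  then show ?case
    using wf_codeD(3)[OF assms, of q "take K ss"] wf_codeD(1)[OF assms] 3 by (auto simp: lift_tm_def)
qed (use assms in \<open>auto simp: lift_tm_def wf_code_def\<close>)

definition fresh :: "tape \<Rightarrow> bool" where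
  "fresh u \<longleftrightarrow> fst u = [] \<and> snd u \<in> {[], [0]}"

lemma fresh_refresh: "fresh u \<Longrightarrow> fresh (refresh u)"
  by (auto simp: fresh_def refresh_def read_tape_def)

lemma length_write_move_le: "length (snd (write_move a t)) \<le> Suc (max 1 (length (snd t)))"
  by (cases "(a, t)" rule: write_move.cases) auto

text \<open>The added tapes are idle, hence blank up to explicit blanks. The bound on the tape
  lengths serves to bound the output of \<open>M\<close>: one step lengthens the right part by at
  most one cell, if an empty part is counted as one cell.\<close>

lemma tm_runs_lift:
  assumes "tm_runs M c t c'" and wf: "wf_code K A M" and A: "0 < A"
    and "length (snd c) = K" "tapes_below A (snd c)" "\<forall>u\<in>set us. fresh u"
  shows "\<exists>us'. length us' = length us \<and> (\<forall>u\<in>set us'. fresh u) \<and>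
      tm_runs (lift_tm d M) (fst c, snd c @ us) t (fst c', snd c' @ us') \<and> length (snd c') = K \<and>
      (\<forall>i<K. length (snd (snd c' ! i)) \<le> max 1 (length (snd (snd c ! i))) + t)"
  using assms(1,4-)
proof (induction arbitrary: us rule: tm_runs.induct)
  case (tm_runs_refl c)
  then show ?case by (intro exI[of _ us]) (auto intro: tm_runs.tm_runs_refl)
next
  case (tm_runs_step q ts q' as t c)
  have K: "length ts = K" "tm_tapes M = K" using tm_runs_step.prems wf by (auto simp: wf_code_def)
  have w: "length as = K" "\<forall>a \<in> set as. fst a < A"
    using wf_codeD(3)[OF wf tm_runs_step.hyps(1), of "map read_tape ts"]
      read_tapes_below[of A ts] A tm_runs_step.prems tm_runs_step.hyps(2) by auto
  let ?ts = "map2 write_move as ts" and ?us = "map refresh us"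
  have "tapes_below A ?ts" using tm_runs_step.prems w by (intro tapes_below_step) auto
  moreover have "length ?ts = K" using w K by simp
  ultimately obtain us' where us': "length us' = length us" "\<forall>u\<in>set us'. fresh u"
    "tm_runs (lift_tm d M) (q', ?ts @ ?us) t (fst c, snd c @ us')" "length (snd c) = K"
    "\<forall>i<K. length (snd (snd c ! i)) \<le> max 1 (length (snd (?ts ! i))) + t"
    using tm_runs_step.IH[of ?us] tm_runs_step.prems(3) fresh_refresh by auto
  have "tm_runs (lift_tm d M) (q, ts @ us) (Suc t) (fst c, snd c @ us')"
  proof (rule tm_runs.tm_runs_step)
    show "q < tm_states (lift_tm d M)" using tm_runs_step.hyps(1) by (simp add: lift_tm_def)
    show "tm_delta (lift_tm d M) q (map read_tape (ts @ us)) = (q', as @ keep (map read_tape us))"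
      using tm_runs_step.hyps(2) K by (simp add: lift_tm_def)
    have "map2 write_move (as @ keep (map read_tape us)) (ts @ us) = ?ts @ ?us"
      using w K map2_keep[of us] by (simp del: map_map)
    then show "tm_runs (lift_tm d M) (q', map2 write_move (as @ keep (map read_tape us)) (ts @ us)) t
        (fst c, snd c @ us')" using us'(3) by simp
  qed
  moreover have "length (snd (snd c ! i)) \<le> max 1 (length (snd (ts ! i))) + Suc t" if "i < K" for i
  proof -
    have "?ts ! i = write_move (as ! i) (ts ! i)" using that w K by simp
    then have "length (snd (?ts ! i)) \<le> Suc (max 1 (length (snd (ts ! i))))"
      using length_write_move_le by metis
    moreover have "length (snd (snd c ! i)) \<le> max 1 (length (snd (?ts ! i))) + t"
      using us'(5) that by blast
    ultimately show ?thesis by linarith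
  qed
  ultimately show ?case using us' by auto
qed

text \<open>The loop condition is the one by which \<open>tm_output\<close> delimits the output.
  Bits are copied in the direction of reading, so that the head of tape \<open>k\<close> ends behind
  them and has to be rewound.\<close>

definition copy_tm :: "nat \<Rightarrow> nat \<Rightarrow> nat \<Rightarrow> tm" where
  "copy_tm K A k = while_tm (\<lambda>ss. ss ! 1 = 1 \<or> ss ! 1 = 2)
     (act_tm K A (\<lambda>ss. (keep ss)[1 := (ss ! 1, MoveRight), k := (ss ! 1, MoveRight)]))"

lemma wf_copy_tm:
  assumes "1 < K" "k < K"
  shows "wf_code K A (copy_tm K A k)"
  unfolding copy_tm_def
proof (intro wf_while_tm wf_act_tm)
  fix ss :: "nat list" assume *: "length ss = K" "\<forall>s\<in>set ss. s < A"
  let ?a = "(ss ! 1, MoveRight)"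
  have "set ((keep ss)[1 := ?a, k := ?a]) \<subseteq> insert ?a (set (keep ss))"
    by (meson insert_subset order_trans set_update_subset_insert subset_insertI subset_refl insertI1)
  moreover have "ss ! 1 < A" using * assms by auto
  ultimately show "length ((keep ss)[1 := ?a, k := ?a]) = K \<and>
      (\<forall>a\<in>set ((keep ss)[1 := ?a, k := ?a]). fst a < A)"
    using * by auto
qed

lemma computes_copy:
  assumes "1 < length ts" "k < length ts" "k \<noteq> 1"
    and "ts ! 1 = (ls, map bit_symbol y @ js)" "cell_hd js \<noteq> 1" "cell_hd js \<noteq> 2"
    and "ts ! k = (map bit_symbol w, rs)" "rs \<in> {[], [0]}"
  shows "\<exists>ts' ls' rs'. computes (copy_tm K A k) ts (2 * length y + 1) ts' \<and>
    length ts' = length ts \<and> ts' ! 1 = (ls', cell_hd js # tl js) \<and>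
    ts' ! k = (map bit_symbol (rev y @ w), rs') \<and> rs' \<in> {[], [0]} \<and>
    (\<forall>j<length ts. j \<noteq> 1 \<longrightarrow> j \<noteq> k \<longrightarrow> ts' ! j = refresh (ts ! j))"
  using assms
proof (induction y arbitrary: ts ls w rs)
  case Nil
  have "computes (copy_tm K A k) ts 1 (map refresh ts)"
    unfolding copy_tm_def by (rule computes_while_False) (use Nil in \<open>auto simp: read_tape_def\<close>)
  then show ?case using Nil
    by (intro exI[of _ "map refresh ts"] exI[of _ ls] exI[of _ "[0]"])
      (auto simp: refresh_def read_tape_def)
next
  case (Cons b y)
  let ?P = "\<lambda>ss :: nat list. ss ! 1 = 1 \<or> ss ! 1 = 2"
  let ?a = "\<lambda>ss :: nat list. (keep ss)[1 := (ss ! 1, MoveRight), k := (ss ! 1, MoveRight)]"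
  let ?ts = "map2 write_move (?a (map read_tape (map refresh ts))) (map refresh ts)"
  have rd: "read_tape (ts ! 1) = bit_symbol b" using Cons.prems by (simp add: read_tape_def)
  have P: "?P (map read_tape ts)" using Cons.prems(1) rd by (auto simp: bit_symbol_def)
  have t1: "?ts ! 1 = (bit_symbol b # ls, map bit_symbol y @ js)"
    using Cons.prems rd by simp
  have tk: "?ts ! k = (map bit_symbol (b # w), [])"
    using Cons.prems rd by auto
  have tj: "?ts ! j = refresh (ts ! j)" if "j < length ts" "j \<noteq> 1" "j \<noteq> k" for j
    using that Cons.prems(1-3) write_move_Stay_read[of "refresh (ts ! j)"] by simp
  have "\<exists>ts' ls' rs'. computes (copy_tm K A k) ?ts (2 * length y + 1) ts' \<and>
    length ts' = length ?ts \<and> ts' ! 1 = (ls', cell_hd js # tl js) \<and>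
    ts' ! k = (map bit_symbol (rev y @ b # w), rs') \<and> rs' \<in> {[], [0]} \<and>
    (\<forall>j<length ?ts. j \<noteq> 1 \<longrightarrow> j \<noteq> k \<longrightarrow> ts' ! j = refresh (?ts ! j))"
    by (rule Cons.IH[OF _ _ _ t1 _ _ tk]) (use Cons.prems in auto)
  then obtain ts' ls' rs' where ts': "computes (copy_tm K A k) ?ts (2 * length y + 1) ts'"
    "length ts' = length ?ts" "ts' ! 1 = (ls', cell_hd js # tl js)"
    "ts' ! k = (map bit_symbol (rev y @ b # w), rs')" "rs' \<in> {[], [0]}"
    "\<forall>j<length ?ts. j \<noteq> 1 \<longrightarrow> j \<noteq> k \<longrightarrow> ts' ! j = refresh (?ts ! j)" by blast
  have "computes (copy_tm K A k) ts (Suc (1 + (2 * length y + 1))) ts'"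
    unfolding copy_tm_def
    by (rule computes_while_True[where P = ?P, OF P computes_act]) (use ts'(1) in \<open>simp add: copy_tm_def\<close>)
  moreover have "\<forall>j<length ts. j \<noteq> 1 \<longrightarrow> j \<noteq> k \<longrightarrow> ts' ! j = refresh (ts ! j)"
    using ts'(6) tj by simp
  ultimately show ?case using ts'(2-5) by auto
qed

text \<open>Tape 1 of the first machine is reused for the output although it may hold rubbish: pushing
  overwrites it, and nothing loops over register 1.\<close>

theorem polytime_computable_exec_comp:
  assumes f: "polytime_computable f" and p: "ok p" "1 \<notin> loops p"
  shows "polytime_computable (\<lambda>x. exec p (init_store (f x)) 1)"
proof -
  obtain M pf where M: "wf_tm M" and pf: "\<And>x. tm_computes_within M x (f x) (poly pf (length x))"
    using f by (auto simp: polytime_computable_def)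
  define k A where "k = tm_tapes M" and "A = tm_alphabet M"
  have k: "2 \<le> k" and A: "3 \<le> A" and wfM: "wf_code k A M"
    using M by (auto simp: wf_tm_iff_wf_code k_def A_def)
  define m where "m = Suc (Max (insert 1 (regs p)))"
  have m: "regs p \<subseteq> {..<m}" "1 < m"
    using finite_regs[of p] by (auto simp: m_def less_Suc_eq_le)
  define K where "K = k + m"
  \<comment> \<open>Register 0 becomes the first added tape. Register 1 remains tape 1, where the
    output is expected, and the other registers take further added tapes.\<close>
  define \<tau> where "\<tau> = (\<lambda>r. if r = 0 then k else if r = 1 then 1 else k + r - 1)"
  have \<tau>: "inj_on \<tau> {..<m}" "\<And>r. r < m \<Longrightarrow> \<tau> r < K" "\<tau> 1 = 1"
    using k m by (auto simp: inj_on_def \<tau>_def K_def split: if_splits)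
  \<comment> \<open>Copying stops with the head of tape 1 on a cell that holds no bit but perhaps a
    work symbol of \<open>M\<close>; blanking it makes register 1 an empty stack.\<close>
  define N where "N = seq_tm (lift_tm m M) (seq_tm (copy_tm K A k)
    (seq_tm (act1 K A 1 (\<lambda>s. (0, Stay))) (seq_tm (rewind_tm K A k) (compile K A \<tau> p))))"
  have wf: "wf_code K A N"
    unfolding N_def using wf_lift_tm[OF wfM, of m] m k A \<tau>
    by (intro wf_seq_tm wf_copy_tm wf_act1 wf_rewind_tm wf_compile) (auto simp: K_def)
  obtain q where q: "\<And>\<sigma> N. (\<forall>r. length (\<sigma> r) \<le> N) \<Longrightarrow> time p \<sigma> \<le> poly q N"
    using time_bound[OF p(1)] by blast
  \<comment> \<open>With \<open>T\<close> the time bound of \<open>M\<close>, its output has length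
    at most \<open>1 + T\<close>. Copying and rewinding take twice this length each, hence the
    factor 4; the constant 5 is \<open>1 + 1 + 3\<close>; and \<open>q\<close> bounds the program on
    an input of this length.\<close>
  define pn where "pn = pf + [:5:] + smult 4 ([:1:] + pf) + pcompose q ([:1:] + pf)"
  have "tm_computes_within N x (exec p (init_store (f x)) 1) (poly pn (length x))" for x
  proof -
    define T where "T = poly pf (length x)"
    let ?ts0 = "([], map bit_symbol x) # replicate (k - 1) ([], []) :: tape list"
    let ?y = "f x"
    have init: "tm_init M x = (0, ?ts0)" by (simp add: tm_init_def k_def)
    obtain ts1 where ts1: "(tm_step M ^^ T) (0, ?ts0) = (tm_states M, ts1)"
      and out: "tm_output (tm_states M, ts1) = ?y"
      using pf[of x] by (cases "(tm_step M ^^ T) (0, ?ts0)")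
        (auto simp: tm_computes_within_def Let_def init T_def)
    have len0: "length ?ts0 = k" using k by simp
    have A0: "0 < A" using A by simp
    have below: "tapes_below A ?ts0"
      using A by (auto simp: tapes_below_def bit_symbol_def)
    obtain s where s: "s \<le> T" "tm_runs M (0, ?ts0) s (tm_states M, ts1)"
      using funpow_imp_tm_runs[OF wfM _ len0 below, of 0 T] A ts1 by auto
    have "\<forall>u\<in>set (replicate m ([], [])). fresh u" by (simp add: fresh_def)
    from tm_runs_lift[OF s(2) wfM _ _ _ this, of m, unfolded fst_conv snd_conv length_replicate,
        OF A0 len0 below]
    obtain us where us: "length us = m" "\<forall>u\<in>set us. fresh u"
      "tm_runs (lift_tm m M) (0, ?ts0 @ replicate m ([], [])) s (tm_states M, ts1 @ us)"
      "length ts1 = k" "\<forall>i<k. length (snd (ts1 ! i)) \<le> max 1 (length (snd (?ts0 ! i))) + s"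
      by blast
    have 1: "computes (lift_tm m M) (?ts0 @ replicate m ([], [])) T (ts1 @ us)"
      using us(3) s(1) by (auto simp: computes_def lift_tm_def)
    let ?Q = "\<lambda>s. s = 1 \<or> s = (2 :: nat)"
    let ?rs = "snd (ts1 ! 1)"
    have y: "map bit_symbol ?y = takeWhile ?Q ?rs"
    proof -
      have "map bit_symbol (map (\<lambda>s. s = 2) xs) = xs" if "\<forall>s\<in>set xs. ?Q s" for xs
        using that by (induction xs) (auto simp: bit_symbol_def)
      moreover have "\<forall>s\<in>set (takeWhile ?Q ?rs). ?Q s" by (auto dest!: set_takeWhileD)
      moreover have "?y = map (\<lambda>s. s = 2) (takeWhile ?Q ?rs)" using out by (simp add: tm_output_def)
      ultimately show ?thesis by metis
    qed
    define js where "js = dropWhile ?Q ?rs"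
    have js: "cell_hd js \<noteq> 1" "cell_hd js \<noteq> 2"
      using hd_dropWhile[of ?Q ?rs] unfolding js_def[symmetric] by (cases js; auto)+
    have rs: "?rs = map bit_symbol ?y @ js" unfolding y js_def by simp
    have leny: "length ?y \<le> 1 + T"
    proof -
      have "length (snd (ts1 ! 1)) \<le> 1 + s" using us(5) k by (auto dest!: spec[of _ 1])
      then show ?thesis using rs s(1) by simp
    qed
    have fr: "us ! 0 = ([], snd (us ! 0))" "snd (us ! 0) \<in> {[], [0]}"
      using us(1,2) m(2) nth_mem[of 0 us] by (auto simp: fresh_def prod_eq_iff)
    have L: "length (ts1 @ us) = K" using us by (simp add: K_def)
    have "\<exists>ts' ls' rs'. computes (copy_tm K A k) (ts1 @ us) (2 * length ?y + 1) ts' \<and>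
        length ts' = length (ts1 @ us) \<and> ts' ! 1 = (ls', cell_hd js # tl js) \<and>
        ts' ! k = (map bit_symbol (rev ?y @ []), rs') \<and> rs' \<in> {[], [0]} \<and>
        (\<forall>j<length (ts1 @ us). j \<noteq> 1 \<longrightarrow> j \<noteq> k \<longrightarrow> ts' ! j = refresh ((ts1 @ us) ! j))"
      by (rule computes_copy[where ls = "fst (ts1 ! 1)" and rs = "snd (us ! 0)"])
        (use k m us js rs fr in \<open>auto simp: nth_append prod_eq_iff\<close>)
    then obtain ts2 ls2 rs2 where ts2: "computes (copy_tm K A k) (ts1 @ us) (2 * length ?y + 1) ts2"
        "length ts2 = K" "ts2 ! 1 = (ls2, cell_hd js # tl js)"
        "ts2 ! k = (map bit_symbol (rev ?y), rs2)" "rs2 \<in> {[], [0]}"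
        "\<forall>j<K. j \<noteq> 1 \<longrightarrow> j \<noteq> k \<longrightarrow> ts2 ! j = refresh ((ts1 @ us) ! j)"
      using L by auto
    define ts3 where "ts3 = (map refresh ts2)[1 := (ls2, 0 # tl js)]"
    have kK: "k < K" "1 < K" "k \<noteq> 1" using k m by (auto simp: K_def)
    have 3: "computes (act1 K A 1 (\<lambda>s. (0, Stay))) ts2 1 ts3"
      using computes_act1[of 1 ts2 K A "\<lambda>s. (0, Stay)"] ts2(2,3) kK by (simp add: ts3_def)
    have "ts3 ! k = (map bit_symbol (rev ?y) @ replicate 0 0, [0])"
      using ts2(2,4,5) kK by (auto simp: ts3_def refresh_def read_tape_def)
    from computes_rewind[OF _ this, of K A] ts2(2) kK
    have 4: "computes (rewind_tm K A k) ts3 (2 * length ?y + 3)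
        ((map refresh ts3)[k := ([0], map bit_symbol ?y @ [0])])" by (simp add: ts3_def)
    define ts4 where "ts4 = (map refresh ts3)[k := ([0], map bit_symbol ?y @ [0])]"
    have len4: "length ts4 = K" using ts2(2) by (simp add: ts4_def ts3_def)
    have "represents \<tau> m (loops p) (\<lambda>_. []) (init_store ?y) ts4"
      unfolding represents_def
    proof (intro conjI allI impI)
      fix r assume r: "r < m"
      show "\<tau> r < length ts4" using \<tau>(2)[OF r] len4 by simp
      consider "r = 0" | "r = 1" | "r \<ge> 2" by linarith
      then show "holds (r \<in> loops p) [] (init_store ?y r) (ts4 ! \<tau> r)"
      proof cases
        case 1
        then have "ts4 ! \<tau> r = ([0], map bit_symbol ?y @ [0])"
          using kK ts2(2) by (simp add: \<tau>_def ts4_def ts3_def)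
        then show ?thesis using 1 by (auto simp: holds_def intro: exI[of _ 1])
      next
        case 2
        then have "ts4 ! \<tau> r = (ls2, 0 # tl js)"
          using kK ts2(2) \<tau>(3) by (simp add: ts4_def ts3_def)
        then show ?thesis using 2 p(2) by (auto simp: holds_def)
      next
        case 3
        then have \<tau>r: "\<tau> r = k + (r - 1)" "\<tau> r \<noteq> 1" "\<tau> r \<noteq> k" "\<tau> r < K"
          using k r by (auto simp: \<tau>_def K_def)
        have "(ts1 @ us) ! \<tau> r = us ! (r - 1)"
          unfolding \<tau>r(1) us(4)[symmetric] by (rule nth_append_length_plus)
        moreover have "ts2 ! \<tau> r = refresh ((ts1 @ us) ! \<tau> r)" using ts2(6) \<tau>r by blast
        ultimately have "ts4 ! \<tau> r = refresh (us ! (r - 1))"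
          using \<tau>r(2-4) ts2(2) by (simp add: ts4_def ts3_def)
        moreover have "fresh (us ! (r - 1))" using us(1,2) r by simp
        ultimately have "fresh (ts4 ! \<tau> r)" using fresh_refresh by simp
        then show ?thesis using 3 by (auto simp: holds_def fresh_def)
      qed
    qed (rule \<tau>(1))
    from compile_correct[OF p(1) m(1) subset_refl _ this, of K A] obtain ts5 where
      5: "computes (compile K A \<tau> p) ts4 (time p (init_store ?y)) ts5"
      and r: "represents \<tau> m (loops p) (\<lambda>_. []) (exec p (init_store ?y)) ts5"
      by blast
    have "computes N (?ts0 @ replicate m ([], []))
        (T + ((2 * length ?y + 1) + (1 + ((2 * length ?y + 3) + time p (init_store ?y))))) ts5"
      unfolding N_def
      by (rule computes_seq[OF 1 computes_seq[OF ts2(1) computes_seq[OF 3 computes_seq[OF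
              4[folded ts4_def] 5]]]])
    then obtain s' where s': "tm_runs N (0, ?ts0 @ replicate m ([], [])) s' (tm_states N, ts5)"
      "s' \<le> T + ((2 * length ?y + 1) + (1 + ((2 * length ?y + 3) + time p (init_store ?y))))"
      by (auto simp: computes_def)
    have "time p (init_store ?y) \<le> poly q (1 + T)" using leny by (intro q) auto
    then have "s' \<le> poly pn (length x)"
      using s'(2) leny by (simp add: pn_def T_def poly_pcompose)
    then have "(tm_step N ^^ poly pn (length x)) (0, ?ts0 @ replicate m ([], [])) = (tm_states N, ts5)"
      by (rule tm_runs_halt[OF s'(1)])
    moreover have "tm_init N x = (0, ?ts0 @ replicate m ([], []))"
      using wf_codeD(1)[OF wf] k by (simp add: tm_init_def K_def flip: replicate_add)
    moreover have "tm_output (tm_states N, ts5) = exec p (init_store ?y) 1"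
      using r m(2) \<tau>(3) by (intro tm_output_holds) (auto simp: represents_def)
    ultimately show ?thesis by (simp add: tm_computes_within_def Let_def)
  qed
  moreover have "wf_tm N" using wf k A by (auto simp: wf_tm_iff_wf_code wf_code_def K_def)
  ultimately show ?thesis unfolding polytime_computable_def by blast
qed

section \<open>Programs\<close>

abbreviation IfEmpty :: "nat \<Rightarrow> cmd \<Rightarrow> cmd \<Rightarrow> cmd" where
  "IfEmpty r \<equiv> Cond r 0"

abbreviation IfTrue :: "nat \<Rightarrow> cmd \<Rightarrow> cmd \<Rightarrow> cmd" where
  "IfTrue r \<equiv> Cond r 2"

lemma top_symbol_simps [simp]:
  "top_symbol [] = 0" "top_symbol (b # xs) = bit_symbol b"
  by (simp_all add: top_symbol_def)

lemma bit_symbol_simps [simp]: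
  "bit_symbol b = 0 \<longleftrightarrow> False" "bit_symbol b = 2 \<longleftrightarrow> b" "bit_symbol b = bit_symbol c \<longleftrightarrow> b = c"
  "bit_symbol True = 2" "0 = bit_symbol b \<longleftrightarrow> False"
  by (auto simp: bit_symbol_def)

lemma top_symbol_eq_2: "top_symbol xs = 2 \<longleftrightarrow> xs \<noteq> [] \<and> hd xs"
  by (cases xs) auto

text \<open>A loop sets \<open>r\<close> before each pass and restores it at the end, so what the
  recursion leaves in \<open>r\<close> is noise. Loop lemmas are therefore stated after overwriting
  \<open>r\<close> by an arbitrary \<open>w\<close> on both sides.\<close>

lemma exec_Loop_eqI:
  assumes "\<And>w. (loop (exec p) r (\<sigma> r) \<sigma>)(r := w) = \<tau>(r := w)" "\<tau> r = \<sigma> r"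
  shows "exec (Loop r p) \<sigma> = \<tau>"
  using assms(1)[of "\<sigma> r"] assms(2) by (metis exec.simps(6) fun_upd_triv)

lemma loop_Cons_eqI:
  assumes "f (\<sigma>(r := x # xs)) = \<tau>" "(loop f r xs \<tau>)(r := w) = \<rho>(r := w)" "\<rho>(r := w) = \<sigma>'(r := w)"
  shows "(loop f r (x # xs) \<sigma>)(r := w) = \<sigma>'(r := w)"
  using assms by simp

text \<open>The step may assume that registers not written by the body are unchanged, which keeps
  them out of the invariants. An invariant must not depend on \<open>r\<close>, since each pass
  overwrites it.\<close>

lemma exec_Loop_invariant:
  assumes "I 0 \<sigma>"
    and step: "\<And>i \<tau>. i < length (\<sigma> r) \<Longrightarrow> I i \<tau> \<Longrightarrow> \<tau> r = drop i (\<sigma> r) \<Longrightarrow>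
      (\<And>s. s \<notin> writes p \<Longrightarrow> s \<noteq> r \<Longrightarrow> \<tau> s = \<sigma> s) \<Longrightarrow> I (Suc i) (exec p \<tau>)"
    and indep: "\<And>i \<tau> v. I i \<tau> \<Longrightarrow> I i (\<tau>(r := v))"
  shows "I (length (\<sigma> r)) (exec (Loop r p) \<sigma>)"
proof -
  have "I (i + length xs) (loop (exec p) r xs \<tau>)"
    if "drop i (\<sigma> r) = xs" "i \<le> length (\<sigma> r)" "I i \<tau>" "\<And>s. s \<notin> writes p \<Longrightarrow> s \<noteq> r \<Longrightarrow> \<tau> s = \<sigma> s"
    for i xs \<tau>
    using that
  proof (induction xs arbitrary: i \<tau>)
    case (Cons x xs)
    let ?\<tau> = "\<tau>(r := x # xs)"
    have i: "i < length (\<sigma> r)" using Cons.prems(1) by (metis drop_eq_Nil2 linorder_not_le neq_Nil_conv)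
    have "I i ?\<tau>" using Cons.prems(3) by (rule indep)
    then have I: "I (Suc i) (exec p ?\<tau>)"
      by (rule step[OF i]) (use Cons.prems in auto)
    have "drop (Suc i) (\<sigma> r) = xs" using Cons.prems(1) by (simp add: drop_Suc drop_tl flip: tl_drop)
    then have "I (Suc i + length xs) (loop (exec p) r xs (exec p ?\<tau>))"
      by (rule Cons.IH[OF _ _ I]) (use i Cons.prems exec_frame in auto)
    then show ?case by simp
  qed simp
  from this[of 0 "\<sigma> r" \<sigma>] assms(1) have "I (length (\<sigma> r)) (loop (exec p) r (\<sigma> r) \<sigma>)" by simp
  then show ?thesis using indep by simp
qed

section \<open>Copying, moving and dropping parts of registers\<close>

definition copy_top :: "nat \<Rightarrow> nat \<Rightarrow> cmd" where
  "copy_top s t = IfTrue s (Push t True) (Push t False)"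

lemma copy_top_simps [simp]:
  "exec (copy_top s t) \<sigma> = \<sigma>(t := (\<sigma> s \<noteq> [] \<and> hd (\<sigma> s)) # \<sigma> t)"
  "writes (copy_top s t) = {t}" "loops (copy_top s t) = {}" "ok (copy_top s t)"
  by (auto simp: copy_top_def top_symbol_eq_2)

definition copy_rev :: "nat \<Rightarrow> nat \<Rightarrow> cmd" where
  "copy_rev s t = Loop s (copy_top s t)"

lemma exec_copy_rev:
  assumes "s \<noteq> t"
  shows "exec (copy_rev s t) \<sigma> = \<sigma>(t := rev (\<sigma> s) @ \<sigma> t)"
proof -
  have "(loop (exec (copy_top s t)) s xs \<sigma>)(s := w) = \<sigma>(t := rev xs @ \<sigma> t, s := w)" for xs w
    by (induction xs arbitrary: \<sigma>) (use assms in auto)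
  then show ?thesis unfolding copy_rev_def by (rule exec_Loop_eqI) (use assms in auto)
qed

lemma copy_rev_simps [simp]:
  "writes (copy_rev s t) = {t}" "loops (copy_rev s t) = {s}" "ok (copy_rev s t) \<longleftrightarrow> s \<noteq> t"
  by (auto simp: copy_rev_def)

definition shift :: "nat \<Rightarrow> nat \<Rightarrow> nat \<Rightarrow> cmd" where
  "shift r s t = Loop r (copy_top s t ;; Pop s)"

lemma shift_simps [simp]:
  "writes (shift r s t) = {s, t}" "loops (shift r s t) = {r}" "ok (shift r s t) \<longleftrightarrow> r \<noteq> s \<and> r \<noteq> t"
  by (auto simp: shift_def)

lemma exec_shift:
  assumes "r \<noteq> s" "r \<noteq> t" "s \<noteq> t" "length (\<sigma> r) \<le> length (\<sigma> s)"
  shows "exec (shift r s t) \<sigma> =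
    \<sigma>(t := rev (take (length (\<sigma> r)) (\<sigma> s)) @ \<sigma> t, s := drop (length (\<sigma> r)) (\<sigma> s))"
proof -
  have "(loop (exec (copy_top s t ;; Pop s)) r xs \<sigma>)(r := w) =
      \<sigma>(t := rev (take (length xs) (\<sigma> s)) @ \<sigma> t, s := drop (length xs) (\<sigma> s), r := w)"
    if "length xs \<le> length (\<sigma> s)" for xs w
    using that
  proof (induction xs arbitrary: \<sigma>)
    case (Cons x xs)
    then obtain y ys where "\<sigma> s = y # ys" by (cases "\<sigma> s") auto
    with Cons.prems show ?case
      by (intro loop_Cons_eqI[OF refl Cons.IH]) (use assms(1-3) in \<open>auto simp: fun_eq_iff\<close>)
  qed (use assms in \<open>auto simp: fun_eq_iff\<close>)
  from this[OF assms(4)] show ?thesis unfolding shift_def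
    by (rule exec_Loop_eqI) (use assms in auto)
qed

definition discard :: "nat \<Rightarrow> nat \<Rightarrow> cmd" where
  "discard r s = Loop r (Pop s)"

lemma discard_simps [simp]:
  "writes (discard r s) = {s}" "loops (discard r s) = {r}" "ok (discard r s) \<longleftrightarrow> r \<noteq> s"
  by (auto simp: discard_def)

lemma exec_discard:
  assumes "r \<noteq> s"
  shows "exec (discard r s) \<sigma> = \<sigma>(s := drop (length (\<sigma> r)) (\<sigma> s))"
proof -
  have "(loop (exec (Pop s)) r xs \<sigma>)(r := w) = \<sigma>(s := drop (length xs) (\<sigma> s), r := w)" for xs w
    by (induction xs arbitrary: \<sigma>) (use assms in \<open>auto simp: fun_upd_twist drop_Suc\<close>)
  then show ?thesis unfolding discard_def by (rule exec_Loop_eqI) (use assms in auto)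
qed

subsection \<open>Binary counters\<close>

text \<open>Propagates a carry of bit \<open>b\<close> through the counter \<open>c\<close>, so that \<open>b = True\<close> increments and
  \<open>b = False\<close> decrements. Register 7 records whether the carry was absorbed; if it runs off the end,
  the counter is extended (\<open>e\<close>) or left unchanged (\<open>\<not> e\<close>). Register 0 only supplies enough
  iterations.\<close>

definition scan_body :: "bool \<Rightarrow> bool \<Rightarrow> nat \<Rightarrow> cmd" where
  "scan_body b e c = IfEmpty 7 (Cond c (bit_symbol b) (Pop c ;; Push 16 b)
     (IfEmpty c (if e then Push c b ;; Push 7 True else Push 7 False)
       (Pop c ;; Push c b ;; Push 7 True))) Skip"

definition restore_body :: "bool \<Rightarrow> nat \<Rightarrow> cmd" where
  "restore_body b c = IfEmpty 16 Skip (Pop 16 ;; IfTrue 7 (Push c (\<not> b)) (Push c b))"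

definition count :: "bool \<Rightarrow> bool \<Rightarrow> nat \<Rightarrow> cmd" where
  "count b e c = Loop 0 (scan_body b e c) ;; Loop 0 (restore_body b c)"

lemma count_simps [simp]:
  "writes (count b e c) = {7, 16, c}" "loops (count b e c) = {0}" "ok (count b e c) \<longleftrightarrow> c \<noteq> 0"
  by (auto simp: count_def scan_body_def restore_body_def)

context
  fixes c :: nat
  assumes c: "c \<noteq> 0" "c \<noteq> 7" "c \<noteq> 16"
begin

lemma loop_scan_done:
  "\<sigma> 7 \<noteq> [] \<Longrightarrow> (loop (exec (scan_body b e c)) 0 xs \<sigma>)(0 := w) = \<sigma>(0 := w)"
  by (induction xs arbitrary: \<sigma>) (auto simp: scan_body_def)

lemma loop_scan_absorb:
  assumes "\<sigma> 7 = []" "\<sigma> c = replicate j b @ (\<not> b) # r" "j < length xs"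
  shows "(loop (exec (scan_body b e c)) 0 xs \<sigma>)(0 := w) =
    \<sigma>(16 := replicate j b @ \<sigma> 16, c := b # r, 7 := [True], 0 := w)"
  using assms
proof (induction j arbitrary: \<sigma> xs)
  case 0
  then obtain x ys where xs: "xs = x # ys" by (cases xs) auto
  have st: "exec (scan_body b e c) (\<sigma>(0 := xs)) = \<sigma>(0 := xs, c := b # r, 7 := [True])"
    using 0 c by (auto simp: scan_body_def fun_eq_iff)
  show ?case unfolding xs
    by (rule loop_Cons_eqI, rule st[unfolded xs], rule loop_scan_done) (use c in \<open>auto simp: fun_eq_iff\<close>)
next
  case (Suc j)
  then obtain x ys where xs: "xs = x # ys" by (cases xs) auto
  let ?\<sigma> = "\<sigma>(0 := xs, c := replicate j b @ (\<not> b) # r, 16 := b # \<sigma> 16)"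
  have st: "exec (scan_body b e c) (\<sigma>(0 := xs)) = ?\<sigma>"
    using Suc.prems c by (auto simp: scan_body_def fun_eq_iff)
  show ?case unfolding xs
    by (rule loop_Cons_eqI, rule st[unfolded xs], rule Suc.IH)
      (use Suc.prems c in \<open>auto simp: xs fun_eq_iff replicate_app_Cons_same\<close>)
qed

lemma loop_scan_overflow:
  assumes "\<sigma> 7 = []" "\<sigma> c = replicate j b" "j < length xs"
  shows "(loop (exec (scan_body b e c)) 0 xs \<sigma>)(0 := w) =
    \<sigma>(16 := replicate j b @ \<sigma> 16, c := (if e then [b] else []), 7 := [e], 0 := w)"
  using assms
proof (induction j arbitrary: \<sigma> xs)
  case 0
  then obtain x ys where xs: "xs = x # ys" by (cases xs) auto
  let ?\<sigma> = "\<sigma>(0 := xs, c := (if e then [b] else []), 7 := [e])"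
  have st: "exec (scan_body b e c) (\<sigma>(0 := xs)) = ?\<sigma>"
    using 0 c bit_symbol_simps by (auto simp: scan_body_def fun_eq_iff)
  show ?case unfolding xs
    by (rule loop_Cons_eqI, rule st[unfolded xs], rule loop_scan_done) (use 0 c in \<open>auto simp: fun_eq_iff\<close>)
next
  case (Suc j)
  then obtain x ys where xs: "xs = x # ys" by (cases xs) auto
  let ?\<sigma> = "\<sigma>(0 := xs, c := replicate j b, 16 := b # \<sigma> 16)"
  have st: "exec (scan_body b e c) (\<sigma>(0 := xs)) = ?\<sigma>"
    using Suc.prems c by (auto simp: scan_body_def fun_eq_iff)
  show ?case unfolding xs
    by (rule loop_Cons_eqI, rule st[unfolded xs], rule Suc.IH)
      (use Suc.prems c in \<open>auto simp: xs fun_eq_iff replicate_app_Cons_same\<close>)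
qed

text \<open>\<open>f\<close> tells whether the carry was absorbed. If so, the bits passed are
  flipped, as \<open>b \<noteq> True\<close> is \<open>\<not> b\<close>; otherwise they are put
  back, as \<open>b \<noteq> False\<close> is \<open>b\<close>.\<close>

lemma loop_restore:
  assumes "\<sigma> 7 = [f]" "\<sigma> 16 = replicate j b" "j \<le> length xs"
  shows "(loop (exec (restore_body b c)) 0 xs \<sigma>)(0 := w) =
    \<sigma>(16 := [], c := replicate j (b \<noteq> f) @ \<sigma> c, 0 := w)"
  using assms
proof (induction xs arbitrary: \<sigma> j)
  case Nil
  then show ?case using c by (auto simp: fun_eq_iff)
next
  case (Cons x xs)
  show ?case
  proof (cases j)
    case 0
    then have st: "exec (restore_body b c) (\<sigma>(0 := x # xs)) = \<sigma>(0 := x # xs)"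
      using Cons.prems by (auto simp: restore_body_def)
    show ?thesis
      by (rule loop_Cons_eqI, rule st, rule Cons.IH[where j = 0])
        (use Cons.prems 0 c in \<open>auto simp: fun_eq_iff\<close>)
  next
    case (Suc i)
    let ?\<sigma> = "\<sigma>(0 := x # xs, 16 := replicate i b, c := (b \<noteq> f) # \<sigma> c)"
    have st: "exec (restore_body b c) (\<sigma>(0 := x # xs)) = ?\<sigma>"
      using Cons.prems Suc c by (auto simp: restore_body_def fun_eq_iff)
    show ?thesis
      by (rule loop_Cons_eqI, rule st, rule Cons.IH[where j = i])
        (use Cons.prems Suc c in \<open>auto simp: fun_eq_iff replicate_app_Cons_same\<close>)
  qed
qed

lemma exec_count_absorb:
  assumes "\<sigma> 7 = []" "\<sigma> 16 = []" "\<sigma> c = replicate j b @ (\<not> b) # r" "j < length (\<sigma> 0)"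
  shows "exec (count b e c) \<sigma> = \<sigma>(c := replicate j (\<not> b) @ b # r, 7 := [True])"
proof -
  let ?\<sigma> = "\<sigma>(16 := replicate j b, c := b # r, 7 := [True])"
  have 1: "exec (Loop 0 (scan_body b e c)) \<sigma> = ?\<sigma>"
    using loop_scan_absorb[OF assms(1,3,4)] by (intro exec_Loop_eqI) (use assms(2) c in auto)
  have "exec (Loop 0 (restore_body b c)) ?\<sigma> =
      ?\<sigma>(16 := [], c := replicate j (b \<noteq> True) @ ?\<sigma> c)"
    by (rule exec_Loop_eqI, rule loop_restore) (use c assms in auto)
  then show ?thesis unfolding count_def exec.simps(4) 1
    using c assms(2) by (auto simp: fun_eq_iff simp del: exec.simps)
qed

lemma exec_count_overflow:
  assumes "\<sigma> 7 = []" "\<sigma> 16 = []" "\<sigma> c = replicate j b" "j < length (\<sigma> 0)"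
  shows "exec (count b e c) \<sigma> =
    (if e then \<sigma>(c := replicate j (\<not> b) @ [b], 7 := [True]) else \<sigma>(7 := [False]))"
proof -
  let ?\<sigma> = "\<sigma>(16 := replicate j b, c := (if e then [b] else []), 7 := [e])"
  have 1: "exec (Loop 0 (scan_body b e c)) \<sigma> = ?\<sigma>"
    using loop_scan_overflow[OF assms(1,3,4)] by (intro exec_Loop_eqI) (use assms(2) c in auto)
  have "exec (Loop 0 (restore_body b c)) ?\<sigma> =
      ?\<sigma>(16 := [], c := replicate j (b \<noteq> e) @ ?\<sigma> c)"
    by (rule exec_Loop_eqI, rule loop_restore) (use c assms in auto)
  then show ?thesis unfolding count_def exec.simps(4) 1
    using c assms(2,3) by (auto simp: fun_eq_iff simp del: exec.simps)
qed

end

primrec bits_value :: "bool list \<Rightarrow> nat" where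
  "bits_value [] = 0"
| "bits_value (b # bs) = of_bool b + 2 * bits_value bs"

text \<open>The two ways in which a carry of bit \<open>b\<close> can end: at the first opposite bit
  or beyond the last bit.\<close>

lemma replicate_prefix: "(\<exists>j r. bs = replicate j b @ (\<not> b) # r) \<or> (\<exists>j. bs = replicate j b)"
proof (induction bs)
  case Nil
  have "[] = replicate 0 b" by simp
  then show ?case by blast
next
  case (Cons a bs)
  show ?case
  proof (cases "a = b")
    case True
    have "a # bs = replicate (Suc j) b @ (\<not> b) # r" if "bs = replicate j b @ (\<not> b) # r" for j r
      using that True by simp
    moreover have "a # bs = replicate (Suc j) b" if "bs = replicate j b" for j
      using that True by simp
    ultimately show ?thesis using Cons by blast
  next
    case False
    then have "a # bs = replicate 0 b @ (\<not> b) # bs" by auto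
    then show ?thesis by blast
  qed
qed

lemma bits_value_replicate_False: "bits_value (replicate j False) = 0"
  by (induction j) auto

lemma bits_value_carry:
  "bits_value (replicate j False @ True # r) = Suc (bits_value (replicate j True @ False # r))"
  by (induction j) auto

lemma bits_value_overflow:
  "bits_value (replicate j False @ [True]) = Suc (bits_value (replicate j True))"
  by (induction j) auto

lemma bits_value_nat_bits: "bits_value (nat_bits n) = n"
proof (induction n rule: nat_bits.induct)
  case (1 n)
  then show ?case
    by (subst nat_bits.simps) (auto simp: odd_two_times_div_two_succ of_bool_def)
qed

lemma nat_bits_bits_value: "bs = [] \<or> last bs \<Longrightarrow> nat_bits (bits_value bs) = bs"
proof (induction bs)
  case Nil
  show ?case by (simp add: nat_bits.simps)
next
  case (Cons b bs)
  have "bits_value (b # bs) \<noteq> 0"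
  proof (cases "bs = []")
    case False
    then have "nat_bits (bits_value bs) = bs" using Cons by auto
    then have "bits_value bs \<noteq> 0" using False by (metis nat_bits.simps)
    then show ?thesis by simp
  qed (use Cons in simp)
  then show ?case using Cons by (subst nat_bits.simps) (auto split: if_splits)
qed

lemma last_nat_bits: "nat_bits n = [] \<or> last (nat_bits n)"
proof (induction n rule: nat_bits.induct)
  case (1 n)
  show ?case
  proof (cases "n = 0")
    case False
    show ?thesis
    proof (cases "n div 2 = 0")
      case True
      then have "n = 1" using False by linarith
      then show ?thesis by (simp add: nat_bits.simps)
    next
      case nz: False
      then have "nat_bits (n div 2) \<noteq> []" by (metis nat_bits.simps list.distinct(1))
      then show ?thesis using 1 False by (subst nat_bits.simps, subst (2) nat_bits.simps) auto
    qed
  qed (simp add: nat_bits.simps)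
qed

lemma length_nat_bits_le: "length (nat_bits n) \<le> n"
proof (induction n rule: nat_bits.induct)
  case (1 n)
  then show ?case by (subst nat_bits.simps) auto
qed

lemma nat_bits_eq_iff [simp]: "nat_bits m = nat_bits n \<longleftrightarrow> m = n"
  by (metis bits_value_nat_bits)

lemma exec_decrement:
  assumes "\<sigma> 7 = []" "\<sigma> 16 = []" "length (\<sigma> 12) < length (\<sigma> 0)"
  shows "\<exists>bs. exec (count False False 12) \<sigma> = \<sigma>(12 := bs, 7 := [bits_value (\<sigma> 12) > 0]) \<and>
    bits_value bs = bits_value (\<sigma> 12) - 1 \<and> length bs = length (\<sigma> 12)"
  using replicate_prefix[of "\<sigma> 12" False]
proof (elim disjE exE)
  fix j r assume j: "\<sigma> 12 = replicate j False @ (\<not> False) # r"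
  from exec_count_absorb[of 12 \<sigma>, OF _ _ _ assms(1,2) j] assms(3) j
  show ?thesis
    by (intro exI[of _ "replicate j True @ False # r"]) (simp add: bits_value_carry)
next
  fix j assume j: "\<sigma> 12 = replicate j False"
  from exec_count_overflow[of 12 \<sigma>, OF _ _ _ assms(1,2) j] assms(3) j
  show ?thesis
    by (intro exI[of _ "\<sigma> 12"]) (simp add: bits_value_replicate_False fun_upd_idem)
qed

text \<open>Here the bits themselves matter, since register 29 becomes part of the output. The
  canonical form survives because the last bit of the result is \<open>True\<close>.\<close>

lemma exec_increment:
  assumes "\<sigma> 7 = []" "\<sigma> 16 = []" "\<sigma> 29 = nat_bits v" "length (nat_bits v) < length (\<sigma> 0)"
  shows "exec (count True True 29) \<sigma> = \<sigma>(29 := nat_bits (Suc v), 7 := [True])"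
  using replicate_prefix[of "nat_bits v" True]
proof (elim disjE exE)
  fix j r assume j: "nat_bits v = replicate j True @ (\<not> True) # r"
  have "bits_value (replicate j False @ True # r) = Suc v"
    using bits_value_carry[of j r] bits_value_nat_bits[of v] j by simp
  moreover have "last (replicate j False @ True # r)" using last_nat_bits[of v] j by auto
  ultimately have "nat_bits (Suc v) = replicate j False @ True # r"
    using nat_bits_bits_value by metis
  with exec_count_absorb[of 29 \<sigma>, OF _ _ _ assms(1,2)] assms(3,4) j
  show ?thesis by simp
next
  fix j assume j: "nat_bits v = replicate j True"
  have "bits_value (replicate j False @ [True]) = Suc v"
    using bits_value_overflow[of j] bits_value_nat_bits[of v] j by simp
  then have "nat_bits (Suc v) = replicate j False @ [True]"
    using nat_bits_bits_value by (metis last_snoc)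
  with exec_count_overflow[of 29 \<sigma>, OF _ _ _ assms(1,2)] assms(3,4) j
  show ?thesis by simp
qed

subsection \<open>Parsing instances\<close>

text \<open>The size \<open>n\<close> is stored three times in unary, since nested loops must not
  run over the same register: 8, 9 and 10 drive the loops of depth one, two and three. Register 7 is
  set at the end of the unary prefix.\<close>

definition parse_body :: cmd where
  "parse_body = IfEmpty 7 (IfTrue 6 (Push 8 True ;; Push 9 True ;; Push 10 True) (Push 7 True))
     (copy_top 6 11)"

text \<open>The instance is expected in reverse in register 2, because both the verifier and the
  reduction obtain it there by pushing it bit by bit.\<close>

definition parse :: cmd where
  "parse = copy_rev 2 6 ;; Loop 6 parse_body ;; Pop 7 ;; copy_rev 11 12"

lemma parse_simps [simp]:
  "writes parse = {6, 7, 8, 9, 10, 11, 12}" "loops parse = {2, 6, 11}" "ok parse"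
  by (auto simp: parse_def parse_body_def)

lemma loop_parse_rest:
  assumes "\<sigma> 7 = [True]"
  shows "(loop (exec parse_body) 6 xs \<sigma>)(6 := w) = \<sigma>(11 := rev xs @ \<sigma> 11, 6 := w)"
  using assms
proof (induction xs arbitrary: \<sigma>)
  case (Cons x xs)
  have st: "exec parse_body (\<sigma>(6 := x # xs)) = \<sigma>(6 := x # xs, 11 := x # \<sigma> 11)"
    using Cons.prems by (simp add: parse_body_def)
  show ?case
    by (rule loop_Cons_eqI, rule st, rule Cons.IH) (use Cons.prems in \<open>auto simp: fun_eq_iff\<close>)
qed simp

lemma loop_parse:
  assumes "\<sigma> 7 = []"
  shows "(loop (exec parse_body) 6 (replicate n True @ False # ys) \<sigma>)(6 := w) =
    \<sigma>(7 := [True], 8 := replicate n True @ \<sigma> 8, 9 := replicate n True @ \<sigma> 9,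
      10 := replicate n True @ \<sigma> 10, 11 := rev ys @ \<sigma> 11, 6 := w)"
  using assms
proof (induction n arbitrary: \<sigma>)
  case 0
  have st: "exec parse_body (\<sigma>(6 := False # ys)) = \<sigma>(6 := False # ys, 7 := [True])"
    using 0 by (simp add: parse_body_def)
  show ?case unfolding replicate_0 append_Nil
    by (rule loop_Cons_eqI, rule st, rule loop_parse_rest) (use 0 in \<open>auto simp: fun_eq_iff\<close>)
next
  case (Suc n)
  let ?ys = "replicate n True @ False # ys"
  have st: "exec parse_body (\<sigma>(6 := True # ?ys)) =
      \<sigma>(6 := True # ?ys, 8 := True # \<sigma> 8, 9 := True # \<sigma> 9, 10 := True # \<sigma> 10)"
    using Suc.prems by (simp add: parse_body_def)
  show ?case unfolding replicate_Suc append_Cons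
    by (rule loop_Cons_eqI, rule st, rule Suc.IH)
      (use Suc.prems in \<open>auto simp: fun_eq_iff replicate_app_Cons_same\<close>)
qed

lemma exec_parse:
  assumes "\<sigma> 2 = rev (replicate n True @ False # ys)"
    and "\<sigma> 6 = []" "\<sigma> 7 = []" "\<sigma> 8 = []" "\<sigma> 9 = []" "\<sigma> 10 = []" "\<sigma> 11 = []" "\<sigma> 12 = []"
  shows "exec parse \<sigma> = \<sigma>(6 := replicate n True @ False # ys, 8 := replicate n True,
    9 := replicate n True, 10 := replicate n True, 11 := rev ys, 12 := ys)"
proof -
  let ?x = "replicate n True @ False # ys"
  let ?\<sigma> = "\<sigma>(6 := ?x)"
  have 1: "exec (copy_rev 2 6) \<sigma> = ?\<sigma>"
    using assms by (simp add: exec_copy_rev)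
  have 2: "exec (Loop 6 parse_body) ?\<sigma> = ?\<sigma>(7 := [True], 8 := replicate n True,
      9 := replicate n True, 10 := replicate n True, 11 := rev ys)"
    using loop_parse[of ?\<sigma> n ys] assms by (intro exec_Loop_eqI) auto
  show ?thesis unfolding parse_def exec.simps(4) 1 2
    using assms by (auto simp: exec_copy_rev fun_eq_iff)
qed

definition read_matrix :: cmd where
  "read_matrix = Loop 8 (shift 9 12 13)"

lemma read_matrix_simps [simp]:
  "writes read_matrix = {12, 13}" "loops read_matrix = {8, 9}" "ok read_matrix"
  by (auto simp: read_matrix_def)

lemma exec_read_matrix:
  assumes "length (\<sigma> 8) * length (\<sigma> 9) \<le> length (\<sigma> 12)"
  shows "exec read_matrix \<sigma> = \<sigma>(13 := rev (take (length (\<sigma> 8) * length (\<sigma> 9)) (\<sigma> 12)) @ \<sigma> 13,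
    12 := drop (length (\<sigma> 8) * length (\<sigma> 9)) (\<sigma> 12))"
proof -
  have "(loop (exec (shift 9 12 13)) 8 xs \<sigma>)(8 := w) =
      \<sigma>(13 := rev (take (length xs * length (\<sigma> 9)) (\<sigma> 12)) @ \<sigma> 13,
        12 := drop (length xs * length (\<sigma> 9)) (\<sigma> 12), 8 := w)"
    if "length xs * length (\<sigma> 9) \<le> length (\<sigma> 12)" for xs w
    using that
  proof (induction xs arbitrary: \<sigma>)
    case (Cons x xs)
    let ?n = "length (\<sigma> 9)"
    have st: "exec (shift 9 12 13) (\<sigma>(8 := x # xs)) = \<sigma>(8 := x # xs,
        13 := rev (take ?n (\<sigma> 12)) @ \<sigma> 13, 12 := drop ?n (\<sigma> 12))"
      using Cons.prems by (subst exec_shift) auto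
    show ?case
      by (rule loop_Cons_eqI, rule st, rule Cons.IH)
        (use Cons.prems in \<open>auto simp: fun_eq_iff take_add add.commute\<close>)
  qed (auto simp: fun_eq_iff)
  from this[OF assms] show ?thesis unfolding read_matrix_def by (rule exec_Loop_eqI) auto
qed

text \<open>Register 3 keeps the first bit of a pair until the second arrives, and register 4 is set
  once the separator has been passed. As data bits are doubled, a second bit \<open>True\<close>
  after a first bit \<open>False\<close> identifies the separator.\<close>

definition decode_body :: cmd where
  "decode_body = IfEmpty 4
     (IfEmpty 3 (copy_top 0 3)
       (IfTrue 0 (IfTrue 3 (Push 2 True) (Push 4 True)) (Push 2 False) ;; Pop 3))
     (copy_top 0 5)"

lemma loop_decode_certificate:
  assumes "\<sigma> 4 = [True]"
  shows "(loop (exec decode_body) 0 xs \<sigma>)(0 := w) = \<sigma>(5 := rev xs @ \<sigma> 5, 0 := w)"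
  using assms
proof (induction xs arbitrary: \<sigma>)
  case (Cons x xs)
  have st: "exec decode_body (\<sigma>(0 := x # xs)) = \<sigma>(0 := x # xs, 5 := x # \<sigma> 5)"
    using Cons.prems by (simp add: decode_body_def)
  show ?case
    by (rule loop_Cons_eqI, rule st, rule Cons.IH) (use Cons.prems in \<open>auto simp: fun_eq_iff\<close>)
qed simp

lemma loop_decode:
  assumes "\<sigma> 3 = []" "\<sigma> 4 = []"
  shows "(loop (exec decode_body) 0 (pair_string x u) \<sigma>)(0 := w) =
    \<sigma>(2 := rev x @ \<sigma> 2, 4 := [True], 5 := rev u @ \<sigma> 5, 0 := w)"
  using assms
proof (induction x arbitrary: \<sigma>)
  case Nil
  have p: "pair_string [] u = False # True # u" by (simp add: pair_string_def)
  let ?\<sigma> = "\<sigma>(0 := False # True # u, 3 := [False])"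
  have st: "exec decode_body (\<sigma>(0 := False # True # u)) = ?\<sigma>"
    using Nil by (simp add: decode_body_def)
  have st2: "exec decode_body (?\<sigma>(0 := True # u)) = \<sigma>(0 := True # u, 4 := [True])"
    using Nil by (auto simp: decode_body_def fun_eq_iff)
  have lp: "(loop (exec decode_body) 0 (True # u) ?\<sigma>)(0 := w) =
      \<sigma>(4 := [True], 5 := rev u @ \<sigma> 5, 0 := w)"
    by (rule loop_Cons_eqI, rule st2, rule loop_decode_certificate) (auto simp: fun_eq_iff)
  show ?case unfolding p
    by (rule loop_Cons_eqI, rule st, rule lp) (auto simp: fun_eq_iff)
next
  case (Cons b x)
  have p: "pair_string (b # x) u = b # b # pair_string x u" by (simp add: pair_string_def)
  let ?p = "pair_string x u"
  let ?\<sigma> = "\<sigma>(0 := b # b # ?p, 3 := [b])"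
  have st: "exec decode_body (\<sigma>(0 := b # b # ?p)) = ?\<sigma>"
    using Cons.prems by (simp add: decode_body_def)
  have st2: "exec decode_body (?\<sigma>(0 := b # ?p)) = \<sigma>(0 := b # ?p, 2 := b # \<sigma> 2)"
    using Cons.prems by (auto simp: decode_body_def fun_eq_iff)
  have lp: "(loop (exec decode_body) 0 (b # ?p) ?\<sigma>)(0 := w) =
      \<sigma>(2 := rev (b # x) @ \<sigma> 2, 4 := [True], 5 := rev u @ \<sigma> 5, 0 := w)"
    by (rule loop_Cons_eqI, rule st2, rule Cons.IH) (use Cons.prems in \<open>auto simp: fun_eq_iff\<close>)
  show ?case unfolding p
    by (rule loop_Cons_eqI, rule st, rule lp) (auto simp: fun_eq_iff)
qed

lemma exec_decode:
  assumes "\<sigma> 0 = pair_string x u" "\<sigma> 2 = []" "\<sigma> 3 = []" "\<sigma> 4 = []" "\<sigma> 5 = []"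
  shows "exec (Loop 0 decode_body) \<sigma> = \<sigma>(2 := rev x, 4 := [True], 5 := rev u)"
  using loop_decode[of \<sigma> x u] assms by (intro exec_Loop_eqI) auto

subsection \<open>The verifier\<close>

text \<open>Positions beyond the end count as false, just as an exhausted register does not show the
  symbol of \<open>True\<close>. Thus a certificate of any length describes a set of
  vertices.\<close>

definition nth_true :: "bool list \<Rightarrow> nat \<Rightarrow> bool" where
  "nth_true xs i \<longleftrightarrow> i < length xs \<and> xs ! i"

lemma top_symbol_drop: "top_symbol (drop i xs) = 2 \<longleftrightarrow> nth_true xs i"
  by (auto simp: top_symbol_eq_2 nth_true_def hd_drop_conv_nth)

definition select_body :: cmd where
  "select_body = IfTrue 14 (Push 15 True ;; count False False 12 ;; Pop 7) (Push 15 False) ;; Pop 14"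

text \<open>Each chosen vertex subtracts one from the threshold in register 12, so the truncated
  difference is 0 exactly if enough vertices are chosen. Register 15 receives the certificate cut or
  padded to length \<open>n\<close>.\<close>

lemma exec_select:
  assumes "length (\<sigma> 12) < length (\<sigma> 0)" "\<sigma> 7 = []" "\<sigma> 15 = []" "\<sigma> 16 = []" "length (\<sigma> 8) = n"
  defines "\<tau> \<equiv> exec (Loop 8 select_body) \<sigma>"
  shows "\<tau> 15 = rev (map (nth_true (\<sigma> 14)) [0..<n])"
    and "bits_value (\<tau> 12) = bits_value (\<sigma> 12) - card {j. j < n \<and> nth_true (\<sigma> 14) j}"
    and "\<tau> 7 = []" "\<tau> 16 = []"
proof -
  define I where "I = (\<lambda>i (\<tau> :: store). \<tau> 14 = drop i (\<sigma> 14) \<and>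
    \<tau> 15 = rev (map (nth_true (\<sigma> 14)) [0..<i]) \<and>
    bits_value (\<tau> 12) = bits_value (\<sigma> 12) - card {j. j < i \<and> nth_true (\<sigma> 14) j} \<and>
    length (\<tau> 12) = length (\<sigma> 12) \<and> \<tau> 7 = [] \<and> \<tau> 16 = [])"
  have "I (length (\<sigma> 8)) (exec (Loop 8 select_body) \<sigma>)"
  proof (rule exec_Loop_invariant)
    fix i \<tau> assume I: "I i \<tau>"
      and fr: "\<And>s. s \<notin> writes select_body \<Longrightarrow> s \<noteq> 8 \<Longrightarrow> \<tau> s = \<sigma> s"
    have \<tau>0: "\<tau> 0 = \<sigma> 0" by (rule fr) (simp_all add: select_body_def)
    show "I (Suc i) (exec select_body \<tau>)"
    proof (cases "nth_true (\<sigma> 14) i")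
      case True
      let ?\<tau> = "\<tau>(15 := True # \<tau> 15)"
      obtain bs where bs: "exec (count False False 12) ?\<tau> = ?\<tau>(12 := bs, 7 := [bits_value (?\<tau> 12) > 0])"
        "bits_value bs = bits_value (?\<tau> 12) - 1" "length bs = length (?\<tau> 12)"
        using exec_decrement[of ?\<tau>] I \<tau>0 assms(1) by (auto simp: I_def)
      have "{j. j < Suc i \<and> nth_true (\<sigma> 14) j} = insert i {j. j < i \<and> nth_true (\<sigma> 14) j}"
        using True by (auto simp: less_Suc_eq)
      then have "card {j. j < Suc i \<and> nth_true (\<sigma> 14) j} = Suc (card {j. j < i \<and> nth_true (\<sigma> 14) j})"
        by simp
      moreover have "exec select_body \<tau> = ?\<tau>(12 := bs, 7 := [], 14 := drop (Suc i) (\<sigma> 14))"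
        using I True bs(1) by (simp add: select_body_def I_def top_symbol_drop drop_Suc tl_drop)
      ultimately show ?thesis using I bs(2,3) True by (simp add: I_def)
    next
      case False
      then have "{j. j < Suc i \<and> nth_true (\<sigma> 14) j} = {j. j < i \<and> nth_true (\<sigma> 14) j}"
        by (auto simp: less_Suc_eq)
      moreover have "exec select_body \<tau> = \<tau>(15 := False # \<tau> 15, 14 := drop (Suc i) (\<sigma> 14))"
        using I False by (simp add: select_body_def I_def top_symbol_drop drop_Suc tl_drop)
      ultimately show ?thesis using I False by (simp add: I_def)
    qed
  qed (use assms in \<open>auto simp: I_def\<close>)
  then show "\<tau> 15 = rev (map (nth_true (\<sigma> 14)) [0..<n])"
    "bits_value (\<tau> 12) = bits_value (\<sigma> 12) - card {j. j < n \<and> nth_true (\<sigma> 14) j}"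
    "\<tau> 7 = []" "\<tau> 16 = []"
    by (simp_all add: I_def \<tau>_def assms(5) del: exec.simps)
qed

text \<open>The triple loop checks transitivity of the chosen subtournament, reading row \<open>a\<close> in register
  17, the entry \<open>(a, b)\<close> in 18, row \<open>b\<close> in 20, and membership of \<open>a\<close>, \<open>b\<close>, \<open>c\<close> in 19, 21, 22.
  Violations are recorded in 23.\<close>

definition check_c :: cmd where
  "check_c = IfTrue 19 (IfTrue 21 (IfTrue 18 (IfTrue 22 (IfTrue 20 (IfTrue 17 Skip (Push 23 True))
     Skip) Skip) Skip) Skip) Skip ;; copy_top 17 16 ;; Pop 17 ;; Pop 20 ;; Pop 22"

definition check_b :: cmd where
  "check_b = copy_rev 15 22 ;; Loop 10 check_c ;; shift 10 16 17 ;; Pop 21 ;; Pop 18"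

definition check_a :: cmd where
  "check_a = copy_rev 13 20 ;; copy_rev 15 21 ;; Loop 9 check_b ;; discard 10 17 ;; Pop 19"

lemma check_simps [simp]:
  "writes check_c = {16, 17, 20, 22, 23}" "loops check_c = {}" "ok check_c"
  "writes check_b = {16, 17, 18, 20, 21, 22, 23}" "loops check_b = {10, 15}" "ok check_b"
  "writes check_a = {16, 17, 18, 19, 20, 21, 22, 23}" "loops check_a = {9, 10, 13, 15}" "ok check_a"
  by (auto simp: check_c_def check_b_def check_a_def)

text \<open>The loop consumes row \<open>a\<close> from register 17, which is needed again for the
  next \<open>b\<close>; register 16 keeps it so that \<open>shift\<close> can put it back. Row
  \<open>b\<close> in 20 and the membership bits in 22 are simply used up.\<close>

lemma exec_check_c:
  assumes n: "length (\<sigma> 10) = n" "n \<le> length (\<sigma> 17)" and "\<sigma> 16 = []"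
  defines "\<tau> \<equiv> exec (Loop 10 check_c) \<sigma>"
  shows "\<tau> 16 = rev (take n (\<sigma> 17))" "\<tau> 17 = drop n (\<sigma> 17)" "\<tau> 20 = drop n (\<sigma> 20)"
    "\<tau> 22 = drop n (\<sigma> 22)"
    and "\<tau> 23 = [] \<longleftrightarrow> \<sigma> 23 = [] \<and> \<not> (top_symbol (\<sigma> 19) = 2 \<and> top_symbol (\<sigma> 21) = 2 \<and>
      top_symbol (\<sigma> 18) = 2 \<and>
      (\<exists>c<n. nth_true (\<sigma> 22) c \<and> nth_true (\<sigma> 20) c \<and> \<not> nth_true (\<sigma> 17) c))"
proof -
  define P where "P = (\<lambda>i. top_symbol (\<sigma> 19) = 2 \<and> top_symbol (\<sigma> 21) = 2 \<and> top_symbol (\<sigma> 18) = 2 \<and>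
      (\<exists>c<i. nth_true (\<sigma> 22) c \<and> nth_true (\<sigma> 20) c \<and> \<not> nth_true (\<sigma> 17) c))"
  define I where "I = (\<lambda>i (\<tau> :: store). \<tau> 16 = rev (take i (\<sigma> 17)) \<and> \<tau> 17 = drop i (\<sigma> 17) \<and>
    \<tau> 20 = drop i (\<sigma> 20) \<and> \<tau> 22 = drop i (\<sigma> 22) \<and> (\<tau> 23 = [] \<longleftrightarrow> \<sigma> 23 = [] \<and> \<not> P i))"
  have "I (length (\<sigma> 10)) (exec (Loop 10 check_c) \<sigma>)"
  proof (rule exec_Loop_invariant)
    fix i \<tau> assume I: "I i \<tau>" and i: "i < length (\<sigma> 10)"
      and fr: "\<And>s. s \<notin> writes check_c \<Longrightarrow> s \<noteq> 10 \<Longrightarrow> \<tau> s = \<sigma> s"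
    have fr': "\<tau> 19 = \<sigma> 19" "\<tau> 21 = \<sigma> 21" "\<tau> 18 = \<sigma> 18" by (auto intro!: fr)
    have i': "i < length (\<sigma> 17)" using i n by simp
    have P: "P (Suc i) \<longleftrightarrow> P i \<or> top_symbol (\<sigma> 19) = 2 \<and> top_symbol (\<sigma> 21) = 2 \<and>
        top_symbol (\<sigma> 18) = 2 \<and> nth_true (\<sigma> 22) i \<and> nth_true (\<sigma> 20) i \<and> \<not> nth_true (\<sigma> 17) i"
      by (auto simp: P_def less_Suc_eq)
    show "I (Suc i) (exec check_c \<tau>)"
      using I i' P by (auto simp: I_def check_c_def fr' top_symbol_drop drop_Suc tl_drop
          take_Suc_conv_app_nth hd_drop_conv_nth)
  qed (use assms in \<open>auto simp: I_def P_def\<close>)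
  then show "\<tau> 16 = rev (take n (\<sigma> 17))" "\<tau> 17 = drop n (\<sigma> 17)" "\<tau> 20 = drop n (\<sigma> 20)"
    "\<tau> 22 = drop n (\<sigma> 22)"
    "\<tau> 23 = [] \<longleftrightarrow> \<sigma> 23 = [] \<and> \<not> (top_symbol (\<sigma> 19) = 2 \<and> top_symbol (\<sigma> 21) = 2 \<and>
      top_symbol (\<sigma> 18) = 2 \<and>
      (\<exists>c<n. nth_true (\<sigma> 22) c \<and> nth_true (\<sigma> 20) c \<and> \<not> nth_true (\<sigma> 17) c))"
    by (simp_all add: I_def \<tau>_def n P_def del: exec.simps)
qed


text \<open>Register 20 is meant to hold the whole matrix. Every pass takes one row off it, so that
  pass \<open>b\<close> finds row \<open>b\<close> on top.\<close>

lemma exec_check_b: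
  assumes n: "length (\<sigma> 9) = n" "length (\<sigma> 10) = n" "n \<le> length (\<sigma> 17)" "length (\<sigma> 15) = n"
    and e: "\<sigma> 16 = []" "\<sigma> 22 = []"
  defines "\<tau> \<equiv> exec (Loop 9 check_b) \<sigma>"
  shows "\<tau> 16 = []" "\<tau> 17 = \<sigma> 17" "\<tau> 18 = drop n (\<sigma> 18)" "\<tau> 20 = drop (n * n) (\<sigma> 20)"
    "\<tau> 21 = drop n (\<sigma> 21)" "\<tau> 22 = []"
    and "\<tau> 23 = [] \<longleftrightarrow> \<sigma> 23 = [] \<and> \<not> (top_symbol (\<sigma> 19) = 2 \<and>
      (\<exists>b<n. nth_true (\<sigma> 21) b \<and> nth_true (\<sigma> 18) b \<and> (\<exists>c<n. nth_true (rev (\<sigma> 15)) c \<and>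
        nth_true (drop (b * n) (\<sigma> 20)) c \<and> \<not> nth_true (\<sigma> 17) c)))"
proof -
  define Q where "Q = (\<lambda>b. top_symbol (\<sigma> 19) = 2 \<and> nth_true (\<sigma> 21) b \<and> nth_true (\<sigma> 18) b \<and>
    (\<exists>c<n. nth_true (rev (\<sigma> 15)) c \<and> nth_true (drop (b * n) (\<sigma> 20)) c \<and> \<not> nth_true (\<sigma> 17) c))"
  define I where "I = (\<lambda>i (\<tau> :: store). \<tau> 16 = [] \<and> \<tau> 17 = \<sigma> 17 \<and> \<tau> 18 = drop i (\<sigma> 18) \<and>
    \<tau> 20 = drop (i * n) (\<sigma> 20) \<and> \<tau> 21 = drop i (\<sigma> 21) \<and> \<tau> 22 = [] \<and>
    (\<tau> 23 = [] \<longleftrightarrow> \<sigma> 23 = [] \<and> \<not> (\<exists>b<i. Q b)))"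
  have "I (length (\<sigma> 9)) (exec (Loop 9 check_b) \<sigma>)"
  proof (rule exec_Loop_invariant)
    fix i \<tau> assume I: "I i \<tau>" and i: "i < length (\<sigma> 9)"
      and fr: "\<And>s. s \<notin> writes check_b \<Longrightarrow> s \<noteq> 9 \<Longrightarrow> \<tau> s = \<sigma> s"
    have fr': "\<tau> 19 = \<sigma> 19" "\<tau> 15 = \<sigma> 15" "\<tau> 10 = \<sigma> 10" by (auto intro!: fr)
    define \<tau>1 where "\<tau>1 = \<tau>(22 := rev (\<sigma> 15))"
    define \<tau>2 where "\<tau>2 = exec (Loop 10 check_c) \<tau>1"
    have 1: "exec (copy_rev 15 22) \<tau> = \<tau>1" using I fr' by (simp add: exec_copy_rev \<tau>1_def I_def)
    have "length (\<tau>1 10) = n" "n \<le> length (\<tau>1 17)" "\<tau>1 16 = []"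
      using I fr' n by (auto simp: \<tau>1_def I_def)
    note c = exec_check_c[OF this, folded \<tau>2_def]
    have f2: "\<tau>2 s = \<tau>1 s" if "s \<notin> writes check_c" for s
      unfolding \<tau>2_def by (rule exec_frame) (use that in simp)
    have 3: "exec (shift 10 16 17) \<tau>2 = \<tau>2(17 := \<sigma> 17, 16 := [])"
      using c(1,2) f2[of 10] I fr' n by (subst exec_shift) (auto simp: \<tau>1_def I_def)
    have ex: "exec check_b \<tau> = \<tau>2(17 := \<sigma> 17, 16 := [], 21 := tl (\<tau>2 21), 18 := tl (\<tau>2 18))"
      unfolding check_b_def exec.simps(4) 1 \<tau>2_def[symmetric] 3 by simp
    have "\<tau>2 23 = [] \<longleftrightarrow> \<tau> 23 = [] \<and> \<not> Q i"
      using I c(5) by (simp add: \<tau>1_def I_def Q_def fr' top_symbol_drop)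
    moreover have "(\<exists>b<Suc i. Q b) \<longleftrightarrow> (\<exists>b<i. Q b) \<or> Q i" by (auto simp: less_Suc_eq)
    moreover have "\<tau>2 20 = drop (Suc i * n) (\<sigma> 20)" "\<tau>2 22 = []"
      using I c(3,4) n by (auto simp: \<tau>1_def I_def add.commute)
    moreover have "\<tau>2 18 = drop i (\<sigma> 18)" "\<tau>2 21 = drop i (\<sigma> 21)"
      using I f2[of 18] f2[of 21] by (auto simp: \<tau>1_def I_def)
    ultimately show "I (Suc i) (exec check_b \<tau>)"
      unfolding ex using I by (auto simp: I_def drop_Suc tl_drop)
  qed (use e in \<open>auto simp: I_def\<close>)
  then show "\<tau> 16 = []" "\<tau> 17 = \<sigma> 17" "\<tau> 18 = drop n (\<sigma> 18)" "\<tau> 20 = drop (n * n) (\<sigma> 20)"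
    "\<tau> 21 = drop n (\<sigma> 21)" "\<tau> 22 = []"
    "\<tau> 23 = [] \<longleftrightarrow> \<sigma> 23 = [] \<and> \<not> (top_symbol (\<sigma> 19) = 2 \<and>
      (\<exists>b<n. nth_true (\<sigma> 21) b \<and> nth_true (\<sigma> 18) b \<and> (\<exists>c<n. nth_true (rev (\<sigma> 15)) c \<and>
        nth_true (drop (b * n) (\<sigma> 20)) c \<and> \<not> nth_true (\<sigma> 17) c)))"
    unfolding \<tau>_def n by (auto simp: I_def Q_def simp del: exec.simps)
qed

lemma exec_check_a:
  assumes n: "length (\<sigma> 8) = n" "length (\<sigma> 9) = n" "length (\<sigma> 10) = n" "length (\<sigma> 15) = n"
    and m: "length (\<sigma> 13) = n * n" "\<sigma> 17 = rev (\<sigma> 13)" "\<sigma> 18 = rev (\<sigma> 13)" "\<sigma> 19 = rev (\<sigma> 15)"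
    and e: "\<sigma> 16 = []" "\<sigma> 20 = []" "\<sigma> 21 = []" "\<sigma> 22 = []" "\<sigma> 23 = []"
  defines "S \<equiv> nth_true (rev (\<sigma> 15))" and "M \<equiv> \<lambda>i j. nth_true (drop (i * n) (rev (\<sigma> 13))) j"
  shows "exec (Loop 8 check_a) \<sigma> 23 = [] \<longleftrightarrow>
    (\<forall>a<n. \<forall>b<n. \<forall>c<n. S a \<and> S b \<and> S c \<and> M a b \<and> M b c \<longrightarrow> M a c)"
proof -
  define Q where "Q = (\<lambda>a. \<exists>b<n. \<exists>c<n. S a \<and> S b \<and> M a b \<and> S c \<and> M b c \<and> \<not> M a c)"
  define I where "I = (\<lambda>i (\<tau> :: store). \<tau> 16 = [] \<and> \<tau> 17 = drop (i * n) (rev (\<sigma> 13)) \<and>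
    \<tau> 18 = drop (i * n) (rev (\<sigma> 13)) \<and> \<tau> 19 = drop i (rev (\<sigma> 15)) \<and>
    \<tau> 20 = [] \<and> \<tau> 21 = [] \<and> \<tau> 22 = [] \<and> (\<tau> 23 = [] \<longleftrightarrow> \<not> (\<exists>a<i. Q a)))"
  have "I (length (\<sigma> 8)) (exec (Loop 8 check_a) \<sigma>)"
  proof (rule exec_Loop_invariant)
    fix i \<tau> assume I: "I i \<tau>" and i: "i < length (\<sigma> 8)"
      and fr: "\<And>s. s \<notin> writes check_a \<Longrightarrow> s \<noteq> 8 \<Longrightarrow> \<tau> s = \<sigma> s"
    have fr': "\<tau> 13 = \<sigma> 13" "\<tau> 15 = \<sigma> 15" "\<tau> 10 = \<sigma> 10" "\<tau> 9 = \<sigma> 9" by (auto intro!: fr)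
    define \<tau>1 where "\<tau>1 = \<tau>(20 := rev (\<sigma> 13), 21 := rev (\<sigma> 15))"
    define \<tau>2 where "\<tau>2 = exec (Loop 9 check_b) \<tau>1"
    have 1: "exec (copy_rev 15 21) (exec (copy_rev 13 20) \<tau>) = \<tau>1"
      using I fr' by (simp add: exec_copy_rev \<tau>1_def I_def)
    have "Suc i * n \<le> n * n" using i n by (intro mult_le_mono1) simp
    then have "n \<le> length (\<tau>1 17)" using I m(1) by (auto simp: \<tau>1_def I_def)
    then have "length (\<tau>1 9) = n" "length (\<tau>1 10) = n" "n \<le> length (\<tau>1 17)" "length (\<tau>1 15) = n"
      "\<tau>1 16 = []" "\<tau>1 22 = []"
      using I fr' n by (auto simp: \<tau>1_def I_def)
    note b = exec_check_b[OF this, folded \<tau>2_def]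
    have f2: "\<tau>2 s = \<tau>1 s" if "s \<notin> writes check_b" for s
      unfolding \<tau>2_def by (rule exec_frame) (use that in simp)
    have 10: "length (\<tau>2 10) = n" using f2[of 10] fr' n by (simp add: \<tau>1_def)
    have ex: "exec check_a \<tau> = \<tau>2(17 := drop n (\<tau>2 17), 19 := tl (\<tau>2 19))"
      unfolding check_a_def exec.simps(4) 1 \<tau>2_def[symmetric] by (simp add: exec_discard 10)
    have "top_symbol (\<tau>1 19) = 2 \<longleftrightarrow> S i"
      using I by (simp add: \<tau>1_def I_def top_symbol_drop S_def)
    then have "\<tau>2 23 = [] \<longleftrightarrow> \<tau> 23 = [] \<and> \<not> Q i"
      using I b(7) by (auto simp: \<tau>1_def I_def Q_def fr' M_def S_def)
    moreover have "(\<exists>b<Suc i. Q b) \<longleftrightarrow> (\<exists>b<i. Q b) \<or> Q i" by (auto simp: less_Suc_eq)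
    moreover have "\<tau>2 19 = drop i (rev (\<sigma> 15))"
      using I f2[of 19] by (auto simp: \<tau>1_def I_def)
    moreover have "\<tau>2 17 = drop (i * n) (rev (\<sigma> 13))" "\<tau>2 18 = drop (Suc i * n) (rev (\<sigma> 13))"
      "\<tau>2 20 = []" "\<tau>2 21 = []" "\<tau>2 22 = []" "\<tau>2 16 = []"
      using I b(1-6) m(1) n by (auto simp: \<tau>1_def I_def add.commute)
    ultimately show "I (Suc i) (exec check_a \<tau>)"
      unfolding ex using I by (auto simp: I_def drop_Suc tl_drop add.commute)
  qed (use e m in \<open>auto simp: I_def\<close>)
  then have "exec (Loop 8 check_a) \<sigma> 23 = [] \<longleftrightarrow> \<not> (\<exists>a<n. Q a)"
    unfolding n by (auto simp: I_def simp del: exec.simps)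
  then show ?thesis by (auto simp: Q_def)
qed

section \<open>The threshold test and the whole verifier\<close>

definition test_zero :: cmd where
  "test_zero = Loop 12 (IfTrue 12 (Push 23 True) Skip)"

lemma bits_value_eq_0: "bits_value bs = 0 \<longleftrightarrow> True \<notin> set bs"
  by (induction bs) auto

lemma exec_test_zero: "exec test_zero \<sigma> 23 = [] \<longleftrightarrow> \<sigma> 23 = [] \<and> bits_value (\<sigma> 12) = 0"
proof -
  have "loop (exec (IfTrue 12 (Push 23 True) Skip)) 12 xs \<tau> 23 = [] \<longleftrightarrow> \<tau> 23 = [] \<and> True \<notin> set xs"
    for xs \<tau>
    by (induction xs arbitrary: \<tau>) auto
  then show ?thesis by (simp add: test_zero_def bits_value_eq_0)
qed

lemma test_zero_simps [simp]: "writes test_zero = {23}" "loops test_zero = {12}" "ok test_zero"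
  by (auto simp: test_zero_def)

lemma length_pair_string: "length (pair_string x u) = 2 * length x + 2 + length u"
  by (induction x) (auto simp: pair_string_def)

lemma index_less_square:
  fixes i j n :: nat
  assumes "i < n" "j < n"
  shows "i * n + j < n * n"
proof -
  have "i * n + j < Suc i * n" using assms by simp
  also have "\<dots> \<le> n * n" using assms by (intro mult_le_mono1) simp
  finally show ?thesis .
qed

definition verifier :: cmd where
  "verifier = Loop 0 decode_body ;; copy_rev 5 14 ;; parse ;; read_matrix ;; Loop 8 select_body ;;
     copy_rev 13 17 ;; copy_rev 13 18 ;; copy_rev 15 19 ;; Loop 8 check_a ;; test_zero ;;
     IfEmpty 23 (Push 1 True) Skip"

lemma ok_verifier: "ok verifier"
  by (auto simp: verifier_def decode_body_def select_body_def)

lemma exec_verifier: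
  fixes mat ks u :: "bool list"
  assumes mat: "length mat = n * n"
  defines "x \<equiv> replicate n True @ False # mat @ ks"
    and "S \<equiv> nth_true u" and "M \<equiv> \<lambda>i j. mat ! (i * n + j)"
  shows "exec verifier (init_store (pair_string x u)) 1 = [True] \<longleftrightarrow>
    bits_value ks \<le> card {i. i < n \<and> S i} \<and>
    (\<forall>a<n. \<forall>b<n. \<forall>c<n. S a \<and> S b \<and> S c \<and> M a b \<and> M b c \<longrightarrow> M a c)"
proof -
  define \<sigma> where "\<sigma> = init_store (pair_string x u)"
  define \<sigma>1 where "\<sigma>1 = \<sigma>(2 := rev x, 4 := [True], 5 := rev u, 14 := u, 6 := x,
    8 := replicate n True, 9 := replicate n True, 10 := replicate n True,
    11 := rev (mat @ ks), 13 := rev mat, 12 := ks)"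
  have 1: "exec read_matrix (exec parse (exec (copy_rev 5 14) (exec (Loop 0 decode_body) \<sigma>))) = \<sigma>1"
  proof -
    have a: "exec (Loop 0 decode_body) \<sigma> = \<sigma>(2 := rev x, 4 := [True], 5 := rev u)"
      by (rule exec_decode) (simp_all add: \<sigma>_def)
    have b: "exec (copy_rev 5 14) (\<sigma>(2 := rev x, 4 := [True], 5 := rev u)) =
        \<sigma>(2 := rev x, 4 := [True], 5 := rev u, 14 := u)"
      by (simp add: exec_copy_rev \<sigma>_def)
    have c: "exec parse (\<sigma>(2 := rev x, 4 := [True], 5 := rev u, 14 := u)) =
      \<sigma>(2 := rev x, 4 := [True], 5 := rev u, 14 := u, 6 := x, 8 := replicate n True,
        9 := replicate n True, 10 := replicate n True, 11 := rev (mat @ ks), 12 := mat @ ks)"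
      unfolding x_def by (rule exec_parse) (simp_all add: \<sigma>_def)
    show ?thesis unfolding a b c using mat by (simp add: exec_read_matrix \<sigma>1_def \<sigma>_def)
  qed
  define \<sigma>2 where "\<sigma>2 = exec (Loop 8 select_body) \<sigma>1"
  have "length (\<sigma>1 12) < length (\<sigma>1 0)"
    by (simp add: \<sigma>1_def \<sigma>_def x_def length_pair_string)
  moreover have "\<sigma>1 7 = []" "\<sigma>1 15 = []" "\<sigma>1 16 = []" "length (\<sigma>1 8) = n"
    by (simp_all add: \<sigma>1_def \<sigma>_def)
  ultimately have sel: "\<sigma>2 15 = rev (map S [0..<n])"
    "bits_value (\<sigma>2 12) = bits_value ks - card {j. j < n \<and> S j}" "\<sigma>2 16 = []"
    using exec_select[of \<sigma>1 n] by (simp_all add: \<sigma>2_def S_def \<sigma>1_def)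
  have f2: "\<sigma>2 s = \<sigma>1 s" if "s \<notin> {7, 12, 14, 15, 16}" for s
    unfolding \<sigma>2_def by (rule exec_frame) (use that in \<open>auto simp: select_body_def\<close>)
  have r2: "\<sigma>2 8 = replicate n True" "\<sigma>2 9 = replicate n True" "\<sigma>2 10 = replicate n True"
    "\<sigma>2 13 = rev mat" "\<sigma>2 17 = []" "\<sigma>2 18 = []" "\<sigma>2 19 = []" "\<sigma>2 20 = []" "\<sigma>2 21 = []" "\<sigma>2 22 = []"
    "\<sigma>2 23 = []" "\<sigma>2 1 = []"
    by (simp_all add: f2 \<sigma>1_def \<sigma>_def)
  define \<sigma>3 where "\<sigma>3 = \<sigma>2(17 := mat, 18 := mat, 19 := map S [0..<n])"
  have 3: "exec (copy_rev 15 19) (exec (copy_rev 13 18) (exec (copy_rev 13 17) \<sigma>2)) = \<sigma>3"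
    using r2 sel by (simp add: exec_copy_rev \<sigma>3_def)
  define \<sigma>4 where "\<sigma>4 = exec (Loop 8 check_a) \<sigma>3"
  have S: "nth_true (map S [0..<n]) i \<longleftrightarrow> i < n \<and> S i" for i by (auto simp: nth_true_def)
  have M: "nth_true (drop (i * n) mat) j \<longleftrightarrow> M i j" if "i < n" "j < n" for i j
  proof -
    have "i * n + j < length mat" using index_less_square[OF that] mat by simp
    then show ?thesis by (auto simp: nth_true_def M_def nth_drop)
  qed
  have "\<sigma>4 23 = [] \<longleftrightarrow> (\<forall>a<n. \<forall>b<n. \<forall>c<n. nth_true (rev (\<sigma>3 15)) a \<and> nth_true (rev (\<sigma>3 15)) b \<and>
      nth_true (rev (\<sigma>3 15)) c \<and> nth_true (drop (a * n) (rev (\<sigma>3 13))) b \<and>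
      nth_true (drop (b * n) (rev (\<sigma>3 13))) c \<longrightarrow> nth_true (drop (a * n) (rev (\<sigma>3 13))) c)"
    unfolding \<sigma>4_def by (rule exec_check_a) (use r2 sel mat in \<open>simp_all add: \<sigma>3_def\<close>)
  also have "\<dots> \<longleftrightarrow> (\<forall>a<n. \<forall>b<n. \<forall>c<n. S a \<and> S b \<and> S c \<and> M a b \<and> M b c \<longrightarrow> M a c)"
    using r2 sel by (auto simp: \<sigma>3_def S M)
  finally have 4: "\<sigma>4 23 = [] \<longleftrightarrow>
      (\<forall>a<n. \<forall>b<n. \<forall>c<n. S a \<and> S b \<and> S c \<and> M a b \<and> M b c \<longrightarrow> M a c)" .
  have "\<sigma>4 12 = \<sigma>2 12" "\<sigma>4 1 = []"
    unfolding \<sigma>4_def using r2 by (subst exec_frame; simp add: \<sigma>3_def)+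
  define \<sigma>5 where "\<sigma>5 = exec test_zero \<sigma>4"
  have "\<sigma>5 1 = []" unfolding \<sigma>5_def using \<open>\<sigma>4 1 = []\<close> by (subst exec_frame) auto
  moreover have 5: "\<sigma>5 23 = [] \<longleftrightarrow> \<sigma>4 23 = [] \<and> bits_value ks \<le> card {j. j < n \<and> S j}"
    using exec_test_zero[of \<sigma>4] sel(2) \<open>\<sigma>4 12 = \<sigma>2 12\<close> by (simp add: \<sigma>5_def)
  moreover have "exec verifier \<sigma> = exec (IfEmpty 23 (Push 1 True) Skip) \<sigma>5"
    unfolding verifier_def exec.simps(4) 1 \<sigma>2_def[symmetric] 3 \<sigma>4_def[symmetric] \<sigma>5_def ..
  ultimately have "exec verifier \<sigma> 1 = [True] \<longleftrightarrow> \<sigma>5 23 = []" by simp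
  also have "\<dots> \<longleftrightarrow> bits_value ks \<le> card {i. i < n \<and> S i} \<and>
      (\<forall>a<n. \<forall>b<n. \<forall>c<n. S a \<and> S b \<and> S c \<and> M a b \<and> M b c \<longrightarrow> M a c)"
    unfolding 5 4 by (rule conj_commute)
  finally show ?thesis unfolding \<sigma>_def .
qed

subsection \<open>The reduction\<close>

text \<open>Vertex \<open>i\<close> of the graph becomes \<open>2 * i\<close>, and \<open>2 * i + 1\<close> is the isolated vertex placed
  right after it.\<close>

definition spread_arc :: "(nat \<Rightarrow> nat \<Rightarrow> bool) \<Rightarrow> nat \<Rightarrow> nat \<Rightarrow> bool" where
  "spread_arc adj a b \<longleftrightarrow> (if even a \<and> even b \<and> adj (a div 2) (b div 2) then b < a else a < b)"

text \<open>While row \<open>i\<close> is read, register 25 (in the second pass, 26) counts down from \<open>i\<close>, and 27 is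
  set after the diagonal.\<close>

definition even_row :: cmd where
  "even_row = IfEmpty 25
     (IfEmpty 27 (Push 24 False ;; Push 24 True ;; Push 27 True)
       (IfTrue 12 (Push 24 False) (Push 24 True) ;; Push 24 True))
     (Pop 25 ;; Push 26 True ;; copy_top 12 24 ;; Push 24 False) ;; Pop 12"

definition odd_row :: cmd where
  "odd_row = IfEmpty 26
     (IfEmpty 27 (Push 24 False ;; Push 24 False ;; Push 27 True) (Push 24 True ;; Push 24 True))
     (Pop 26 ;; Push 25 True ;; Push 24 False ;; Push 24 False)"

text \<open>The first pass moves the unary counter \<open>i\<close> from 25 to 26 and the second one
  moves it back; the last push turns it into \<open>i + 1\<close> for the next row of the
  graph.\<close>

definition two_rows :: cmd where
  "two_rows = Loop 9 even_row ;; Pop 27 ;; Loop 9 odd_row ;; Pop 27 ;; Push 25 True"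

lemma row_simps [simp]:
  "writes even_row = {12, 24, 25, 26, 27}" "loops even_row = {}" "ok even_row"
  "writes odd_row = {24, 25, 26, 27}" "loops odd_row = {}" "ok odd_row"
  "writes two_rows = {12, 24, 25, 26, 27}" "loops two_rows = {9}" "ok two_rows"
  by (auto simp: even_row_def odd_row_def two_rows_def)

text \<open>Entry \<open>(i, j)\<close> yields columns \<open>2 * j\<close> and
  \<open>2 * j + 1\<close>. For \<open>j < i\<close> there is an arc to the first exactly if there
  is an edge, and none to the second; for \<open>j = i\<close> only the arc to the companion
  \<open>2 * i + 1\<close>; for \<open>j > i\<close> an edge removes the arc to the first, and the
  second always gets one.\<close>

lemma exec_even_row:
  assumes n: "length (\<sigma> 9) = n" "i < n" and row: "\<And>j. j < n \<Longrightarrow> nth_true (\<sigma> 12) j \<longleftrightarrow> adj i j"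
    and e: "\<sigma> 25 = replicate i True" "\<sigma> 26 = []" "\<sigma> 27 = []"
  defines "\<tau> \<equiv> exec (Loop 9 even_row) \<sigma>"
  shows "\<tau> 12 = drop n (\<sigma> 12)" "\<tau> 24 = rev (map (spread_arc adj (2 * i)) [0..<2 * n]) @ \<sigma> 24"
    "\<tau> 25 = []" "\<tau> 26 = replicate i True" "\<tau> 27 = [True]"
proof -
  define I where "I = (\<lambda>j (\<tau> :: store). \<tau> 12 = drop j (\<sigma> 12) \<and>
    \<tau> 24 = rev (map (spread_arc adj (2 * i)) [0..<2 * j]) @ \<sigma> 24 \<and> \<tau> 25 = replicate (i - j) True \<and>
    \<tau> 26 = replicate (min i j) True \<and> \<tau> 27 = (if j \<le> i then [] else [True]))"
  have "I (length (\<sigma> 9)) (exec (Loop 9 even_row) \<sigma>)"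
  proof (rule exec_Loop_invariant)
    fix j \<tau> assume I: "I j \<tau>" and j: "j < length (\<sigma> 9)"
    have row': "top_symbol (drop j (\<sigma> 12)) = 2 \<longleftrightarrow> adj i j"
      using row j n by (simp add: top_symbol_drop)
    then have row'': "\<not> length (\<sigma> 12) \<le> j \<and> hd (drop j (\<sigma> 12)) \<longleftrightarrow> adj i j"
      by (simp add: top_symbol_eq_2)
    have dr: "tl (drop j (\<sigma> 12)) = drop (Suc j) (\<sigma> 12)" by (simp add: drop_Suc tl_drop)
    have arcs: "rev (map (spread_arc adj (2 * i)) [0..<2 * Suc j]) =
        spread_arc adj (2 * i) (Suc (2 * j)) # spread_arc adj (2 * i) (2 * j) #
          rev (map (spread_arc adj (2 * i)) [0..<2 * j])" by simp
    consider "j < i" | "j = i" | "i < j" by linarith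
    then show "I (Suc j) (exec even_row \<tau>)"
    proof cases
      case 1
      then obtain k where k: "i - j = Suc k" "i - Suc j = k" by (metis Suc_diff_Suc)
      have m: "min i (Suc j) = Suc j" "min i j = j" using 1 by auto
      have "exec even_row \<tau> = \<tau>(25 := replicate k True, 26 := True # \<tau> 26,
          24 := False # adj i j # \<tau> 24, 12 := drop (Suc j) (\<sigma> 12))"
        using I k row'' by (simp add: even_row_def I_def dr)
      then show ?thesis using I 1 k m by (simp add: I_def arcs spread_arc_def)
    next
      case 2
      have "exec even_row \<tau> = \<tau>(24 := True # False # \<tau> 24, 27 := [True], 12 := drop (Suc j) (\<sigma> 12))"
        using I 2 by (simp add: even_row_def I_def dr[unfolded 2])
      then show ?thesis using I 2 by (simp add: I_def arcs spread_arc_def)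
    next
      case 3
      have "exec even_row \<tau> = \<tau>(24 := True # (\<not> adj i j) # \<tau> 24, 12 := drop (Suc j) (\<sigma> 12))"
        using I 3 row' by (simp add: even_row_def I_def dr)
      then show ?thesis using I 3 by (simp add: I_def arcs spread_arc_def)
    qed
  qed (use e in \<open>auto simp: I_def\<close>)
  then show "\<tau> 12 = drop n (\<sigma> 12)" "\<tau> 24 = rev (map (spread_arc adj (2 * i)) [0..<2 * n]) @ \<sigma> 24"
    "\<tau> 25 = []" "\<tau> 26 = replicate i True" "\<tau> 27 = [True]"
    using n by (simp_all add: I_def \<tau>_def min_def del: exec.simps)
qed

text \<open>An odd vertex is on no backedge, so its row only compares positions and never consults
  the matrix.\<close>

lemma exec_odd_row:
  assumes n: "length (\<sigma> 9) = n" "i < n"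
    and e: "\<sigma> 26 = replicate i True" "\<sigma> 25 = []" "\<sigma> 27 = []"
  defines "\<tau> \<equiv> exec (Loop 9 odd_row) \<sigma>"
  shows "\<tau> 24 = rev (map (spread_arc adj (Suc (2 * i))) [0..<2 * n]) @ \<sigma> 24"
    "\<tau> 26 = []" "\<tau> 25 = replicate i True" "\<tau> 27 = [True]"
proof -
  define I where "I = (\<lambda>j (\<tau> :: store).
    \<tau> 24 = rev (map (spread_arc adj (Suc (2 * i))) [0..<2 * j]) @ \<sigma> 24 \<and> \<tau> 26 = replicate (i - j) True \<and>
    \<tau> 25 = replicate (min i j) True \<and> \<tau> 27 = (if j \<le> i then [] else [True]))"
  have "I (length (\<sigma> 9)) (exec (Loop 9 odd_row) \<sigma>)"
  proof (rule exec_Loop_invariant)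
    fix j \<tau> assume I: "I j \<tau>" and j: "j < length (\<sigma> 9)"
    have arcs: "rev (map (spread_arc adj (Suc (2 * i))) [0..<2 * Suc j]) =
        (i < j) # (i < j) # rev (map (spread_arc adj (Suc (2 * i))) [0..<2 * j])"
      by (auto simp: spread_arc_def)
    consider "j < i" | "j = i" | "i < j" by linarith
    then show "I (Suc j) (exec odd_row \<tau>)"
    proof cases
      case 1
      then obtain k where k: "i - j = Suc k" "i - Suc j = k" by (metis Suc_diff_Suc)
      have m: "min i (Suc j) = Suc j" "min i j = j" using 1 by auto
      have "exec odd_row \<tau> = \<tau>(26 := replicate k True, 25 := True # \<tau> 25,
          24 := False # False # \<tau> 24)"
        using I k by (simp add: odd_row_def I_def)
      then show ?thesis using I 1 k m arcs by (simp add: I_def)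
    next
      case 2
      have "exec odd_row \<tau> = \<tau>(24 := False # False # \<tau> 24, 27 := [True])"
        using I 2 by (simp add: odd_row_def I_def)
      then show ?thesis using I 2 arcs by (simp add: I_def)
    next
      case 3
      have "exec odd_row \<tau> = \<tau>(24 := True # True # \<tau> 24)"
        using I 3 by (simp add: odd_row_def I_def)
      then show ?thesis using I 3 arcs by (simp add: I_def)
    qed
  qed (use e in \<open>auto simp: I_def\<close>)
  then show "\<tau> 24 = rev (map (spread_arc adj (Suc (2 * i))) [0..<2 * n]) @ \<sigma> 24"
    "\<tau> 26 = []" "\<tau> 25 = replicate i True" "\<tau> 27 = [True]"
    using n by (simp_all add: I_def \<tau>_def min_def del: exec.simps)
qed

abbreviation matrix :: "nat \<Rightarrow> (nat \<Rightarrow> nat \<Rightarrow> bool) \<Rightarrow> bool list" where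
  "matrix n adj \<equiv> concat (map (\<lambda>i. map (adj i) [0..<n]) [0..<n])"

lemma length_rows: "length (concat (map (\<lambda>i. map (adj i) [0..<n]) [0..<m])) = m * n"
  by (induction m) auto

lemma nth_rows:
  assumes "i < m" "j < n"
  shows "concat (map (\<lambda>i. map (adj i) [0..<n]) [0..<m]) ! (i * n + j) = adj i j"
  using assms(1)
proof (induction m)
  case (Suc m)
  show ?case
  proof (cases "i = m")
    case True
    then show ?thesis using assms(2) by (simp add: nth_append length_rows)
  next
    case False
    then have i: "i < m" using Suc.prems by simp
    have "i * n + j < Suc i * n" using assms(2) by simp
    also have "\<dots> \<le> m * n" using i by (intro mult_le_mono1) simp
    finally show ?thesis using Suc.IH[OF i] by (simp add: nth_append length_rows)
  qed
qed simp

lemma exec_rows: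
  assumes n: "length (\<sigma> 8) = n" "length (\<sigma> 9) = n" and R: "\<sigma> 12 = matrix n adj @ ks"
    and e: "\<sigma> 25 = []" "\<sigma> 26 = []" "\<sigma> 27 = []"
  defines "\<tau> \<equiv> exec (Loop 8 two_rows) \<sigma>"
  shows "\<tau> 12 = ks" "\<tau> 24 = rev (matrix (2 * n) (spread_arc adj)) @ \<sigma> 24"
proof -
  let ?rows = "\<lambda>m. concat (map (\<lambda>a. map (spread_arc adj a) [0..<2 * n]) [0..<m])"
  define I where "I = (\<lambda>i (\<tau> :: store). \<tau> 12 = drop (i * n) (\<sigma> 12) \<and>
    \<tau> 24 = rev (?rows (2 * i)) @ \<sigma> 24 \<and> \<tau> 25 = replicate i True \<and> \<tau> 26 = [] \<and> \<tau> 27 = [])"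
  have "I (length (\<sigma> 8)) (exec (Loop 8 two_rows) \<sigma>)"
  proof (rule exec_Loop_invariant)
    fix i \<tau> assume I: "I i \<tau>" and "i < length (\<sigma> 8)"
      and fr: "\<And>s. s \<notin> writes two_rows \<Longrightarrow> s \<noteq> 8 \<Longrightarrow> \<tau> s = \<sigma> s"
    then have i: "i < n" using n by simp
    have l9: "length (\<tau> 9) = n" using fr[of 9] n by simp
    have row: "nth_true (\<tau> 12) j \<longleftrightarrow> adj i j" if "j < n" for j
      using I that i nth_rows[of i n j n adj] index_less_square[OF i that]
      by (auto simp: I_def R nth_true_def length_rows nth_append)
    define \<tau>1 where "\<tau>1 = exec (Loop 9 even_row) \<tau>"
    have "\<tau> 25 = replicate i True" "\<tau> 26 = []" "\<tau> 27 = []" using I by (auto simp: I_def)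
    note ev = exec_even_row[where adj = adj and i = i and \<sigma> = \<tau> and n = n, OF l9 i row this, folded \<tau>1_def]
    define \<tau>2 where "\<tau>2 = exec (Loop 9 odd_row) (\<tau>1(27 := []))"
    have "\<tau>1 9 = \<tau> 9" unfolding \<tau>1_def by (rule exec_frame) simp
    then have o: "length ((\<tau>1(27 := [])) 9) = n" "(\<tau>1(27 := [])) 26 = replicate i True"
      "(\<tau>1(27 := [])) 25 = []" "(\<tau>1(27 := [])) 27 = []"
      using ev l9 by auto
    note od = exec_odd_row(1)[OF o(1) i o(2-), of adj, folded \<tau>2_def]
      exec_odd_row(2-)[OF o(1) i o(2-), folded \<tau>2_def]
    have 12: "\<tau>2 12 = drop n (\<tau> 12)" unfolding \<tau>2_def by (subst exec_frame) (simp_all add: ev)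
    have p: "exec (Pop 27) \<tau>1 = \<tau>1(27 := [])" by (simp add: ev)
    have ex: "exec two_rows \<tau> = \<tau>2(27 := [], 25 := replicate (Suc i) True)"
      unfolding two_rows_def exec.simps(4) \<tau>1_def[symmetric] p \<tau>2_def[symmetric] by (simp add: od)
    show "I (Suc i) (exec two_rows \<tau>)"
      unfolding ex using I od(1,2) ev(2) 12 by (simp add: I_def add.commute)
  qed (use e in \<open>auto simp: I_def\<close>)
  then have "I n \<tau>" unfolding \<tau>_def n(1) .
  then show "\<tau> 12 = ks" "\<tau> 24 = rev (matrix (2 * n) (spread_arc adj)) @ \<sigma> 24"
    by (simp_all add: I_def R length_rows)
qed

section \<open>The threshold and the output of the reduction\<close>

definition double :: "nat \<Rightarrow> cmd" where
  "double t = Loop 8 (Push t True ;; Push t True)"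

lemma double_simps [simp]: "writes (double t) = {t}" "loops (double t) = {8}" "ok (double t) \<longleftrightarrow> t \<noteq> 8"
  by (auto simp: double_def)

lemma exec_double:
  assumes "t \<noteq> 8"
  shows "exec (double t) \<sigma> = \<sigma>(t := replicate (2 * length (\<sigma> 8)) True @ \<sigma> t)"
proof -
  have "(loop (exec (Push t True ;; Push t True)) 8 xs \<sigma>)(8 := w) =
      \<sigma>(t := replicate (2 * length xs) True @ \<sigma> t, 8 := w)" for xs w
  proof (induction xs arbitrary: \<sigma>)
    case (Cons x xs)
    have st: "exec (Push t True ;; Push t True) (\<sigma>(8 := x # xs)) =
        \<sigma>(8 := x # xs, t := True # True # \<sigma> t)" using assms by simp
    show ?case
      by (rule loop_Cons_eqI, rule st, rule Cons.IH)
        (use assms in \<open>auto simp: fun_eq_iff replicate_app_Cons_same\<close>)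
  qed (use assms in auto)
  then show ?thesis unfolding double_def by (rule exec_Loop_eqI) (use assms in auto)
qed

definition subtract_body :: cmd where
  "subtract_body = count False False 12 ;; IfTrue 7 (Pop 7) (Pop 7 ;; count True True 29 ;; Pop 7)"

text \<open>Each pass over register 28 lowers the number in 12 as long as it is positive and
  otherwise raises the result, which starts at 1 and so ends at 1 plus the surplus of
  passes.\<close>

lemma exec_subtract:
  assumes l: "length (\<sigma> 12) < length (\<sigma> 0)" "length (\<sigma> 28) < length (\<sigma> 0)"
    and e: "\<sigma> 7 = []" "\<sigma> 16 = []" "\<sigma> 29 = nat_bits 1"
  shows "exec (Loop 28 subtract_body) \<sigma> 29 = nat_bits (Suc (length (\<sigma> 28) - bits_value (\<sigma> 12)))"
proof -
  let ?k = "bits_value (\<sigma> 12)"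
  define I where "I = (\<lambda>i (\<tau> :: store). bits_value (\<tau> 12) = ?k - i \<and> length (\<tau> 12) = length (\<sigma> 12) \<and>
    \<tau> 29 = nat_bits (Suc (i - ?k)) \<and> \<tau> 7 = [] \<and> \<tau> 16 = [])"
  have "I (length (\<sigma> 28)) (exec (Loop 28 subtract_body) \<sigma>)"
  proof (rule exec_Loop_invariant)
    fix i \<tau> assume I: "I i \<tau>" and i: "i < length (\<sigma> 28)"
      and fr: "\<And>s. s \<notin> writes subtract_body \<Longrightarrow> s \<noteq> 28 \<Longrightarrow> \<tau> s = \<sigma> s"
    have \<tau>0: "\<tau> 0 = \<sigma> 0" by (rule fr) (simp_all add: subtract_body_def)
    obtain bs where bs: "exec (count False False 12) \<tau> = \<tau>(12 := bs, 7 := [bits_value (\<tau> 12) > 0])"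
        "bits_value bs = bits_value (\<tau> 12) - 1" "length bs = length (\<tau> 12)"
      using exec_decrement[of \<tau>] I \<tau>0 l by (auto simp: I_def)
    show "I (Suc i) (exec subtract_body \<tau>)"
    proof (cases "i < ?k")
      case True
      then have "exec subtract_body \<tau> = \<tau>(12 := bs, 7 := [])"
        using bs(1) I by (simp add: subtract_body_def I_def)
      then show ?thesis using I True bs(2,3) by (simp add: I_def)
    next
      case False
      let ?\<tau> = "\<tau>(12 := bs, 7 := [])"
      \<comment> \<open>The binary form is no longer than the value, which the number of passes
        bounds; so register 0 gives the carry enough iterations.\<close>
      have "length (nat_bits (Suc (i - ?k))) \<le> Suc (i - ?k)" by (rule length_nat_bits_le)
      then have "length (nat_bits (Suc (i - ?k))) < length (?\<tau> 0)" using i l(2) \<tau>0 by simp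
      then have "exec (count True True 29) ?\<tau> = ?\<tau>(29 := nat_bits (Suc (Suc (i - ?k))), 7 := [True])"
        using I by (intro exec_increment) (simp_all add: I_def)
      then have "exec subtract_body \<tau> = ?\<tau>(29 := nat_bits (Suc (Suc (i - ?k))), 7 := [])"
        using bs(1) I False by (simp add: subtract_body_def I_def)
      then show ?thesis using I False bs(2,3) by (simp add: I_def Suc_diff_le)
    qed
  qed (use e in \<open>auto simp: I_def\<close>)
  then show ?thesis by (simp add: I_def del: exec.simps)
qed

primrec emit :: "bool list \<Rightarrow> cmd" where
  "emit [] = Skip"
| "emit (b # bs) = emit bs ;; Push 1 b"

lemma exec_emit: "exec (emit z) \<sigma> = \<sigma>(1 := z @ \<sigma> 1)"
  by (induction z arbitrary: \<sigma>) auto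

lemma emit_simps [simp]: "loops (emit z) = {}" "ok (emit z)"
  by (induction z) auto

text \<open>Register 24 builds the output back to front: unary prefix, rows, threshold; the last
  copy reverses it. Register 28 provides \<open>2 * n - 1\<close> passes, which with the initial 1
  in register 29 give the threshold \<open>Suc (2 * n - 1 - k)\<close>. The string \<open>z\<close>
  answers the case \<open>n = 0\<close>.\<close>

definition reduction :: "bool list \<Rightarrow> cmd" where
  "reduction z = copy_rev 0 2 ;; parse ;; IfEmpty 8 (emit z)
     (double 24 ;; Push 24 False ;; Loop 8 two_rows ;; double 28 ;; Pop 28 ;; Push 29 True ;;
      Loop 28 subtract_body ;; copy_rev 29 24 ;; copy_rev 24 1)"

lemma ok_reduction: "ok (reduction z)" "1 \<notin> loops (reduction z)"
  by (auto simp: reduction_def subtract_body_def)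

lemma exec_reduction:
  "exec (reduction z) (init_store (encode_instance n adj k)) 1 =
    (if n = 0 then z else encode_instance (2 * n) (spread_arc adj) (Suc (2 * n - 1 - k)))"
proof -
  let ?x = "replicate n True @ False # matrix n adj @ nat_bits k"
  have x: "encode_instance n adj k = ?x" by (simp add: encode_instance_def)
  define \<sigma> where "\<sigma> = init_store ?x"
  define \<sigma>1 where "\<sigma>1 = \<sigma>(2 := rev ?x, 6 := ?x, 8 := replicate n True, 9 := replicate n True,
    10 := replicate n True, 11 := rev (matrix n adj @ nat_bits k), 12 := matrix n adj @ nat_bits k)"
  have a: "exec (copy_rev 0 2) \<sigma> = \<sigma>(2 := rev ?x)" by (simp add: exec_copy_rev \<sigma>_def)
  have 1: "exec parse (\<sigma>(2 := rev ?x)) = \<sigma>1"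
    unfolding \<sigma>1_def by (rule exec_parse) (simp_all add: \<sigma>_def)
  show ?thesis
  proof (cases "n = 0")
    case True
    then have "\<sigma>1 8 = []" by (simp add: \<sigma>1_def)
    then have "exec (reduction z) \<sigma> = \<sigma>1(1 := z @ \<sigma>1 1)"
      unfolding reduction_def exec.simps(4) a 1 by (simp add: exec_emit)
    then show ?thesis using True unfolding x \<sigma>_def[symmetric] by (simp add: \<sigma>1_def) (simp add: \<sigma>_def)
  next
    case False
    then have top: "top_symbol (\<sigma>1 8) \<noteq> 0" by (simp add: \<sigma>1_def)
    define \<sigma>2 where "\<sigma>2 = \<sigma>1(24 := False # replicate (2 * n) True)"
    have 2: "exec (Push 24 False) (exec (double 24) \<sigma>1) = \<sigma>2"
      by (simp add: exec_double \<sigma>2_def \<sigma>1_def \<sigma>_def)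
    define \<sigma>3 where "\<sigma>3 = exec (Loop 8 two_rows) \<sigma>2"
    have "length (\<sigma>2 8) = n" "length (\<sigma>2 9) = n" "\<sigma>2 12 = matrix n adj @ nat_bits k"
      "\<sigma>2 25 = []" "\<sigma>2 26 = []" "\<sigma>2 27 = []"
      by (simp_all add: \<sigma>2_def \<sigma>1_def \<sigma>_def)
    note rows = exec_rows[OF this, folded \<sigma>3_def]
    have f3: "\<sigma>3 s = \<sigma>2 s" if "s \<notin> {12, 24, 25, 26, 27}" for s
      unfolding \<sigma>3_def by (rule exec_frame) (use that in auto)
    define \<sigma>4 where "\<sigma>4 = \<sigma>3(28 := replicate (2 * n - 1) True, 29 := nat_bits 1)"
    have b1: "nat_bits (Suc 0) = [True]" by (simp add: nat_bits.simps)
    have "tl (replicate (2 * n) True) = replicate (2 * n - 1) True" by (cases n) auto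
    then have 4: "exec (Push 29 True) (exec (Pop 28) (exec (double 28) \<sigma>3)) = \<sigma>4"
      using f3[of 28] f3[of 29] f3[of 8]
      by (simp add: exec_double \<sigma>4_def \<sigma>2_def \<sigma>1_def \<sigma>_def b1)
    define \<sigma>5 where "\<sigma>5 = exec (Loop 28 subtract_body) \<sigma>4"
    have len: "length (\<sigma>4 0) = Suc (n + n * n + length (nat_bits k))"
      using f3[of 0] by (simp add: \<sigma>4_def \<sigma>2_def \<sigma>1_def \<sigma>_def length_rows)
    have sub: "\<sigma>5 29 = nat_bits (Suc (2 * n - 1 - k))"
      unfolding \<sigma>5_def
    proof (subst exec_subtract)
      show "length (\<sigma>4 12) < length (\<sigma>4 0)" using rows(1) unfolding len by (simp add: \<sigma>4_def)
      have "2 * n - 1 < Suc (n + n * n + length (nat_bits k))" using le_square[of n] by linarith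
      then show "length (\<sigma>4 28) < length (\<sigma>4 0)" unfolding len by (simp add: \<sigma>4_def)
      show "\<sigma>4 7 = []" "\<sigma>4 16 = []" "\<sigma>4 29 = nat_bits 1"
        using f3[of 7] f3[of 16] by (simp_all add: \<sigma>4_def \<sigma>2_def \<sigma>1_def \<sigma>_def)
    qed (use rows(1) in \<open>simp add: \<sigma>4_def bits_value_nat_bits\<close>)
    have "\<sigma>5 24 = \<sigma>4 24" "\<sigma>5 1 = \<sigma>4 1"
      unfolding \<sigma>5_def by (rule exec_frame, simp add: subtract_body_def)+
    then have r5: "\<sigma>5 24 = rev (matrix (2 * n) (spread_arc adj)) @ False # replicate (2 * n) True"
      "\<sigma>5 1 = []"
      using rows(2) f3[of 1] by (simp_all add: \<sigma>4_def \<sigma>2_def \<sigma>1_def \<sigma>_def)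
    have "exec (reduction z) \<sigma> = exec (copy_rev 24 1) (exec (copy_rev 29 24) \<sigma>5)"
      unfolding reduction_def exec.simps(4) a 1 exec.simps(5)
      using top 2 4 \<sigma>3_def \<sigma>5_def by simp
    then show ?thesis unfolding x \<sigma>_def[symmetric] using False r5 sub
      by (simp add: exec_copy_rev encode_instance_def rev_replicate)
  qed
qed

section \<open>NP-completeness\<close>

subsection \<open>Encodings\<close>

lemma encode_instance_eq_iff:
  "encode_instance n adj k = encode_instance n' adj' k' \<longleftrightarrow>
    n = n' \<and> k = k' \<and> (\<forall>i<n. \<forall>j<n. adj i j = adj' i j)"
proof
  assume eq: "encode_instance n adj k = encode_instance n' adj' k'"
  have "takeWhile id (encode_instance n adj k) = replicate n True" for n adj k
    unfolding encode_instance_def by (subst takeWhile_append2) auto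
  then have "replicate n True = replicate n' True" using eq by metis
  then have n: "n = n'" by (metis length_replicate)
  then have m: "matrix n adj = matrix n adj'" and k: "nat_bits k = nat_bits k'"
    using eq by (auto simp: encode_instance_def length_rows append_eq_append_conv)
  have "adj i j = adj' i j" if "i < n" "j < n" for i j
    using nth_rows[OF that, of adj] nth_rows[OF that, of adj'] m by metis
  with n k show "n = n' \<and> k = k' \<and> (\<forall>i<n. \<forall>j<n. adj i j = adj' i j)" by simp
next
  assume *: "n = n' \<and> k = k' \<and> (\<forall>i<n. \<forall>j<n. adj i j = adj' i j)"
  then have "matrix n adj = matrix n adj'"
    by (intro arg_cong[where f = concat] map_cong) auto
  with * show "encode_instance n adj k = encode_instance n' adj' k'"
    by (simp add: encode_instance_def)
qed

lemma encode_digraph_eqD: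
  assumes "encode_digraph n A k = encode_digraph n' A' k'"
    and "tournament ({..<n}, A)" "tournament ({..<n'}, A')"
  shows "n = n' \<and> A = A' \<and> k = k'"
proof -
  have *: "n = n'" "k = k'" "\<forall>i<n. \<forall>j<n. (i, j) \<in> A \<longleftrightarrow> (i, j) \<in> A'"
    using assms(1) by (auto simp: encode_digraph_def encode_instance_eq_iff)
  moreover have "A \<subseteq> {..<n} \<times> {..<n}" "A' \<subseteq> {..<n} \<times> {..<n}"
    using assms(2,3) *(1) by (auto simp: tournament_def)
  ultimately have "A = A'" by auto
  with * show ?thesis by simp
qed

text \<open>The matrix only shows pairs of vertices below \<open>n\<close>; in a simple graph every
  edge is such a pair, so nothing is lost.\<close>

lemma encode_graph_eqD:
  assumes "encode_graph n E k = encode_graph n' E' k'"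
    and "simple_graph ({..<n}, E)" "simple_graph ({..<n'}, E')"
  shows "n = n' \<and> E = E' \<and> k = k'"
proof -
  have *: "n = n'" "k = k'" "\<forall>i<n. \<forall>j<n. {i, j} \<in> E \<longleftrightarrow> {i, j} \<in> E'"
    using assms(1) by (auto simp: encode_graph_def encode_instance_eq_iff)
  have "\<exists>i<n. \<exists>j<n. e = {i, j}" if "e \<in> E \<union> E'" for e
  proof -
    have "e \<subseteq> {..<n}" "card e = 2" using that assms(2,3) *(1) by (auto simp: simple_graph_def)
    then show ?thesis by (auto simp: card_2_iff)
  qed
  then have "E = E'" using *(3) by blast
  with * show ?thesis by simp
qed

lemma simple_graph_iso_closure:
  assumes "\<forall>G \<in> C. simple_graph G" "H \<in> iso_closure C"
  shows "simple_graph H"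
proof -
  obtain G f where G: "simple_graph G" "bij_betw f (fst G) (fst H)" "snd H = (\<lambda>e. f ` e) ` snd G"
    using assms by (auto simp: iso_closure_def graph_iso_def)
  have "f ` e \<subseteq> fst H \<and> card (f ` e) = 2" if "e \<in> snd G" for e
  proof -
    have e: "e \<subseteq> fst G" "card e = 2" using that G(1) by (auto simp: simple_graph_def)
    then have "inj_on f e" using G(2) by (meson bij_betw_def inj_on_subset)
    then show ?thesis using e G(2) by (auto simp: card_image bij_betw_def)
  qed
  moreover have "finite (fst H)" using G by (auto simp: simple_graph_def bij_betw_finite)
  ultimately show ?thesis using G(3) by (auto simp: simple_graph_def)
qed

text \<open>The \<open>LEAST\<close> is attained because the whole vertex set is a cover: edges of a
  simple graph are not empty.\<close>

lemma min_vertex_cover_size_le_iff: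
  assumes "simple_graph G"
  shows "min_vertex_cover_size G \<le> k \<longleftrightarrow> (\<exists>X. vertex_cover G X \<and> card X \<le> k)"
proof
  have "e \<inter> fst G \<noteq> {}" if "e \<in> snd G" for e
  proof -
    have "e \<subseteq> fst G" "card e = 2" using assms that by (auto simp: simple_graph_def)
    then show ?thesis by (auto simp: card_2_iff)
  qed
  then have "vertex_cover G (fst G)" by (auto simp: vertex_cover_def)
  then have "\<exists>m X. vertex_cover G X \<and> card X = m" by blast
  from LeastI_ex[OF this] have "\<exists>X. vertex_cover G X \<and> card X = min_vertex_cover_size G"
    unfolding min_vertex_cover_size_def .
  then show "min_vertex_cover_size G \<le> k \<Longrightarrow> \<exists>X. vertex_cover G X \<and> card X \<le> k" by auto
  assume "\<exists>X. vertex_cover G X \<and> card X \<le> k"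
  then obtain X where X: "vertex_cover G X" "card X \<le> k" by blast
  then have "min_vertex_cover_size G \<le> card X"
    unfolding min_vertex_cover_size_def by (intro Least_le exI[of _ X]) simp
  with X(2) show "min_vertex_cover_size G \<le> k" by simp
qed

subsection \<open>The tournament of a graph\<close>

definition spread_tournament :: "nat \<Rightarrow> nat set set \<Rightarrow> (nat \<times> nat) set" where
  "spread_tournament n E =
     {(a, b). a < 2 * n \<and> b < 2 * n \<and> spread_arc (\<lambda>i j. {i, j} \<in> E) a b}"

lemma encode_spread_tournament:
  "encode_digraph (2 * n) (spread_tournament n E) k =
    encode_instance (2 * n) (spread_arc (\<lambda>i j. {i, j} \<in> E)) k"
  by (auto simp: encode_digraph_def encode_instance_eq_iff spread_tournament_def)

lemma tournament_spread: "tournament ({..<2 * n}, spread_tournament n E)"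
  by (auto simp: tournament_def spread_tournament_def spread_arc_def insert_commute)

text \<open>In the natural order only arcs between even vertices ever point backwards, and these are
  the doubled edges of the graph.\<close>

lemma backedge_graph_spread:
  assumes "simple_graph ({..<n}, E)"
  shows "backedge_graph ({..<2 * n}, spread_tournament n E) [0..<2 * n] =
    ({..<2 * n}, (\<lambda>e. (*) 2 ` e) ` E)"
proof -
  have "{{[0..<2 * n] ! i, [0..<2 * n] ! j} |i j. j < i \<and> i < length [0..<2 * n] \<and>
      ([0..<2 * n] ! i, [0..<2 * n] ! j) \<in> spread_tournament n E} = (\<lambda>e. (*) 2 ` e) ` E" (is "?L = ?R")
  proof (intro equalityI subsetI)
    fix e assume "e \<in> ?L"
    then obtain a b where ab: "b < a" "a < 2 * n" "(a, b) \<in> spread_tournament n E" "e = {a, b}"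
      by force
    then have "even a" "even b" "{a div 2, b div 2} \<in> E"
      by (auto simp: spread_tournament_def spread_arc_def split: if_splits)
    moreover from this have "e = (*) 2 ` {a div 2, b div 2}" using ab(4) by auto
    ultimately show "e \<in> ?R" by blast
  next
    fix e assume "e \<in> ?R"
    then obtain e' where e': "e' \<in> E" "e = (*) 2 ` e'" by blast
    then have "e' \<subseteq> {..<n}" "card e' = 2" using assms by (auto simp: simple_graph_def)
    then obtain i j where ij: "e' = {i, j}" "j < i" "i < n"
      by (auto simp: card_2_iff) (metis insert_commute linorder_neqE_nat)
    then have "(2 * i, 2 * j) \<in> spread_tournament n E"
      using e'(1) by (auto simp: spread_tournament_def spread_arc_def)
    moreover have "e = {[0..<2 * n] ! (2 * i), [0..<2 * n] ! (2 * j)}" using e'(2) ij by auto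
    ultimately show "e \<in> ?L" using ij by force
  qed
  then show ?thesis by (simp add: backedge_graph_def)
qed

text \<open>\<open>C\<close> is only known to contain an isomorphic original \<open>(V, E0)\<close>
  of the graph, so the isolated vertices \<open>W\<close> are chosen outside of \<open>V\<close>.
  The isomorphism \<open>h\<close> sends \<open>V\<close> to the even numbers via \<open>f\<close>
  and \<open>W\<close> to the odd ones in any order.\<close>

lemma spread_in_class:
  assumes C: "\<forall>G \<in> C. simple_graph G" and G: "({..<n}, E) \<in> iso_closure C"
  shows "({..<2 * n}, spread_tournament n E) \<in> tournaments_with_backedge_graph_in (graphs_plus C)"
proof -
  obtain V E0 f where VE: "(V, E0) \<in> C" "bij_betw f V {..<n}" "E = (\<lambda>e. f ` e) ` E0"
    using G by (auto simp: iso_closure_def graph_iso_def)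
  have "simple_graph (V, E0)" using C VE(1) by blast
  then have V: "finite V" "\<forall>e\<in>E0. e \<subseteq> V" by (auto simp: simple_graph_def)
  have card: "card V = n" using bij_betw_same_card[OF VE(2)] by simp
  have "infinite (- V)" using V(1) by (simp add: Compl_eq_Diff_UNIV)
  then obtain W where W: "finite W" "card W = n" "W \<subseteq> - V"
    using infinite_arbitrarily_large by blast
  obtain g where g: "bij_betw g W {..<n}"
    using finite_same_card_bij[of W "{..<n}"] W by auto
  define h where "h = (\<lambda>v. if v \<in> V then 2 * f v else Suc (2 * g v))"
  have "bij_betw h (V \<union> W) ({a. a < 2 * n \<and> even a} \<union> {a. a < 2 * n \<and> odd a})"
  proof (rule bij_betw_combine)
    have "bij_betw (\<lambda>v. 2 * f v) V {a. a < 2 * n \<and> even a}"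
    proof (rule bij_betw_trans[OF VE(2), of "(*) 2", unfolded o_def])
      show "bij_betw ((*) 2) {..<n} {a. a < 2 * n \<and> even a}"
        by (rule bij_betw_byWitness[where f' = "\<lambda>a. a div 2"]) auto
    qed
    then show "bij_betw h V {a. a < 2 * n \<and> even a}"
      by (rule bij_betw_cong[THEN iffD1, rotated]) (simp add: h_def)
    have "bij_betw (\<lambda>v. Suc (2 * g v)) W {a. a < 2 * n \<and> odd a}"
    proof (rule bij_betw_trans[OF g, of "\<lambda>i. Suc (2 * i)", unfolded o_def])
      show "bij_betw (\<lambda>i. Suc (2 * i)) {..<n} {a. a < 2 * n \<and> odd a}"
        by (rule bij_betw_byWitness[where f' = "\<lambda>a. a div 2"]) (auto elim!: oddE)
    qed
    then show "bij_betw h W {a. a < 2 * n \<and> odd a}"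
      by (rule bij_betw_cong[THEN iffD1, rotated]) (use W(3) in \<open>auto simp: h_def\<close>)
  qed auto
  also have "{a. a < 2 * n \<and> even a} \<union> {a. a < 2 * n \<and> odd a} = {..<2 * n}" by auto
  finally have h: "bij_betw h (V \<union> W) {..<2 * n}" .
  have "(\<lambda>e. (*) 2 ` e) ` E = (\<lambda>e. h ` e) ` E0"
    unfolding VE(3) image_image
  proof (rule image_cong)
    fix e assume "e \<in> E0"
    then have "e \<subseteq> V" using V by blast
    then show "(\<lambda>x. 2 * f x) ` e = h ` e" by (intro image_cong) (auto simp: h_def)
  qed simp
  moreover have "(V \<union> W, E0) \<in> graphs_plus C"
    unfolding graphs_plus_def using VE(1) W card
    by (intro CollectI exI[of _ V] exI[of _ E0] exI[of _ W]) auto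
  moreover have "graph_iso (V \<union> W, E0) ({..<2 * n}, (\<lambda>e. h ` e) ` E0)"
    using h by (auto simp: graph_iso_def)
  ultimately have "({..<2 * n}, (\<lambda>e. (*) 2 ` e) ` E) \<in> iso_closure (graphs_plus C)"
    unfolding iso_closure_def by auto
  then have "backedge_graph ({..<2 * n}, spread_tournament n E) [0..<2 * n] \<in> iso_closure (graphs_plus C)"
    using backedge_graph_spread[OF simple_graph_iso_closure[OF C G]] by simp
  moreover have "vertex_ordering ({..<2 * n}, spread_tournament n E) [0..<2 * n]"
    by (auto simp: vertex_ordering_def)
  ultimately show ?thesis using tournament_spread
    by (auto simp: tournaments_with_backedge_graph_in_def)
qed

lemma independent_of_vertex_cover:
  assumes X: "vertex_cover ({..<n}, E) X"
  shows "tournament_independent ({..<2 * n}, spread_tournament n E) ({..<2 * n} - (*) 2 ` X)"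
proof -
  let ?S = "{..<2 * n} - (*) 2 ` X"
  have "a < b" if "a \<in> ?S" "b \<in> ?S" "(a, b) \<in> spread_tournament n E" for a b
  proof (rule ccontr)
    assume "\<not> a < b"
    then have ev: "even a" "even b" "{a div 2, b div 2} \<in> E"
      using that by (auto simp: spread_tournament_def spread_arc_def split: if_splits)
    then have "a div 2 \<in> X \<or> b div 2 \<in> X" using X by (auto simp: vertex_cover_def)
    then have "a \<in> (*) 2 ` X \<or> b \<in> (*) 2 ` X" using ev by (metis dvd_mult_div_cancel imageI)
    then show False using that by simp
  qed
  then have "Restr (spread_tournament n E) ?S \<subseteq> less_than" by auto
  then show ?thesis
    by (auto simp: tournament_independent_def intro: acyclic_subset[OF wf_acyclic[OF wf_less_than]])
qed

text \<open>A backedge between \<open>2 * j\<close> and \<open>2 * i\<close> with \<open>i < j\<close> closes a directed triangle through the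
  isolated vertex \<open>2 * i + 1\<close>.\<close>

lemma vertex_cover_of_independent:
  assumes G: "simple_graph ({..<n}, E)"
    and S: "tournament_independent ({..<2 * n}, spread_tournament n E) S"
  shows "\<exists>X. vertex_cover ({..<n}, E) X \<and> card X \<le> 2 * n - card S"
proof -
  \<comment> \<open>A vertex enters the cover if it or its companion is missing from
    \<open>S\<close>: a backedge with both ends in \<open>S\<close> loses the companion of its lower
    end.\<close>
  define X where "X = {i. i < n \<and> (2 * i \<notin> S \<or> Suc (2 * i) \<notin> S)}"
  have S': "S \<subseteq> {..<2 * n}" "acyclic (Restr (spread_tournament n E) S)"
    using S by (auto simp: tournament_independent_def)
  have "e \<inter> X \<noteq> {}" if e: "e \<in> E" for e
  proof
    assume disj: "e \<inter> X = {}"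
    have "e \<subseteq> {..<n}" "card e = 2" using G e by (auto simp: simple_graph_def)
    then obtain i j where ij: "e = {i, j}" "i < j" "j < n"
      by (auto simp: card_2_iff) (metis insert_commute linorder_neqE_nat)
    then have "2 * i \<in> S" "Suc (2 * i) \<in> S" "2 * j \<in> S" using disj by (auto simp: X_def)
    moreover have "(2 * i, Suc (2 * i)) \<in> spread_tournament n E"
      "(Suc (2 * i), 2 * j) \<in> spread_tournament n E" "(2 * j, 2 * i) \<in> spread_tournament n E"
      using ij e by (auto simp: spread_tournament_def spread_arc_def insert_commute)
    ultimately have "(2 * i, Suc (2 * i)) \<in> Restr (spread_tournament n E) S"
      "(Suc (2 * i), 2 * j) \<in> Restr (spread_tournament n E) S"
      "(2 * j, 2 * i) \<in> Restr (spread_tournament n E) S" by auto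
    then have "(2 * i, 2 * i) \<in> (Restr (spread_tournament n E) S)\<^sup>+"
      by (meson trancl.intros)
    then show False using S'(2) by (auto simp: acyclic_def)
  qed
  then have "vertex_cover ({..<n}, E) X" by (auto simp: vertex_cover_def X_def)
  moreover have "card X \<le> 2 * n - card S"
  proof -
    \<comment> \<open>Charges every vertex of the cover to a missing member of its own pair
      \<open>2 * i\<close>, \<open>2 * i + 1\<close>; different pairs are disjoint.\<close>
    let ?c = "\<lambda>i. if 2 * i \<notin> S then 2 * i else Suc (2 * i)"
    have "inj_on ?c X" by (auto simp: inj_on_def split: if_splits)
    moreover have "?c ` X \<subseteq> {..<2 * n} - S" by (auto simp: X_def)
    ultimately have "card X \<le> card ({..<2 * n} - S)" by (intro card_inj_on_le[where f = ?c]) auto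
    also have "\<dots> = 2 * n - card S" using S'(1) by (simp add: card_Diff_subset finite_subset)
    finally show ?thesis .
  qed
  ultimately show ?thesis by blast
qed

text \<open>The threshold is \<open>2 * n - k\<close> for \<open>k < 2 * n\<close> and 1 beyond.
  Replacing 0 by 1 does no harm: a cover has at most \<open>n < 2 * n\<close> vertices, so deleting
  it never empties the tournament, and conversely a set of one vertex already yields a cover of at
  most \<open>2 * n - 1\<close> vertices.\<close>

lemma spread_reduction_correct:
  assumes G: "simple_graph ({..<n}, E)" and n: "n > 0"
  shows "min_vertex_cover_size ({..<n}, E) \<le> k \<longleftrightarrow>
    (\<exists>S. tournament_independent ({..<2 * n}, spread_tournament n E) S \<and> card S \<ge> Suc (2 * n - 1 - k))"
  unfolding min_vertex_cover_size_le_iff[OF G]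
proof
  assume "\<exists>X. vertex_cover ({..<n}, E) X \<and> card X \<le> k"
  then obtain X where X: "vertex_cover ({..<n}, E) X" "card X \<le> k" by blast
  then have sub: "X \<subseteq> {..<n}" by (auto simp: vertex_cover_def)
  then have fin: "finite X" "card X \<le> n" using finite_subset card_mono[of "{..<n}" X] by auto
  have "card ({..<2 * n} - (*) 2 ` X) = 2 * n - card X"
    using fin sub by (subst card_Diff_subset) (auto simp: card_image inj_on_def)
  then show "\<exists>S. tournament_independent ({..<2 * n}, spread_tournament n E) S \<and>
      card S \<ge> Suc (2 * n - 1 - k)"
    using independent_of_vertex_cover[OF X(1)] X(2) fin(2) n
    by (intro exI[of _ "{..<2 * n} - (*) 2 ` X"]) auto
next
  assume "\<exists>S. tournament_independent ({..<2 * n}, spread_tournament n E) S \<and>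
      card S \<ge> Suc (2 * n - 1 - k)"
  then obtain S where S: "tournament_independent ({..<2 * n}, spread_tournament n E) S"
    "card S \<ge> Suc (2 * n - 1 - k)" by blast
  obtain X where "vertex_cover ({..<n}, E) X" "card X \<le> 2 * n - card S"
    using vertex_cover_of_independent[OF G S(1)] by blast
  then show "\<exists>X. vertex_cover ({..<n}, E) X \<and> card X \<le> k" using S(2) by (intro exI[of _ X]) auto
qed

subsection \<open>Membership in NP\<close>

lemma acyclic_transI: "trans r \<Longrightarrow> irrefl r \<Longrightarrow> acyclic r"
  by (simp add: acyclic_irrefl trancl_id)

text \<open>A transitive irreflexive relation is its own transitive closure, hence acyclic.
  Conversely, if \<open>(a, b)\<close> and \<open>(b, c)\<close> are arcs in an acyclic set, then
  \<open>(a, c)\<close> is one, since in a tournament the alternatives \<open>a = c\<close> and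
  \<open>(c, a)\<close> would close a cycle.\<close>

lemma verifier_correct:
  fixes n k :: nat and A :: "(nat \<times> nat) set"
  assumes T: "tournament ({..<n}, A)"
  defines "x \<equiv> encode_digraph n A k"
  shows "(\<exists>u. length u \<le> length x \<and> exec verifier (init_store (pair_string x u)) 1 = [True]) \<longleftrightarrow>
    (\<exists>S. tournament_independent ({..<n}, A) S \<and> card S \<ge> k)"
proof -
  let ?mat = "matrix n (\<lambda>i j. (i, j) \<in> A)"
  have x: "x = replicate n True @ False # ?mat @ nat_bits k"
    by (simp add: x_def encode_digraph_def encode_instance_def)
  have ver: "exec verifier (init_store (pair_string x u)) 1 = [True] \<longleftrightarrow>
    k \<le> card {i. i < n \<and> nth_true u i} \<and>
    (\<forall>a<n. \<forall>b<n. \<forall>c<n. nth_true u a \<and> nth_true u b \<and> nth_true u c \<and> (a, b) \<in> A \<and> (b, c) \<in> A \<longrightarrow>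
      (a, c) \<in> A)" for u
    unfolding x by (subst exec_verifier[OF length_rows]) (auto simp: nth_rows bits_value_nat_bits)
  show ?thesis
  proof
    assume "\<exists>u. length u \<le> length x \<and> exec verifier (init_store (pair_string x u)) 1 = [True]"
    then obtain u where u: "exec verifier (init_store (pair_string x u)) 1 = [True]" by blast
    let ?S = "{i. i < n \<and> nth_true u i}"
    have "trans (Restr A ?S)" using u unfolding ver by (intro transI) auto
    moreover have "irrefl (Restr A ?S)" using T by (auto simp: tournament_def irrefl_def)
    ultimately have "acyclic (Restr A ?S)" by (rule acyclic_transI)
    then have "tournament_independent ({..<n}, A) ?S" by (auto simp: tournament_independent_def)
    then show "\<exists>S. tournament_independent ({..<n}, A) S \<and> card S \<ge> k" using u unfolding ver by blast
  next
    assume "\<exists>S. tournament_independent ({..<n}, A) S \<and> card S \<ge> k"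
    then obtain S where S: "S \<subseteq> {..<n}" "acyclic (Restr A S)" "card S \<ge> k"
      by (auto simp: tournament_independent_def)
    define u where "u = map (\<lambda>i. i \<in> S) [0..<n]"
    have u: "nth_true u i \<longleftrightarrow> i \<in> S" for i using S(1) by (auto simp: u_def nth_true_def)
    have "(a, c) \<in> A" if abc: "a \<in> S" "b \<in> S" "c \<in> S" "(a, b) \<in> A" "(b, c) \<in> A" for a b c
    proof (rule ccontr)
      assume ac: "(a, c) \<notin> A"
      have path: "(a, c) \<in> (Restr A S)\<^sup>+" using abc by (meson IntI SigmaI trancl.intros)
      have "a \<noteq> c" using path S(2) by (auto simp: acyclic_def)
      moreover have "a \<in> {..<n}" "c \<in> {..<n}" using abc S(1) by auto
      ultimately have "(c, a) \<in> A" using T ac unfolding tournament_def fst_conv snd_conv by blast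
      then have "(c, a) \<in> Restr A S" using abc by simp
      with path have "(a, a) \<in> (Restr A S)\<^sup>+" by (meson trancl.intros)
      then show False using S(2) by (auto simp: acyclic_def)
    qed
    moreover have "{i. i < n \<and> nth_true u i} = S" using S(1) by (auto simp: u)
    ultimately have "exec verifier (init_store (pair_string x u)) 1 = [True]"
      unfolding ver using S(3) by (auto simp: u)
    \<comment> \<open>\<open>x\<close> starts with \<open>n\<close> in unary, so a certificate of
      \<open>n\<close> bits fits.\<close>
    moreover have "length u \<le> length x" by (simp add: u_def x)
    ultimately show "\<exists>u. length u \<le> length x \<and> exec verifier (init_store (pair_string x u)) 1 = [True]"
      by blast
  qed
qed

lemma MISP_in_NP:
  assumes "\<forall>T \<in> \<T>. tournament T"
  shows "in_NP (MISP \<T>)"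
proof -
  \<comment> \<open>\<open>L\<close> may accept anything on strings that encode no instance;
    \<open>in_NP\<close> compares it with the yes-instances only on instances.\<close>
  define L where "L = {x. \<exists>u. length u \<le> length x \<and>
    exec verifier (init_store (pair_string x u)) 1 = [True]}"
  have "L \<in> NP"
    unfolding NP_def using polytime_computable_exec[OF ok_verifier]
    by (intro CollectI exI[of _ "\<lambda>x. exec verifier (init_store x) 1"] exI[of _ "[:0, 1:]"])
      (simp add: L_def)
  moreover have "yes_instances (MISP \<T>) = L \<inter> instances (MISP \<T>)"
  proof -
    have "encode_digraph n A k \<in> L \<longleftrightarrow> (\<exists>S. tournament_independent ({..<n}, A) S \<and> card S \<ge> k)"
      if "({..<n}, A) \<in> \<T>" for n A k
      unfolding L_def mem_Collect_eq by (rule verifier_correct) (use assms that in auto)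
    then show ?thesis by (auto simp: MISP_def) blast
  qed
  ultimately show ?thesis unfolding in_NP_def by blast
qed

text \<open>A reduction of the empty language must output no-instances. The hardness proof takes one
  of them to get a graph with at least one vertex.\<close>

lemma empty_in_NP: "{} \<in> NP"
proof -
  have "polytime_computable (\<lambda>x. exec Skip (init_store x) 1)"
    by (rule polytime_computable_exec) simp
  then show ?thesis unfolding NP_def
    by (intro CollectI exI[of _ "\<lambda>x. exec Skip (init_store x) 1"] exI[of _ 0]) simp
qed

subsection \<open>Hardness\<close>

text \<open>A yes-instance is a string that encodes some suitable graph and bound; by injectivity of
  the encoding on simple graphs these are the given ones.\<close>

lemma vertex_cover_yes_iff:
  assumes "\<forall>G \<in> C. simple_graph G" "({..<n}, E) \<in> iso_closure C"
  shows "encode_graph n E k \<in> yes_instances (vertex_cover_problem C) \<longleftrightarrow>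
    min_vertex_cover_size ({..<n}, E) \<le> k"
  using assms encode_graph_eqD simple_graph_iso_closure[OF assms(1)]
  by (fastforce simp: vertex_cover_problem_def)

lemma MISP_yes_iff:
  assumes "\<forall>T \<in> \<T>. tournament T" "({..<n}, A) \<in> \<T>" "k \<ge> 1"
  shows "encode_digraph n A k \<in> yes_instances (MISP \<T>) \<longleftrightarrow>
    (\<exists>S. tournament_independent ({..<n}, A) S \<and> card S \<ge> k)"
  using assms encode_digraph_eqD by (fastforce simp: MISP_def)

lemma MISP_NP_hard:
  assumes C: "\<forall>G \<in> C. simple_graph G" and hard: "NP_hard (vertex_cover_problem C)"
  shows "NP_hard (MISP (tournaments_with_backedge_graph_in (graphs_plus C)))" (is "NP_hard (MISP ?\<T>)")
proof -
  let ?P = "vertex_cover_problem C"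
  have tour: "\<forall>T \<in> ?\<T>. tournament T" by (auto simp: tournaments_with_backedge_graph_in_def)
  have correct: "encode_digraph (2 * n) (spread_tournament n E) (Suc (2 * n - 1 - k)) \<in> instances (MISP ?\<T>) \<and>
      (encode_graph n E k \<in> yes_instances ?P \<longleftrightarrow>
       encode_digraph (2 * n) (spread_tournament n E) (Suc (2 * n - 1 - k)) \<in> yes_instances (MISP ?\<T>))"
    if "({..<n}, E) \<in> iso_closure C" "n > 0" for n E k
  proof
    note cl = spread_in_class[OF C that(1)]
    then show "encode_digraph (2 * n) (spread_tournament n E) (Suc (2 * n - 1 - k)) \<in> instances (MISP ?\<T>)"
      by (force simp: MISP_def)
    show "encode_graph n E k \<in> yes_instances ?P \<longleftrightarrow>
       encode_digraph (2 * n) (spread_tournament n E) (Suc (2 * n - 1 - k)) \<in> yes_instances (MISP ?\<T>)"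
      unfolding vertex_cover_yes_iff[OF C that(1)]
        spread_reduction_correct[OF simple_graph_iso_closure[OF C that(1)] that(2)]
      by (rule MISP_yes_iff[OF tour cl, symmetric]) simp
  qed
  have empty: "encode_graph n E k \<in> yes_instances ?P" if "({..<n}, E) \<in> iso_closure C" "n = 0" for n E k
  proof -
    have s: "simple_graph ({..<n}, E)" by (rule simple_graph_iso_closure[OF C that(1)])
    then have "E = {}" using that(2) by (auto simp: simple_graph_def)
    then have "vertex_cover ({..<n}, E) {}" by (auto simp: vertex_cover_def)
    then show ?thesis unfolding vertex_cover_yes_iff[OF C that(1)] min_vertex_cover_size_le_iff[OF s]
      by (intro exI[of _ "{}"]) simp
  qed
  \<comment> \<open>The empty graph is a yes-instance, but the empty tournament is not, so it is mapped to a fixed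
    yes-instance. One exists since the empty language reduces to vertex cover.\<close>
  obtain y where y: "y \<in> instances ?P" "y \<notin> yes_instances ?P"
    using bspec[OF hard[unfolded NP_hard_def] empty_in_NP] by auto
  obtain n0 E0 k0 where G0: "y = encode_graph n0 E0 k0" "({..<n0}, E0) \<in> iso_closure C"
    using y(1) by (auto simp: vertex_cover_problem_def)
  then have n0: "n0 > 0" using y(2) empty by (metis gr0I)
  \<comment> \<open>With \<open>n0\<close> as the bound, the whole vertex set is a small enough
    cover, so that the image is a yes-instance.\<close>
  define z where "z = encode_digraph (2 * n0) (spread_tournament n0 E0) (Suc (2 * n0 - 1 - n0))"
  have "encode_graph n0 E0 n0 \<in> yes_instances ?P"
  proof -
    have s: "simple_graph ({..<n0}, E0)" by (rule simple_graph_iso_closure[OF C G0(2)])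
    have "e \<inter> {..<n0} \<noteq> {}" if "e \<in> E0" for e
      using s that by (auto simp: simple_graph_def card_2_iff)
    then have "vertex_cover ({..<n0}, E0) {..<n0}" by (auto simp: vertex_cover_def)
    then show ?thesis unfolding vertex_cover_yes_iff[OF C G0(2)] min_vertex_cover_size_le_iff[OF s]
      by (intro exI[of _ "{..<n0}"]) simp
  qed
  then have z: "z \<in> instances (MISP ?\<T>)" "z \<in> yes_instances (MISP ?\<T>)"
    using correct[OF G0(2) n0, of n0] by (auto simp: z_def)
  show ?thesis unfolding NP_hard_def
  proof
    fix L assume "L \<in> NP"
    then obtain f where f: "polytime_computable f"
      "\<And>x. f x \<in> instances ?P \<and> (x \<in> L \<longleftrightarrow> f x \<in> yes_instances ?P)"
      using hard by (auto simp: NP_hard_def)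
    define h where "h = (\<lambda>x. exec (reduction z) (init_store (f x)) 1)"
    have "polytime_computable h"
      unfolding h_def by (rule polytime_computable_exec_comp[OF f(1) ok_reduction])
    moreover have "h x \<in> instances (MISP ?\<T>) \<and> (x \<in> L \<longleftrightarrow> h x \<in> yes_instances (MISP ?\<T>))" for x
    proof -
      obtain n E k where G: "f x = encode_graph n E k" "({..<n}, E) \<in> iso_closure C"
        using f(2)[of x] by (auto simp: vertex_cover_problem_def)
      have h: "h x = (if n = 0 then z else
          encode_digraph (2 * n) (spread_tournament n E) (Suc (2 * n - 1 - k)))"
        unfolding h_def G(1) encode_graph_def exec_reduction encode_spread_tournament ..
      show ?thesis
      proof (cases "n = 0")
        case True
        then show ?thesis using h z f(2)[of x] G empty by auto
      next
        case False
        then show ?thesis using h correct[OF G(2), of k] f(2)[of x] G(1) by auto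
      qed
    qed
    ultimately show "\<exists>f. polytime_computable f \<and> (\<forall>x. f x \<in> instances (MISP ?\<T>) \<and>
        (x \<in> L \<longleftrightarrow> f x \<in> yes_instances (MISP ?\<T>)))" by blast
  qed
qed

theorem theorem3p1p3:
  fixes C :: "graph set"
  assumes "\<forall>G \<in> C. simple_graph G"
    and "NP_complete (vertex_cover_problem C)"
  shows "NP_complete (MISP (tournaments_with_backedge_graph_in (graphs_plus C)))"
  using assms MISP_NP_hard MISP_in_NP
  by (auto simp: NP_complete_def tournaments_with_backedge_graph_in_def)

end
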